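(* Let $Q$ be a quadrilateral in the plane. The moment variety $\mathcal{M}_{[3]}(Q)$ is a hypersurface in $\mathbb{P}^9$, whose defining polynomial has $5100$ terms and $\mathbb{Z}^3$-degree $(18,12,12)$. It equals $$\begin{aligned}&2125764\,h^6+5484996\,m_{00}^2h^4s-1574640\,m_{00}gh^3+364500\,m_{00}^3h^3t+3458700\,m_{00}^4h^2s^2\\ &-2041200\,m_{00}^3ghs+472500\,m_{00}^5hst-122500\,m_{00}^6s^3+291600\,m_{00}^2g^2-135000\,m_{00}^4gt+15625\,m_{00}^6t^2,\end{aligned}$$ where the affine invariants $s,t,h,g$ are normalized to have content one and leading monomials $$s=m_{00}m_{02}m_{12}m_{30}+\cdots,\quad t=m_{00}^2m_{03}^2m_{30}^2+\cdots,\quad h=m_{00}m_{02}m_{20}+\cdots,\quad g=m_{00}^3m_{02}^3m_{30}^2+\cdots.$$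
   Context: Moment variety: for the combinatorial type of a quadrilateral with cyclically labeled vertices $x_1,x_2,x_3,x_4\in\mathbb{R}^2$, the moments $m_{ij}=\int w_1^iw_2^j\,d\mu_Q$ of the uniform probability distribution $\mu_Q$ on $Q$ are rational functions of the $4\times2$ matrix $X=(x_{kl})$ and extend to rational functions on $\mathbb{C}^{4\times 2}$. $\mathcal{M}_{[3]}(Q)\subset\mathbb{P}^9$ is the Zariski closure of the image of the rational map $\mathbb{C}^{4\times2}\dashrightarrow\mathbb{P}^9$, $X\mapsto(m_{ij}(X): i+j\le3)$. The $\mathbb{Z}^3$-grading is $\deg(m_{ij})=(1,i,j)$. Affine invariants: consider the ternary cubic $$f=m_{30}u_1^3+3m_{21}u_1^2u_2+3m_{20}u_1^2u_3+3m_{12}u_1u_2^2+6m_{11}u_1u_2u_3+3m_{10}u_1u_3^2+m_{03}u_2^3+3m_{02}u_2^2u_3+3m_{01}u_2u_3^2+m_{00}u_3^3 .$$ Let $S$ and $T$ be its Aronhold invariants, i.e. the (unique up to scalar) $\mathrm{SL}_3$-invariants of degree $4$ and $6$ in the coefficients $m_{ij}$. Let $H=\det(f_{ij})$ be the Hessian, with $f_{ij}=\partial^2f/\partial u_i\partial u_j$, and let $$G=\det\begin{pmatrix} f_{11} & f_{12} & f_{13} & h_1 \\ f_{12} & f_{22} & f_{23} & h_2 \\ f_{13} & f_{23} & f_{33} & h_3 \\ h_1 & h_2 & h_3 & 0 \end{pmatrix},\qquad h_i=\partial H/\partial u_i .$$ Then $s,t,h,g$ are, up to scaling, the polynomials in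 the $m_{ij}$ obtained from $S,T,H,G$, respectively, by substituting $(u_1,u_2,u_3)=(0,0,1)$. "Content one" means coprime integer coefficients, and the scaling is such that the displayed monomial occurs with coefficient $1$. *)

theory Defs
  imports "HOL-Analysis.Analysis" "HOL-Library.Poly_Mapping"
begin

section \<open>Multivariate polynomials\<close>

type_synonym ('v, 'a) mpoly = "('v \<Rightarrow>\<^sub>0 nat) \<Rightarrow>\<^sub>0 'a"

definition Const :: "'a::zero \<Rightarrow> ('v, 'a) mpoly"
  where "Const c = Poly_Mapping.single 0 c"

definition Var :: "'v \<Rightarrow> ('v, 'a::zero_neq_one) mpoly"
  where "Var x = Poly_Mapping.single (Poly_Mapping.single x 1) 1"

definition peval :: "('v \<Rightarrow> 'a::comm_semiring_1) \<Rightarrow> ('v, 'a) mpoly \<Rightarrow> 'a"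
  where "peval a p =
    (\<Sum>m\<in>Poly_Mapping.keys p.
      Poly_Mapping.lookup p m * (\<Prod>x\<in>Poly_Mapping.keys m. a x ^ Poly_Mapping.lookup m x))"

definition pdiff :: "'v \<Rightarrow> ('v, 'a::comm_semiring_1) mpoly \<Rightarrow> ('v, 'a) mpoly"
  where "pdiff x p =
    (\<Sum>m\<in>Poly_Mapping.keys p.
      Poly_Mapping.single (m - Poly_Mapping.single x 1)
        (of_nat (Poly_Mapping.lookup m x) * Poly_Mapping.lookup p m))"

definition wdeg :: "('v \<Rightarrow> nat) \<Rightarrow> ('v \<Rightarrow>\<^sub>0 nat) \<Rightarrow> nat"
  where "wdeg w m = (\<Sum>x\<in>Poly_Mapping.keys m. w x * Poly_Mapping.lookup m x)"

definition homogeneous :: "nat \<Rightarrow> ('v, 'a::zero) mpoly \<Rightarrow> bool"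
  where "homogeneous d p \<longleftrightarrow> (\<forall>m\<in>Poly_Mapping.keys p. wdeg (\<lambda>_. 1) m = d)"

text \<open>Coprime integer coefficients.\<close>
definition content_one :: "('v, complex) mpoly \<Rightarrow> bool"
  where "content_one p \<longleftrightarrow>
    (\<exists>c :: ('v \<Rightarrow>\<^sub>0 nat) \<Rightarrow> int.
      (\<forall>m. Poly_Mapping.lookup p m = of_int (c m)) \<and> Gcd (c ` UNIV) = 1)"


section \<open>The coordinates $m_{ij}$, $i + j \le 3$, and projective 9-space\<close>

datatype mvar = M00 | M10 | M01 | M20 | M11 | M02 | M30 | M21 | M12 | M03

fun expo :: "mvar \<Rightarrow> nat \<times> nat" where
  "expo M00 = (0, 0)"
| "expo M10 = (1, 0)"
| "expo M01 = (0, 1)"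
| "expo M20 = (2, 0)"
| "expo M11 = (1, 1)"
| "expo M02 = (0, 2)"
| "expo M30 = (3, 0)"
| "expo M21 = (2, 1)"
| "expo M12 = (1, 2)"
| "expo M03 = (0, 3)"

type_synonym moment_poly = "(mvar, complex) mpoly"

text \<open>The grading $\deg m_{ij} = (1, i, j)$, on monomials.\<close>
definition z3_degree :: "(mvar \<Rightarrow>\<^sub>0 nat) \<Rightarrow> nat \<times> nat \<times> nat"
  where "z3_degree m =
    (wdeg (\<lambda>_. 1) m, wdeg (\<lambda>x. fst (expo x)) m, wdeg (\<lambda>x. snd (expo x)) m)"

text \<open>A subset of projective 9-space is represented by the set of all nonzero vectors of
  homogeneous coordinates of its points. The argument of the closure may
  contain just one coordinate vector for each point; the result is stable under scaling.\<close>

definition proj_zeros :: "moment_poly set \<Rightarrow> (mvar \<Rightarrow> complex) set"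
  where "proj_zeros I = {v. v \<noteq> (\<lambda>_. 0) \<and> (\<forall>p\<in>I. peval v p = 0)}"

definition vanishing_ideal :: "(mvar \<Rightarrow> complex) set \<Rightarrow> moment_poly set"
  where "vanishing_ideal V = {p. \<forall>v\<in>V. peval v p = 0}"

definition proj_closure :: "(mvar \<Rightarrow> complex) set \<Rightarrow> (mvar \<Rightarrow> complex) set"
  where "proj_closure A = proj_zeros {p. (\<exists>d. homogeneous d p) \<and> (\<forall>v\<in>A. peval v p = 0)}"

text \<open>The defining polynomial generates the whole ideal of the hypersurface, and
  is thereby determined up to a nonzero scalar.\<close>
definition hypersurface_with_equation :: "(mvar \<Rightarrow> complex) set \<Rightarrow> moment_poly \<Rightarrow> bool"
  where "hypersurface_with_equation V F \<longleftrightarrow>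
    F \<noteq> 0 \<and> (\<exists>d>0. homogeneous d F) \<and> V = proj_zeros {F} \<and> vanishing_ideal V = {p. F dvd p}"


section \<open>The moment variety of quadrilaterals\<close>

text \<open>Row \<open>X $ k\<close> of the \<open>4 \<times> 2\<close> matrix is the vertex $x_k$. In the index type \<open>4\<close>
  arithmetic is modulo 4, so \<open>k + 1\<close> is the cyclic successor.\<close>
definition polygon :: "real^2^4 \<Rightarrow> (real^2) set"
  where "polygon X = convex hull (range (\<lambda>k. X $ k))"

definition quadrilateral :: "real^2^4 \<Rightarrow> bool"
  where "quadrilateral X \<longleftrightarrow>
    inj (\<lambda>k. X $ k) \<and>
    (\<forall>k. X $ k extreme_point_of polygon X) \<and>
    (\<forall>k. closed_segment (X $ k) (X $ (k + 1)) edge_of polygon X)"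

definition moment :: "nat \<times> nat \<Rightarrow> real^2^4 \<Rightarrow> real"
  where "moment e X =
    (LINT w|uniform_measure lborel (polygon X). (w $ 1) ^ fst e * (w $ 2) ^ snd e)"

text \<open>The rational function \<open>N / D\<close> on complex \<open>4 \<times> 2\<close> matrices restricts to the moment
  on real quadrilaterals. As these are Zariski dense, it is unique as a rational function.\<close>
definition extends_moment ::
    "nat \<times> nat \<Rightarrow> (4 \<times> 2, complex) mpoly \<Rightarrow> (4 \<times> 2, complex) mpoly \<Rightarrow> bool"
  where "extends_moment e N D \<longleftrightarrow>
    D \<noteq> 0 \<and>
    (\<forall>X. quadrilateral X \<longrightarrow>
      (let x = (\<lambda>(k, l). complex_of_real (X $ k $ l)) in
        peval x D \<noteq> 0 \<longrightarrow> complex_of_real (moment e X) = peval x N / peval x D))"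

text \<open>\<open>v\<close> is the value at \<open>X\<close> of the rational function extending the moment (which is
  regular at \<open>X\<close>).\<close>
definition moment_value :: "nat \<times> nat \<Rightarrow> complex^2^4 \<Rightarrow> complex \<Rightarrow> bool"
  where "moment_value e X v \<longleftrightarrow>
    (\<exists>N D. extends_moment e N D \<and>
      (let x = (\<lambda>(k, l). X $ k $ l) in peval x D \<noteq> 0 \<and> v = peval x N / peval x D))"

text \<open>Since $m_{00} = 1$ on the image, it consists of nonzero vectors.\<close>
definition moment_image :: "(mvar \<Rightarrow> complex) set"
  where "moment_image = {v. \<exists>X. \<forall>x. moment_value (expo x) X (v x)}"

definition moment_variety :: "(mvar \<Rightarrow> complex) set"
  where "moment_variety = proj_closure moment_image"


section \<open>Affine invariants\<close>

definition cubic :: "(mvar \<Rightarrow> 'a::comm_ring_1) \<Rightarrow> 'a^3 \<Rightarrow> 'a"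
  where "cubic m u =
      m M30 * (u$1)^3 + 3 * m M21 * (u$1)^2 * u$2 + 3 * m M20 * (u$1)^2 * u$3
    + 3 * m M12 * u$1 * (u$2)^2 + 6 * m M11 * u$1 * u$2 * u$3 + 3 * m M10 * u$1 * (u$3)^2
    + m M03 * (u$2)^3 + 3 * m M02 * (u$2)^2 * u$3 + 3 * m M01 * u$2 * (u$3)^2 + m M00 * (u$3)^3"

text \<open>The action of \<open>A\<close> on cubics is substitution; \<open>m'\<close> is the coefficient vector of
  the transformed cubic.\<close>
definition sl3_invariant :: "moment_poly \<Rightarrow> bool"
  where "sl3_invariant p \<longleftrightarrow>
    (\<forall>(A :: complex^3^3) m m'. det A = 1 \<longrightarrow> (\<forall>u. cubic m' u = cubic m (A *v u)) \<longrightarrow>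
      peval m' p = peval m p)"

text \<open>Polynomials in $u_1, u_2, u_3$ over the polynomial ring in the $m_{ij}$.\<close>
type_synonym ternary_form = "(3, moment_poly) mpoly"

definition gen_cubic :: ternary_form
  where "gen_cubic = cubic (\<lambda>x. Const (Var x)) (\<chi> i. Var i)"

definition cubic_dd :: "3 \<Rightarrow> 3 \<Rightarrow> ternary_form"
  where "cubic_dd i j = pdiff i (pdiff j gen_cubic)"

definition Hess :: ternary_form
  where "Hess = det (\<chi> i j. cubic_dd i j :: ternary_form^3^3)"

definition Hess_d :: "3 \<Rightarrow> ternary_form"
  where "Hess_d i = pdiff i Hess"

definition Bordered :: ternary_form
  where "Bordered = det (vector [
    vector [cubic_dd 1 1, cubic_dd 1 2, cubic_dd 1 3, Hess_d 1],
    vector [cubic_dd 1 2, cubic_dd 2 2, cubic_dd 2 3, Hess_d 2],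
    vector [cubic_dd 1 3, cubic_dd 2 3, cubic_dd 3 3, Hess_d 3],
    vector [Hess_d 1, Hess_d 2, Hess_d 3, 0]] :: ternary_form^4^4)"

definition at_001 :: "ternary_form \<Rightarrow> moment_poly"
  where "at_001 p = peval (\<lambda>i. (vector [0, 0, 1] :: moment_poly^3) $ i) p"

definition monom_of :: "mvar list \<Rightarrow> mvar \<Rightarrow>\<^sub>0 nat"
  where "monom_of xs = (\<Sum>x\<leftarrow>xs. Poly_Mapping.single x 1)"

definition affine_s :: "moment_poly \<Rightarrow> bool"
  where "affine_s s \<longleftrightarrow> sl3_invariant s \<and> homogeneous 4 s \<and>
    content_one s \<and> Poly_Mapping.lookup s (monom_of [M00, M02, M12, M30]) = 1"

definition affine_t :: "moment_poly \<Rightarrow> bool"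
  where "affine_t t \<longleftrightarrow> sl3_invariant t \<and> homogeneous 6 t \<and>
    content_one t \<and> Poly_Mapping.lookup t (monom_of [M00, M00, M03, M03, M30, M30]) = 1"

definition affine_h :: "moment_poly \<Rightarrow> bool"
  where "affine_h h \<longleftrightarrow> (\<exists>c. h = Const c * at_001 Hess) \<and>
    content_one h \<and> Poly_Mapping.lookup h (monom_of [M00, M02, M20]) = 1"

definition affine_g :: "moment_poly \<Rightarrow> bool"
  where "affine_g g \<longleftrightarrow> (\<exists>c. g = Const c * at_001 Bordered) \<and>
    content_one g \<and> Poly_Mapping.lookup g (monom_of [M00, M00, M00, M02, M02, M02, M30, M30]) = 1"

definition quad_equation ::
    "moment_poly \<Rightarrow> moment_poly \<Rightarrow> moment_poly \<Rightarrow> moment_poly \<Rightarrow> moment_poly"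
  where "quad_equation s t h g = (let m00 = Var M00 in
      2125764 * h^6 + 5484996 * m00^2 * h^4 * s - 1574640 * m00 * g * h^3
    + 364500 * m00^3 * h^3 * t + 3458700 * m00^4 * h^2 * s^2
    - 2041200 * m00^3 * g * h * s + 472500 * m00^5 * h * s * t - 122500 * m00^6 * s^3
    + 291600 * m00^2 * g^2 - 135000 * m00^4 * g * t + 15625 * m00^6 * t^2)"

end

theory Submission
  imports Defs "HOL-Computational_Algebra.Fundamental_Theorem_Algebra"
begin

text \<open>
  The proposed equation is \<open>F = U\<^sup>2 - s V\<^sup>2\<close>, where \<open>U\<close> and \<open>V\<close> are polynomials in $m_{00}$ and the affine
  invariants. Every quadrilateral is an affine image of one with vertices on the coordinate axes, where \<open>s\<close> is
  the square of a polynomial in the two ratios in which the diagonals cut each other, and \<open>F\<close> vanishes.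
  Conversely, a cubic with \<open>m\<^sub>0\<^sub>0 = 1\<close> and \<open>F = 0\<close> is, up to affine maps and under some open conditions, determined
  by its affine invariants, and solving for the two ratios shows that it comes from a (complex) quadrilateral.

  It remains to see that \<open>F\<close> divides every form \<open>p\<close> vanishing on the moments. For this \<open>p\<close> is divided
  by \<open>F\<close> with respect to a direction in which the leading coefficient of \<open>F\<close> is constant. On one explicit line in
  this direction \<open>F\<close> has eighteen distinct zeros, all of which satisfy the open conditions. This persists
  on all nearby lines, so that the remainder, being of degree less than eighteen, vanishes there, and hence
  everywhere.

  Since \<open>F\<close> is homogeneous for the $\mathbb{Z}^3$-grading, its terms can be counted after setting three suitable
  variables to \<open>1\<close>, by computing with iterated coefficient lists.

  The Aronhold invariants are explicit polynomials whose invariance is checked on transvections; they are unique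
  because each $\mathrm{SL}_3$-orbit of ternary cubics meets a small linear space.
\<close>

subsection \<open>Multivariate polynomials\<close>

text \<open>Origin of \<open>U\<close> and \<open>V\<close>: modulo affine maps and with
  \<open>m00 = 1\<close>, a quadrilateral has two parameters, in which \<open>h\<close>,
  \<open>g\<close> and a square root z of \<open>s\<close> are polynomials. On this normal form
  \<open>t\<close> is a polynomial in \<open>h\<close>, \<open>g\<close> and z; collecting the part
  odd in z turns this relation into \<open>U = z V\<close>. Multiplying by the conjugate, (U - z V)
  (U + z V) removes the square root. Conversely \<open>U / V\<close> recovers z where
  \<open>V\<close> is nonzero, which explains one of the open conditions. The obstacle is the whole
  ideal: knowing the zero set generically does not exclude repeated factors or further components.
  Both are excluded by counting on one line: simple zeros rule out repeated factors, and the open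
  conditions at every zero rule out components consisting of other cubics. This count stands in for
  irreducibility. The moment image is defined through arbitrary fractions extending the moments. Its
  inclusion in the hypersurface therefore rests on the density of the real quadrilaterals, whereas
  the reverse inclusion uses one explicit fraction.\<close>

locale semiring_hom =
  fixes \<phi> :: "'a::comm_semiring_1 \<Rightarrow> 'b::comm_semiring_1"
  assumes hom_zero: "\<phi> 0 = 0" and hom_one: "\<phi> 1 = 1"
    and hom_add: "\<phi> (x + y) = \<phi> x + \<phi> y" and hom_mult: "\<phi> (x * y) = \<phi> x * \<phi> y"

lemma semiring_hom_id: "semiring_hom (\<lambda>x. x)"
  by unfold_locales auto

definition meval :: "('v \<Rightarrow> 'b::comm_semiring_1) \<Rightarrow> ('v \<Rightarrow>\<^sub>0 nat) \<Rightarrow> 'b"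
  where "meval a m = (\<Prod>x\<in>Poly_Mapping.keys m. a x ^ Poly_Mapping.lookup m x)"

text \<open>One evaluation map for three uses: with the identity it is \<open>peval\<close>, with
  \<open>Const\<close> it substitutes polynomials for the variables, and with the embedding
  \<open>[:Const c:]\<close> it restricts to lines.\<close>

definition heval ::
    "('a::comm_semiring_1 \<Rightarrow> 'b::comm_semiring_1) \<Rightarrow> ('v \<Rightarrow> 'b) \<Rightarrow> ('v, 'a) mpoly \<Rightarrow> 'b"
  where "heval \<phi> a p =
    (\<Sum>m\<in>Poly_Mapping.keys p. \<phi> (Poly_Mapping.lookup p m) * meval a m)"

lemma peval_eq_heval: "peval a p = heval (\<lambda>x. x) a p"
  by (simp add: peval_def heval_def meval_def)

lemma keys_nat_add:
  "Poly_Mapping.keys (m + n) = Poly_Mapping.keys m \<union> Poly_Mapping.keys (n :: 'v \<Rightarrow>\<^sub>0 nat)"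
  by (auto simp: in_keys_iff lookup_add)

lemma meval_superset:
  assumes "finite S" "Poly_Mapping.keys m \<subseteq> S"
  shows "meval a m = (\<Prod>x\<in>S. a x ^ Poly_Mapping.lookup m x)"
  unfolding meval_def using assms
  by (intro prod.mono_neutral_left) (auto simp: in_keys_iff)

lemma meval_add: "meval a (m + n) = meval a m * meval a n"
proof -
  let ?S = "Poly_Mapping.keys m \<union> Poly_Mapping.keys n"
  have "meval a (m + n) = (\<Prod>x\<in>?S. a x ^ Poly_Mapping.lookup (m + n) x)"
    by (rule meval_superset) (auto simp: keys_nat_add)
  also have "\<dots> = meval a m * meval a n"
    by (simp add: meval_superset[where S = ?S] lookup_add power_add prod.distrib)
  finally show ?thesis .
qed

lemma meval_zero [simp]: "meval a 0 = 1"
  by (simp add: meval_def)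

lemma meval_single [simp]: "meval a (Poly_Mapping.single x k) = a x ^ k"
  by (cases "k = 0") (auto simp: meval_def)

lemma poly_mapping_sum_singles:
  "(\<Sum>m\<in>Poly_Mapping.keys p. Poly_Mapping.single m (Poly_Mapping.lookup p m)) = p"
proof (rule poly_mapping_eqI)
  fix k
  show "Poly_Mapping.lookup
      (\<Sum>m\<in>Poly_Mapping.keys p. Poly_Mapping.single m (Poly_Mapping.lookup p m)) k =
      Poly_Mapping.lookup p k"
    by (auto simp: lookup_sum lookup_single when_def in_keys_iff)
qed

lemma mpoly_induct_single [case_names single add]:
  fixes p :: "'k \<Rightarrow>\<^sub>0 'a::comm_monoid_add"
  assumes "\<And>m c. P (Poly_Mapping.single m c)" and "\<And>p q. P p \<Longrightarrow> P q \<Longrightarrow> P (p + q)"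
  shows "P p"
proof -
  have "P (\<Sum>m\<in>A. Poly_Mapping.single m (Poly_Mapping.lookup p m))" if "finite A" for A
    using that
  proof (induction A rule: finite_induct)
    case empty
    show ?case using assms(1)[of _ 0] by simp
  qed (auto intro: assms)
  from this[of "Poly_Mapping.keys p"] show ?thesis
    by (simp add: poly_mapping_sum_singles)
qed

lemma single_eq_Const_mult:
  "Poly_Mapping.single m c = Const c * Poly_Mapping.single m (1::'a::comm_semiring_1)"
  by (simp add: Const_def mult_single)

lemma Var_power: "Var x ^ k = (Poly_Mapping.single (Poly_Mapping.single x k) 1 :: ('v, 'a::comm_semiring_1) mpoly)"
proof (induction k)
  case 0
  show ?case by (simp add: single_one)
next
  case (Suc k)
  then show ?case
    by (simp add: Var_def mult_single flip: single_add)
qed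

lemma mpoly_induct [case_names Const Var add mult]:
  fixes P :: "('v, 'a::comm_semiring_1) mpoly \<Rightarrow> bool"
  assumes C: "\<And>c. P (Const c)" and V: "\<And>x. P (Var x)"
    and A: "\<And>p q. P p \<Longrightarrow> P q \<Longrightarrow> P (p + q)" and M: "\<And>p q. P p \<Longrightarrow> P q \<Longrightarrow> P (p * q)"
  shows "P p"
proof (induction p rule: mpoly_induct_single)
  case (single m c)
  have one: "P 1" using C[of 1] by (simp add: Const_def)
  have pw: "P (Var x ^ k)" for x k
    by (induction k) (auto simp: one intro: M V)
  have "P (Poly_Mapping.single m 1)"
  proof (induction m rule: mpoly_induct_single)
    case (single x k)
    show ?case using pw[of x k] by (simp add: Var_power)
  next
    case (add m n)
    then show ?case using M[OF add] by (simp add: mult_single)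
  qed
  then show ?case
    by (subst single_eq_Const_mult) (rule M[OF C])
qed (rule A)

context semiring_hom
begin

lemma heval_superset:
  assumes "finite S" "Poly_Mapping.keys p \<subseteq> S"
  shows "heval \<phi> a p = (\<Sum>m\<in>S. \<phi> (Poly_Mapping.lookup p m) * meval a m)"
  unfolding heval_def using assms
  by (intro sum.mono_neutral_left) (auto simp: in_keys_iff hom_zero)

lemma heval_add: "heval \<phi> a (p + q) = heval \<phi> a p + heval \<phi> a q"
proof -
  let ?S = "Poly_Mapping.keys p \<union> Poly_Mapping.keys q"
  have "heval \<phi> a (p + q) = (\<Sum>m\<in>?S. \<phi> (Poly_Mapping.lookup (p + q) m) * meval a m)"
    by (rule heval_superset) (auto simp: Poly_Mapping.keys_add)
  also have "\<dots> = heval \<phi> a p + heval \<phi> a q"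
    by (simp add: heval_superset[where S = ?S] lookup_add hom_add distrib_right sum.distrib)
  finally show ?thesis .
qed

lemma heval_single: "heval \<phi> a (Poly_Mapping.single m c) = \<phi> c * meval a m"
  by (cases "c = 0") (auto simp: heval_def hom_zero)

lemma heval_mult: "heval \<phi> a (p * q) = heval \<phi> a p * heval \<phi> a q"
proof (induction p rule: mpoly_induct_single)
  case (single m c)
  show ?case
  proof (induction q rule: mpoly_induct_single)
    case (single n d)
    show ?case
      by (simp add: mult_single heval_single meval_add hom_mult algebra_simps)
  qed (simp add: heval_add distrib_left)
qed (simp add: heval_add distrib_right)

lemma heval_Const [simp]: "heval \<phi> a (Const c) = \<phi> c"
  by (simp add: Const_def heval_single)

lemma heval_Var [simp]: "heval \<phi> a (Var x) = a x"
  by (simp add: Var_def heval_single hom_one)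

lemma heval_zero [simp]: "heval \<phi> a 0 = 0"
  by (simp add: heval_def)

lemma heval_one [simp]: "heval \<phi> a 1 = 1"
  using heval_Const[of a 1] by (simp add: Const_def hom_one del: heval_Const)

lemma heval_power: "heval \<phi> a (p ^ k) = heval \<phi> a p ^ k"
  by (induction k) (simp_all add: heval_mult)

lemma heval_of_nat: "heval \<phi> a (of_nat k) = of_nat k"
  by (induction k) (simp_all add: heval_add)

lemma heval_numeral [simp]: "heval \<phi> a (numeral k) = numeral k"
  using heval_of_nat[of a "numeral k"] by simp

lemma heval_sum: "heval \<phi> a (\<Sum>i\<in>I. f i) = (\<Sum>i\<in>I. heval \<phi> a (f i))"
  by (induction I rule: infinite_finite_induct) (auto simp: heval_add)

lemma heval_sum_list: "heval \<phi> a (sum_list ps) = (\<Sum>p\<leftarrow>ps. heval \<phi> a p)"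
  by (induction ps) (simp_all add: heval_add)

end

lemma heval_uminus:
  fixes \<phi> :: "'a::comm_ring_1 \<Rightarrow> 'b::comm_ring_1"
  assumes "semiring_hom \<phi>"
  shows "heval \<phi> a (- p) = - heval \<phi> a p"
proof -
  interpret semiring_hom \<phi> by fact
  have "heval \<phi> a (- p) + heval \<phi> a p = 0"
    by (simp flip: heval_add)
  then show ?thesis by (simp add: add_eq_0_iff2)
qed

lemma heval_diff:
  fixes \<phi> :: "'a::comm_ring_1 \<Rightarrow> 'b::comm_ring_1"
  assumes "semiring_hom \<phi>"
  shows "heval \<phi> a (p - q) = heval \<phi> a p - heval \<phi> a q"
  using semiring_hom.heval_add[OF assms, of a p "- q"] heval_uminus[OF assms, of a q] by simp

interpretation peval: semiring_hom "\<lambda>x. x"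
  by (rule semiring_hom_id)

lemma peval_add [simp]: "peval a (p + q) = peval a p + peval a q"
  and peval_mult [simp]: "peval a (p * q) = peval a p * peval a q"
  and peval_Const [simp]: "peval a (Const c) = c"
  and peval_Var [simp]: "peval a (Var x) = a x"
  and peval_zero [simp]: "peval a 0 = 0"
  and peval_one [simp]: "peval a 1 = 1"
  and peval_numeral [simp]: "peval a (numeral k) = numeral k"
  and peval_power [simp]: "peval a (p ^ j) = peval a p ^ j"
  and peval_sum: "peval a (\<Sum>i\<in>I. f i) = (\<Sum>i\<in>I. peval a (f i))"
  and peval_sum_list: "peval a (sum_list ps) = (\<Sum>p\<leftarrow>ps. peval a p)"
  by (simp_all add: peval_eq_heval peval.heval_add peval.heval_mult peval.heval_power
      peval.heval_sum peval.heval_sum_list)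

lemma peval_uminus [simp]: "peval a (- p) = - peval a (p :: ('v, 'a::comm_ring_1) mpoly)"
  and peval_diff [simp]: "peval a (p - q) = peval a p - peval a (q :: ('v, 'a::comm_ring_1) mpoly)"
  by (simp_all add: peval_eq_heval heval_uminus heval_diff semiring_hom_id)

lemma Const_add: "Const (a + b) = Const a + Const b"
  and Const_mult: "Const (a * b) = Const a * Const b"
  and Const_0 [simp]: "Const 0 = 0"
  and Const_1 [simp]: "Const 1 = 1"
  by (simp_all add: Const_def single_add mult_single)

lemma Const_uminus: "Const (- a :: 'a::comm_ring_1) = - Const a"
  by (simp add: Const_def single_uminus)

lemma Const_numeral [simp]: "Const (numeral k) = numeral k"
  by (simp add: Const_def)

lemma lookup_Const_mult:
  fixes p :: "('v, 'a::comm_semiring_1) mpoly"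
  shows "Poly_Mapping.lookup (Const c * p) m = c * Poly_Mapping.lookup p m"
  by (induction p rule: mpoly_induct_single)
    (auto simp: Const_def mult_single distrib_left lookup_add lookup_single when_def)

lemma semiring_hom_Const: "semiring_hom Const"
  by unfold_locales (auto simp: Const_add Const_mult)

subsection \<open>Weighted gradings\<close>

lemma wdeg_superset:
  assumes "finite S" "Poly_Mapping.keys m \<subseteq> S"
  shows "wdeg w m = (\<Sum>x\<in>S. w x * Poly_Mapping.lookup m x)"
  unfolding wdeg_def using assms
  by (intro sum.mono_neutral_left) (auto simp: in_keys_iff)

lemma wdeg_add: "wdeg w (m + n) = wdeg w m + wdeg w n"
proof -
  let ?S = "Poly_Mapping.keys m \<union> Poly_Mapping.keys n"
  have "wdeg w (m + n) = (\<Sum>x\<in>?S. w x * Poly_Mapping.lookup (m + n) x)"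
    by (rule wdeg_superset) (auto simp: keys_nat_add)
  also have "\<dots> = wdeg w m + wdeg w n"
    by (simp add: wdeg_superset[where S = ?S] lookup_add algebra_simps sum.distrib)
  finally show ?thesis .
qed

lemma wdeg_zero [simp]: "wdeg w 0 = 0"
  by (simp add: wdeg_def)

lemma wdeg_single [simp]: "wdeg w (Poly_Mapping.single x k) = w x * k"
  by (cases "k = 0") (auto simp: wdeg_def)

lemma meval_weighted: "meval (\<lambda>x. c ^ w x * a x) m = c ^ wdeg w m * meval a m"
  by (induction m rule: mpoly_induct_single)
    (simp_all add: meval_add wdeg_add power_add power_mult_distrib mult.left_commute mult.assoc
      flip: power_mult)

definition whomogeneous :: "('v \<Rightarrow> nat) \<Rightarrow> nat \<Rightarrow> ('v, 'a::zero) mpoly \<Rightarrow> bool"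
  where "whomogeneous w d p \<longleftrightarrow> (\<forall>m\<in>Poly_Mapping.keys p. wdeg w m = d)"

lemma homogeneous_iff_whomogeneous: "homogeneous d p \<longleftrightarrow> whomogeneous (\<lambda>_. 1) d p"
  by (simp add: homogeneous_def whomogeneous_def)

lemma whomogeneous_add:
  "whomogeneous w d p \<Longrightarrow> whomogeneous w d q \<Longrightarrow> whomogeneous w d (p + q)"
  unfolding whomogeneous_def using Poly_Mapping.keys_add[of p q] by blast

lemma whomogeneous_uminus:
  "whomogeneous w d p \<Longrightarrow> whomogeneous w d (- p :: ('v, 'a::ab_group_add) mpoly)"
  unfolding whomogeneous_def by (simp add: in_keys_iff)

lemma whomogeneous_diff:
  "whomogeneous w d p \<Longrightarrow> whomogeneous w d q \<Longrightarrow>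
    whomogeneous w d (p - q :: ('v, 'a::ab_group_add) mpoly)"
  using whomogeneous_add[of w d p "- q"] whomogeneous_uminus[of w d q] by simp

lemma whomogeneous_Const: "whomogeneous w 0 (Const c)"
  by (simp add: whomogeneous_def Const_def)

lemma peval_weighted:
  assumes "whomogeneous w d p"
  shows "peval (\<lambda>x. c ^ w x * a x) p = c ^ d * peval a p"
proof -
  have "peval (\<lambda>x. c ^ w x * a x) p =
      (\<Sum>m\<in>Poly_Mapping.keys p. c ^ d * (Poly_Mapping.lookup p m * meval a m))"
    unfolding peval_eq_heval heval_def using assms
    by (intro sum.cong) (auto simp: whomogeneous_def meval_weighted mult.left_commute)
  then show ?thesis
    by (simp add: peval_eq_heval heval_def sum_distrib_left)
qed

definition wcomponent :: "('v \<Rightarrow> nat) \<Rightarrow> nat \<Rightarrow> ('v, 'a::comm_semiring_1) mpoly \<Rightarrow> ('v, 'a) mpoly"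
  where "wcomponent w d p =
    (\<Sum>m\<in>{m \<in> Poly_Mapping.keys p. wdeg w m = d}. Poly_Mapping.single m (Poly_Mapping.lookup p m))"

lemma lookup_wcomponent:
  "Poly_Mapping.lookup (wcomponent w d p) m =
    (if wdeg w m = d then Poly_Mapping.lookup p m else 0)"
  by (auto simp: wcomponent_def lookup_sum lookup_single when_def in_keys_iff)

lemma keys_wcomponent:
  "Poly_Mapping.keys (wcomponent w d p) = {m \<in> Poly_Mapping.keys p. wdeg w m = d}"
  by (auto simp: in_keys_iff lookup_wcomponent split: if_splits)

lemma whomogeneous_wcomponent: "whomogeneous w d (wcomponent w d p)"
  by (simp add: whomogeneous_def keys_wcomponent)

lemma sum_wcomponent:
  assumes "wdeg w ` Poly_Mapping.keys p \<subseteq> A" "finite A"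
  shows "(\<Sum>d\<in>A. wcomponent w d p) = p"
proof (rule poly_mapping_eqI)
  fix m
  show "Poly_Mapping.lookup (\<Sum>d\<in>A. wcomponent w d p) m = Poly_Mapping.lookup p m"
    using assms by (cases "m \<in> Poly_Mapping.keys p") (auto simp: lookup_sum lookup_wcomponent in_keys_iff)
qed

text \<open>Along the curve \<open>t ^ w x * a x\<close> the value of \<open>p\<close> is a
  polynomial in \<open>t\<close> whose coefficients are the values of the weighted components at
  \<open>a\<close>; infinitely many zeros make all of them vanish.\<close>

lemma wcomponent_vanishes:
  fixes p :: "('v, complex) mpoly"
  assumes "infinite T" and "\<And>t. t \<in> T \<Longrightarrow> peval (\<lambda>x. t ^ w x * a x) p = 0"
  shows "peval a (wcomponent w d p) = 0"
proof -
  let ?A = "wdeg w ` Poly_Mapping.keys p"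
  define q where "q = (\<Sum>d\<in>?A. monom (peval a (wcomponent w d p)) d)"
  have "poly q t = peval (\<lambda>x. t ^ w x * a x) p" for t
  proof -
    have "peval (\<lambda>x. t ^ w x * a x) p = (\<Sum>d\<in>?A. peval (\<lambda>x. t ^ w x * a x) (wcomponent w d p))"
      by (subst sum_wcomponent[where A = ?A and w = w and p = p, symmetric]) (simp_all only: peval_sum finite_imageI finite_keys order_refl)
    also have "\<dots> = poly q t"
      unfolding peval_weighted[OF whomogeneous_wcomponent]
      by (simp add: q_def poly_sum poly_monom mult.commute)
    finally show ?thesis by simp
  qed
  with assms have "q = 0"
    using poly_roots_finite[of q] by (metis (mono_tags, lifting) finite_subset mem_Collect_eq subsetI)
  show ?thesis
  proof (cases "d \<in> ?A")
    case True
    have "coeff q d = peval a (wcomponent w d p)"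
      using True by (simp add: q_def coeff_sum coeff_monom)
    with \<open>q = 0\<close> show ?thesis by simp
  next
    case False
    then have "wcomponent w d p = 0"
      by (intro poly_mapping_eqI) (auto simp: lookup_wcomponent in_keys_iff)
    then show ?thesis by simp
  qed
qed

section \<open>Polynomials are determined by their values\<close>

lemma poly_mapping_nat_neqD: "m \<noteq> n \<Longrightarrow> \<exists>x. Poly_Mapping.lookup m x \<noteq> Poly_Mapping.lookup n x"
  using poly_mapping_eqI by metis

lemma wdeg_indicator: "wdeg (\<lambda>y. if y = x then 1 else 0) m = Poly_Mapping.lookup m x"
proof -
  have "wdeg (\<lambda>y. if y = x then 1 else 0) m = (\<Sum>y\<in>Poly_Mapping.keys m. if y = x then Poly_Mapping.lookup m y else 0)"
    unfolding wdeg_def by (intro sum.cong) auto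
  also have "\<dots> = Poly_Mapping.lookup m x"
    by (simp add: in_keys_iff)
  finally show ?thesis .
qed

text \<open>Induction on the number of terms: two monomials differ in the exponent of some
  \<open>x\<close>, and sorting by that exponent isolates a shorter polynomial that still vanishes
  everywhere but contains a term of \<open>p\<close>.\<close>

lemma peval_eq_0_imp_zero:
  fixes p :: "('v, complex) mpoly"
  assumes "\<And>a. peval a p = 0"
  shows "p = 0"
  using assms
proof (induction "card (Poly_Mapping.keys p)" arbitrary: p rule: less_induct)
  case less
  show ?case
  proof (rule ccontr)
    assume "p \<noteq> 0"
    then obtain m where m: "m \<in> Poly_Mapping.keys p"
      by (metis all_not_in_conv keys_eq_empty)
    show False
    proof (cases "Poly_Mapping.keys p = {m}")
      case True
      have "peval (\<lambda>_. 1) p = Poly_Mapping.lookup p m"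
        using True by (simp add: peval_def)
      with less.prems m show False by (auto simp: in_keys_iff)
    next
      case False
      with m obtain n where n: "n \<in> Poly_Mapping.keys p" "n \<noteq> m" by blast
      then obtain x where x: "Poly_Mapping.lookup n x \<noteq> Poly_Mapping.lookup m x"
        using poly_mapping_nat_neqD by blast
      let ?w = "\<lambda>y. if y = x then 1 else 0 :: nat"
      let ?q = "wcomponent ?w (Poly_Mapping.lookup m x) p"
      have "Poly_Mapping.keys ?q \<subset> Poly_Mapping.keys p"
        using n(1) x by (auto simp: keys_wcomponent wdeg_indicator)
      then have "card (Poly_Mapping.keys ?q) < card (Poly_Mapping.keys p)"
        by (intro psubset_card_mono) auto
      moreover have "peval a ?q = 0" for a
        by (rule wcomponent_vanishes[where T = UNIV]) (auto simp: less.prems infinite_UNIV_char_0)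
      ultimately have "?q = 0" by (rule less.hyps)
      moreover have "m \<in> Poly_Mapping.keys ?q"
        using m by (simp add: keys_wcomponent wdeg_indicator)
      ultimately show False by simp
    qed
  qed
qed

lemma peval_inject:
  fixes p q :: "('v, complex) mpoly"
  shows "(\<And>a. peval a p = peval a q) \<Longrightarrow> p = q"
  using peval_eq_0_imp_zero[of "p - q"] by simp

text \<open>The coordinates are released from their sets \<open>S x\<close> one at a time.\<close>

lemma peval_box_vanishes:
  fixes p :: "('v::finite, complex) mpoly"
  assumes inf: "\<And>x. infinite (S x)" and van: "\<And>a. (\<And>x. a x \<in> S x) \<Longrightarrow> peval a p = 0"
  shows "p = 0"
proof (rule peval_eq_0_imp_zero)
  have "peval a p = 0" if "finite A" "\<And>x. x \<notin> A \<Longrightarrow> a x \<in> S x" for A a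
    using that
  proof (induction A arbitrary: a rule: finite_induct)
    case empty
    then show ?case by (simp add: van)
  next
    case (insert y A)
    \<comment> \<open>This weight counts the exponent of \<open>y\<close> only, so after the value
      at \<open>y\<close> has been set to 1, scaling by \<open>t\<close> puts \<open>t\<close>
      there.\<close>
    let ?w = "\<lambda>x. if x = y then 1 else 0 :: nat"
    have comp: "peval (a(y := 1)) (wcomponent ?w d p) = 0" for d
    proof (rule wcomponent_vanishes[where T = "S y"])
      fix t assume "t \<in> S y"
      have "(\<lambda>x. t ^ ?w x * (a(y := 1)) x) = a(y := t)" by auto
      then show "peval (\<lambda>x. t ^ ?w x * (a(y := 1)) x) p = 0"
        using insert.prems \<open>t \<in> S y\<close> by (simp only:) (rule insert.IH, auto)
    qed (rule inf)
    have "a = (\<lambda>x. a y ^ ?w x * (a(y := 1)) x)" by auto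
    then have "peval a p = peval (\<lambda>x. a y ^ ?w x * (a(y := 1)) x) p" by metis
    also have "\<dots> = (\<Sum>d\<in>wdeg ?w ` Poly_Mapping.keys p. peval (\<lambda>x. a y ^ ?w x * (a(y := 1)) x) (wcomponent ?w d p))"
      by (subst sum_wcomponent[where A = "wdeg ?w ` Poly_Mapping.keys p" and w = ?w and p = p, symmetric])
        (simp_all only: peval_sum finite_imageI finite_keys order_refl)
    also have "\<dots> = 0"
      by (intro sum.neutral ballI) (simp only: peval_weighted[OF whomogeneous_wcomponent] comp mult_zero_right)
    finally show ?case .
  qed
  from this[of UNIV] show "peval a p = 0" for a by simp
qed

text \<open>The converse of \<open>peval_weighted\<close>: both sides are polynomials in
  \<open>t\<close> that agree for nonzero \<open>t\<close>, so comparing coefficients leaves degree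
  \<open>d\<close> only.\<close>

lemma whomogeneousI_scaling:
  fixes p :: "('v, complex) mpoly"
  assumes "\<And>t a. t \<noteq> 0 \<Longrightarrow> peval (\<lambda>x. t ^ w x * a x) p = t ^ d * peval a p"
  shows "whomogeneous w d p"
  unfolding whomogeneous_def
proof (rule ballI, rule ccontr)
  fix m assume m: "m \<in> Poly_Mapping.keys p" and ne: "wdeg w m \<noteq> d"
  let ?A = "wdeg w ` Poly_Mapping.keys p"
  have "peval a (wcomponent w (wdeg w m) p) = 0" for a
  proof -
    define q where "q = (\<Sum>e\<in>?A. monom (peval a (wcomponent w e p)) e)"
    have "poly q t = poly (monom (peval a p) d) t" if "t \<noteq> 0" for t
    proof -
      have "t ^ d * peval a p = peval (\<lambda>x. t ^ w x * a x) p" by (rule assms[OF that, symmetric])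
      also have "\<dots> = (\<Sum>e\<in>?A. peval (\<lambda>x. t ^ w x * a x) (wcomponent w e p))"
        by (subst sum_wcomponent[where A = ?A and w = w and p = p, symmetric]) (simp_all only: peval_sum finite_imageI finite_keys order_refl)
      also have "\<dots> = poly q t"
        unfolding peval_weighted[OF whomogeneous_wcomponent]
        by (simp add: q_def poly_sum poly_monom mult.commute)
      finally show ?thesis by (simp add: poly_monom mult.commute)
    qed
    then have "- {0} \<subseteq> {t. poly (q - monom (peval a p) d) t = 0}" by auto
    moreover have "infinite (- {0 :: complex})"
      by (simp add: infinite_UNIV_char_0 Compl_eq_Diff_UNIV)
    ultimately have "q - monom (peval a p) d = 0"
      using poly_roots_finite finite_subset by blast
    then have "q = monom (peval a p) d" by simp
    then have "coeff q (wdeg w m) = 0" using ne by simp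
    then show ?thesis using m by (simp add: q_def coeff_sum)
  qed
  then have "wcomponent w (wdeg w m) p = 0" by (rule peval_eq_0_imp_zero)
  moreover have "m \<in> Poly_Mapping.keys (wcomponent w (wdeg w m) p)"
    using m by (simp add: keys_wcomponent)
  ultimately show False by simp
qed

text \<open>Setting variables to 0 deletes exactly the monomials containing them, which makes single
  coefficients of large polynomials readable without expansion.\<close>

lemma lookup_restrict:
  fixes p :: "('v, 'a::comm_semiring_1) mpoly"
  assumes "Poly_Mapping.keys m \<subseteq> A"
  shows "Poly_Mapping.lookup (heval Const (\<lambda>x. if x \<in> A then Var x else 0) p) m = Poly_Mapping.lookup p m"
proof -
  interpret C: semiring_hom "Const :: 'a \<Rightarrow> ('v, 'a) mpoly" by (rule semiring_hom_Const)
  let ?\<sigma> = "\<lambda>x. if x \<in> A then Var x else 0 :: ('v, 'a) mpoly"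
  have mev: "meval ?\<sigma> n = (if Poly_Mapping.keys n \<subseteq> A then Poly_Mapping.single n 1 else 0)" for n
  proof (induction n rule: mpoly_induct_single)
    case (single x k)
    then show ?case by (cases "k = 0") (auto simp: Var_power zero_power)
  qed (auto simp: meval_add keys_nat_add mult_single)
  show ?thesis
  proof (induction p rule: mpoly_induct_single)
    case (single n c)
    show ?case using assms
      unfolding C.heval_single mev
      by (auto simp: Const_def mult_single lookup_single when_def)
  qed (simp add: C.heval_add lookup_add)
qed

section \<open>Integer coefficients and content one\<close>

definition int_coeffs :: "('v, complex) mpoly \<Rightarrow> bool"
  where "int_coeffs p \<longleftrightarrow> (\<forall>m. Poly_Mapping.lookup p m \<in> \<int>)"

lemma int_coeffs_single: "c \<in> \<int> \<Longrightarrow> int_coeffs (Poly_Mapping.single m c)"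
  by (simp add: int_coeffs_def lookup_single when_def)

lemma int_coeffs_add [intro]: "int_coeffs p \<Longrightarrow> int_coeffs q \<Longrightarrow> int_coeffs (p + q)"
  by (simp add: int_coeffs_def lookup_add)

lemma int_coeffs_diff [intro]: "int_coeffs p \<Longrightarrow> int_coeffs q \<Longrightarrow> int_coeffs (p - q)"
  by (simp add: int_coeffs_def lookup_minus)

lemma int_coeffs_mult [intro]:
  assumes "int_coeffs p" "int_coeffs q"
  shows "int_coeffs (p * q)"
proof -
  have "p * q = (\<Sum>m\<in>Poly_Mapping.keys p. \<Sum>n\<in>Poly_Mapping.keys q.
      Poly_Mapping.single (m + n) (Poly_Mapping.lookup p m * Poly_Mapping.lookup q n))"
    by (subst poly_mapping_sum_singles[of p, symmetric], subst poly_mapping_sum_singles[of q, symmetric])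
      (simp add: sum_product mult_single)
  then show ?thesis
    using assms by (auto simp: int_coeffs_def lookup_sum lookup_single when_def intro!: Ints_sum)
qed

lemma int_coeffs_Var [intro]: "int_coeffs (Var x)"
  unfolding Var_def by (rule int_coeffs_single) simp

lemma int_coeffs_numeral [intro]: "int_coeffs (numeral k)"
  using int_coeffs_single[of "numeral k" 0] by simp

lemma int_coeffs_one [intro]: "int_coeffs 1"
  using int_coeffs_single[of 1 0] by simp

lemma int_coeffs_power [intro]: "int_coeffs p \<Longrightarrow> int_coeffs (p ^ k)"
  by (induction k) auto

lemma content_oneI:
  assumes "int_coeffs p" "Poly_Mapping.lookup p m = 1"
  shows "content_one p"
proof -
  define c where "c = (\<lambda>m. \<lfloor>Re (Poly_Mapping.lookup p m)\<rfloor>)"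
  have c: "Poly_Mapping.lookup p n = of_int (c n)" for n
    using assms(1) by (auto simp: int_coeffs_def c_def elim!: Ints_cases dest!: spec[of _ n])
  have "c m = 1" using assms(2) by (simp add: c_def)
  then have "1 \<in> c ` UNIV" by (metis rangeI)
  then have "Gcd (c ` UNIV) dvd 1" by (rule Gcd_dvd)
  then have "Gcd (c ` UNIV) = 1"
    by (metis Gcd_int_greater_eq_0 abs_of_nonneg zdvd1_eq)
  with c show ?thesis unfolding content_one_def by blast
qed

subsection \<open>Partial derivatives\<close>

lemma pdiff_superset:
  assumes "finite S" "Poly_Mapping.keys p \<subseteq> S"
  shows "pdiff x p = (\<Sum>m\<in>S. Poly_Mapping.single (m - Poly_Mapping.single x 1)
        (of_nat (Poly_Mapping.lookup m x) * Poly_Mapping.lookup p m))"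
  unfolding pdiff_def using assms
  by (intro sum.mono_neutral_left) (auto simp: in_keys_iff)

lemma pdiff_add: "pdiff x (p + q) = pdiff x p + pdiff x q"
proof -
  let ?S = "Poly_Mapping.keys p \<union> Poly_Mapping.keys q"
  have "pdiff x (p + q) = (\<Sum>m\<in>?S. Poly_Mapping.single (m - Poly_Mapping.single x 1)
        (of_nat (Poly_Mapping.lookup m x) * Poly_Mapping.lookup (p + q) m))"
    by (rule pdiff_superset) (auto simp: Poly_Mapping.keys_add)
  also have "\<dots> = pdiff x p + pdiff x q"
    by (simp add: pdiff_superset[where S = ?S] lookup_add distrib_left single_add sum.distrib)
  finally show ?thesis .
qed

lemma pdiff_single:
  "pdiff x (Poly_Mapping.single m c) =
    Poly_Mapping.single (m - Poly_Mapping.single x 1) (of_nat (Poly_Mapping.lookup m x) * c)"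
  by (cases "c = 0") (auto simp: pdiff_def)

lemma pdiff_mult: "pdiff x (p * q) = pdiff x p * q + p * pdiff x q"
proof (induction p rule: mpoly_induct_single)
  case (single m c)
  show ?case
  proof (induction q rule: mpoly_induct_single)
    case (single n d)
    let ?e = "Poly_Mapping.single x (1::nat)"
    \<comment> \<open>Subtraction of exponents is truncated, so the shift fails for exponent 0; in
      that case the factor \<open>of_nat 0\<close> makes both terms vanish.\<close>
    have shift: "m + n - ?e = (m - ?e) + n" if "Poly_Mapping.lookup m x \<noteq> 0" for m n :: "_ \<Rightarrow>\<^sub>0 nat"
      using that by (intro poly_mapping_eqI) (auto simp: lookup_add lookup_minus lookup_single when_def)
    have 1: "Poly_Mapping.single (m + n - ?e) (of_nat (Poly_Mapping.lookup m x) * (c * d)) =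
        Poly_Mapping.single (m - ?e + n) (of_nat (Poly_Mapping.lookup m x) * (c * d))"
      using shift[of m n] by (cases "Poly_Mapping.lookup m x = 0") simp_all
    have 2: "Poly_Mapping.single (m + n - ?e) (of_nat (Poly_Mapping.lookup n x) * (c * d)) =
        Poly_Mapping.single (m + (n - ?e)) (of_nat (Poly_Mapping.lookup n x) * (c * d))"
      using shift[of n m] by (cases "Poly_Mapping.lookup n x = 0") (simp_all add: add.commute)
    show ?case
      unfolding mult_single pdiff_single lookup_add of_nat_add distrib_right single_add 1 2
      by (simp add: ac_simps)
  qed (simp_all add: pdiff_add distrib_left add.assoc add.left_commute)
qed (simp_all add: pdiff_add distrib_right add.assoc add.left_commute)

lemma pdiff_Const [simp]: "pdiff x (Const c) = 0"
  by (simp add: Const_def pdiff_single)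

lemma pdiff_Var [simp]: "pdiff x (Var y) = (if x = y then 1 else 0)"
  by (simp add: Var_def pdiff_single lookup_single when_def single_one)

lemma pdiff_numeral [simp]: "pdiff x (numeral k) = 0"
  using pdiff_Const[of x "numeral k"] by simp

lemma pdiff_uminus: "pdiff x (- p :: ('v, 'a::comm_ring_1) mpoly) = - pdiff x p"
  using pdiff_add[of x p "- p"] by (simp add: add_eq_0_iff2 pdiff_def add_eq_0_iff)

lemma pdiff_diff: "pdiff x (p - q :: ('v, 'a::comm_ring_1) mpoly) = pdiff x p - pdiff x q"
  using pdiff_add[of x p "- q"] by (simp add: pdiff_uminus)

subsection \<open>The invariants\<close>

text \<open>Polymorphic in the ring, so that one formula can be read at numbers, at
  \<open>Var\<close> (the polynomial itself) and at polynomials substituted for the variables. The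
  same applies to the invariants below.\<close>

definition inv_S :: "(mvar \<Rightarrow> 'a::comm_ring_1) \<Rightarrow> 'a"
  where "inv_S m =
    m M00*m M20*m M21*m M03 - m M00*m M20*m M12^2 - m M00*m M11*m M30*m M03 + m M00*m M11*m M21*m
    M12 + m M00*m M02*m M30*m M12 - m M00*m M02*m M21^2 - m M10^2*m M21*m M03 + m M10^2*m M12^2 + m
    M10*m M01*m M30*m M03 - m M10*m M01*m M21*m M12 + m M10*m M20*m M11*m M03 - m M10*m M20*m M02*m
    M12 - 2*m M10*m M11^2*m M12 + 3*m M10*m M11*m M02*m M21 - m M10*m M02^2*m M30 - m M01^2*m M30*m
    M12 + m M01^2*m M21^2 - m M01*m M20^2*m M03 + 3*m M01*m M20*m M11*m M12 - m M01*m M20*m M02*m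
    M21 - 2*m M01*m M11^2*m M21 + m M01*m M11*m M02*m M30 + m M20^2*m M02^2 - 2*m M20*m M11^2*m M02
    + m M11^4"

definition inv_T :: "(mvar \<Rightarrow> 'a::comm_ring_1) \<Rightarrow> 'a"
  where "inv_T m =
    m M00^2*m M30^2*m M03^2 - 6*m M00^2*m M30*m M21*m M12*m M03 + 4*m M00^2*m M30*m M12^3 + 4*m
    M00^2*m M21^3*m M03 - 3*m M00^2*m M21^2*m M12^2 - 6*m M00*m M10*m M20*m M30*m M03^2 + 18*m
    M00*m M10*m M20*m M21*m M12*m M03 - 12*m M00*m M10*m M20*m M12^3 + 12*m M00*m M10*m M11*m M30*m
    M12*m M03 - 24*m M00*m M10*m M11*m M21^2*m M03 + 12*m M00*m M10*m M11*m M21*m M12^2 + 6*m M00*m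
    M10*m M02*m M30*m M21*m M03 - 12*m M00*m M10*m M02*m M30*m M12^2 + 6*m M00*m M10*m M02*m
    M21^2*m M12 + 6*m M00*m M01*m M20*m M30*m M12*m M03 - 12*m M00*m M01*m M20*m M21^2*m M03 + 6*m
    M00*m M01*m M20*m M21*m M12^2 + 12*m M00*m M01*m M11*m M30*m M21*m M03 - 24*m M00*m M01*m M11*m
    M30*m M12^2 + 12*m M00*m M01*m M11*m M21^2*m M12 - 6*m M00*m M01*m M02*m M30^2*m M03 + 18*m
    M00*m M01*m M02*m M30*m M21*m M12 - 12*m M00*m M01*m M02*m M21^3 + 4*m M00*m M20^3*m M03^2 -
    24*m M00*m M20^2*m M11*m M12*m M03 - 12*m M00*m M20^2*m M02*m M21*m M03 + 24*m M00*m M20^2*m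
    M02*m M12^2 + 36*m M00*m M20*m M11^2*m M21*m M03 + 12*m M00*m M20*m M11^2*m M12^2 + 12*m M00*m
    M20*m M11*m M02*m M30*m M03 - 60*m M00*m M20*m M11*m M02*m M21*m M12 - 12*m M00*m M20*m M02^2*m
    M30*m M12 + 24*m M00*m M20*m M02^2*m M21^2 - 20*m M00*m M11^3*m M30*m M03 - 12*m M00*m M11^3*m
    M21*m M12 + 36*m M00*m M11^2*m M02*m M30*m M12 + 12*m M00*m M11^2*m M02*m M21^2 - 24*m M00*m
    M11*m M02^2*m M30*m M21 + 4*m M00*m M02^3*m M30^2 + 4*m M10^3*m M30*m M03^2 - 12*m M10^3*m
    M21*m M12*m M03 + 8*m M10^3*m M12^3 - 12*m M10^2*m M01*m M30*m M12*m M03 + 24*m M10^2*m M01*m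
    M21^2*m M03 - 12*m M10^2*m M01*m M21*m M12^2 - 3*m M10^2*m M20^2*m M03^2 + 12*m M10^2*m M20*m
    M11*m M12*m M03 + 6*m M10^2*m M20*m M02*m M21*m M03 - 12*m M10^2*m M20*m M02*m M12^2 + 12*m
    M10^2*m M11^2*m M21*m M03 - 24*m M10^2*m M11^2*m M12^2 - 24*m M10^2*m M11*m M02*m M30*m M03 +
    36*m M10^2*m M11*m M02*m M21*m M12 + 24*m M10^2*m M02^2*m M30*m M12 - 27*m M10^2*m M02^2*m
    M21^2 - 12*m M10*m M01^2*m M30*m M21*m M03 + 24*m M10*m M01^2*m M30*m M12^2 - 12*m M10*m
    M01^2*m M21^2*m M12 + 6*m M10*m M01*m M20^2*m M12*m M03 - 60*m M10*m M01*m M20*m M11*m M21*m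
    M03 + 36*m M10*m M01*m M20*m M11*m M12^2 + 18*m M10*m M01*m M20*m M02*m M30*m M03 - 6*m M10*m
    M01*m M20*m M02*m M21*m M12 + 36*m M10*m M01*m M11^2*m M30*m M03 - 12*m M10*m M01*m M11^2*m
    M21*m M12 - 60*m M10*m M01*m M11*m M02*m M30*m M12 + 36*m M10*m M01*m M11*m M02*m M21^2 + 6*m
    M10*m M01*m M02^2*m M30*m M21 + 12*m M10*m M20^2*m M11*m M02*m M03 - 12*m M10*m M20^2*m M02^2*m
    M12 - 12*m M10*m M20*m M11^3*m M03 - 12*m M10*m M20*m M11^2*m M02*m M12 + 36*m M10*m M20*m
    M11*m M02^2*m M21 - 12*m M10*m M20*m M02^3*m M30 + 24*m M10*m M11^4*m M12 - 36*m M10*m M11^3*m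
    M02*m M21 + 12*m M10*m M11^2*m M02^2*m M30 + 4*m M01^3*m M30^2*m M03 - 12*m M01^3*m M30*m M21*m
    M12 + 8*m M01^3*m M21^3 + 24*m M01^2*m M20^2*m M21*m M03 - 27*m M01^2*m M20^2*m M12^2 - 24*m
    M01^2*m M20*m M11*m M30*m M03 + 36*m M01^2*m M20*m M11*m M21*m M12 + 6*m M01^2*m M20*m M02*m
    M30*m M12 - 12*m M01^2*m M20*m M02*m M21^2 + 12*m M01^2*m M11^2*m M30*m M12 - 24*m M01^2*m
    M11^2*m M21^2 + 12*m M01^2*m M11*m M02*m M30*m M21 - 3*m M01^2*m M02^2*m M30^2 - 12*m M01*m
    M20^3*m M02*m M03 + 12*m M01*m M20^2*m M11^2*m M03 + 36*m M01*m M20^2*m M11*m M02*m M12 - 12*m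
    M01*m M20^2*m M02^2*m M21 - 36*m M01*m M20*m M11^3*m M12 - 12*m M01*m M20*m M11^2*m M02*m M21 +
    12*m M01*m M20*m M11*m M02^2*m M30 + 24*m M01*m M11^4*m M21 - 12*m M01*m M11^3*m M02*m M30 +
    8*m M20^3*m M02^3 - 24*m M20^2*m M11^2*m M02^2 + 24*m M20*m M11^4*m M02 - 8*m M11^6"

text \<open>The second moment matrix \<open>(m\<^sub>a\<^sub>b)\<close> is the value at $(0,0,1)$ of a sixth of the matrix of
  second derivatives of the cubic; \<open>adj_ij\<close> are its cofactors.\<close>

definition adj_11 :: "(mvar \<Rightarrow> 'a::comm_ring_1) \<Rightarrow> 'a" where "adj_11 m = m M02 * m M00 - m M01^2"
definition adj_12 :: "(mvar \<Rightarrow> 'a::comm_ring_1) \<Rightarrow> 'a" where "adj_12 m = m M01 * m M10 - m M11 * m M00"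
definition adj_13 :: "(mvar \<Rightarrow> 'a::comm_ring_1) \<Rightarrow> 'a" where "adj_13 m = m M11 * m M01 - m M02 * m M10"
definition adj_22 :: "(mvar \<Rightarrow> 'a::comm_ring_1) \<Rightarrow> 'a" where "adj_22 m = m M20 * m M00 - m M10^2"
definition adj_23 :: "(mvar \<Rightarrow> 'a::comm_ring_1) \<Rightarrow> 'a" where "adj_23 m = m M11 * m M10 - m M20 * m M01"
definition adj_33 :: "(mvar \<Rightarrow> 'a::comm_ring_1) \<Rightarrow> 'a" where "adj_33 m = m M20 * m M02 - m M11^2"

definition inv_H :: "(mvar \<Rightarrow> 'a::comm_ring_1) \<Rightarrow> 'a"
  where "inv_H m = m M20 * adj_11 m + m M11 * adj_12 m + m M10 * adj_13 m"

text \<open>Jacobi's formula: the derivative of a determinant is the sum of the cofactors times the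
  derivatives of the entries. Up to the factor 216 this is the derivative of the Hessian by u_1 at
  (0,0,1).\<close>

definition hess_1 :: "(mvar \<Rightarrow> 'a::comm_ring_1) \<Rightarrow> 'a"
  where "hess_1 m = adj_11 m * m M30 + 2 * adj_12 m * m M21 + 2 * adj_13 m * m M20
    + adj_22 m * m M12 + 2 * adj_23 m * m M11 + adj_33 m * m M10"

definition hess_2 :: "(mvar \<Rightarrow> 'a::comm_ring_1) \<Rightarrow> 'a"
  where "hess_2 m = adj_11 m * m M21 + 2 * adj_12 m * m M12 + 2 * adj_13 m * m M11
    + adj_22 m * m M03 + 2 * adj_23 m * m M02 + adj_33 m * m M01"

text \<open>A determinant bordered by a vector is minus the quadratic form of the cofactor matrix at
  that vector. By Euler's relation for the cubic form H the third entry is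
  \<open>3 * inv_H m\<close>, whence the coefficients 6 and 9.\<close>

definition inv_G :: "(mvar \<Rightarrow> 'a::comm_ring_1) \<Rightarrow> 'a"
  where "inv_G m = adj_11 m * hess_1 m^2 + 2 * adj_12 m * hess_1 m * hess_2 m
    + 6 * adj_13 m * hess_1 m * inv_H m + adj_22 m * hess_2 m^2
    + 6 * adj_23 m * hess_2 m * inv_H m + 9 * adj_33 m * inv_H m^2"

lemmas adj_defs = adj_11_def adj_12_def adj_13_def adj_22_def adj_23_def adj_33_def
lemmas inv_H_defs = inv_H_def adj_defs
lemmas inv_G_defs = inv_G_def hess_1_def hess_2_def inv_H_defs

lemma peval_inv:
  fixes a :: "mvar \<Rightarrow> complex"
  shows "peval a (inv_S Var) = inv_S a" "peval a (inv_T Var) = inv_T a"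
    "peval a (inv_H Var) = inv_H a" "peval a (inv_G Var) = inv_G a"
  by (simp_all add: inv_S_def inv_T_def inv_G_defs)

lemma peval_hess:
  fixes a :: "mvar \<Rightarrow> complex"
  shows "peval a (hess_1 Var) = hess_1 a" "peval a (hess_2 Var) = hess_2 a"
  by (simp_all add: hess_1_def hess_2_def adj_defs)

lemma int_coeffs_inv:
  "int_coeffs (inv_S Var)" "int_coeffs (inv_T Var)" "int_coeffs (inv_H Var)" "int_coeffs (inv_G Var)"
  unfolding inv_S_def inv_T_def inv_G_defs
  by (intro int_coeffs_add int_coeffs_diff int_coeffs_mult int_coeffs_power int_coeffs_Var
      int_coeffs_numeral)+

lemma UNIV_mvar: "(UNIV :: mvar set) = {M00, M10, M01, M20, M11, M02, M30, M21, M12, M03}"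
  using mvar.exhaust by blast

instance mvar :: finite
  by standard (simp add: UNIV_mvar)

text \<open>One scaling by three independent factors covers all components of the grading; the
  single gradings are the unit choices of \<open>a\<close>, \<open>b\<close>,
  \<open>c\<close>.\<close>

lemma whomogeneous_inv:
  fixes w :: "mvar \<Rightarrow> nat" and a b c :: nat
  defines "w \<equiv> \<lambda>x. a + b * fst (expo x) + c * snd (expo x)"
  shows "whomogeneous w (4 * a + 4 * b + 4 * c) (inv_S Var :: moment_poly)"
    "whomogeneous w (6 * a + 6 * b + 6 * c) (inv_T Var :: moment_poly)"
    "whomogeneous w (3 * a + 2 * b + 2 * c) (inv_H Var :: moment_poly)"
    "whomogeneous w (8 * a + 6 * b + 6 * c) (inv_G Var :: moment_poly)"
proof -
  have *: "inv_S (\<lambda>x. t ^ w x * m x) = t ^ (4 * a + 4 * b + 4 * c) * inv_S m"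
    "inv_T (\<lambda>x. t ^ w x * m x) = t ^ (6 * a + 6 * b + 6 * c) * inv_T m"
    "inv_H (\<lambda>x. t ^ w x * m x) = t ^ (3 * a + 2 * b + 2 * c) * inv_H m"
    "inv_G (\<lambda>x. t ^ w x * m x) = t ^ (8 * a + 6 * b + 6 * c) * inv_G m" for t :: complex and m
  proof -
    define x y z where "x = t ^ a" and "y = t ^ b" and "z = t ^ c"
    define m' where "m' = (\<lambda>x. t ^ w x * m x)"
    have W: "m' v = x * y ^ fst (expo v) * z ^ snd (expo v) * m v" for v
      by (simp add: m'_def w_def x_def y_def z_def power_add power_mult)
    have D: "t ^ (i * a + j * b + k * c) = x ^ i * y ^ j * z ^ k" for i j k
      by (simp add: x_def y_def z_def power_add power_mult mult.commute[of _ a] mult.commute[of _ b] mult.commute[of _ c])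
    have A: "adj_11 m' = x^2 * z^2 * adj_11 m" "adj_12 m' = x^2 * y * z * adj_12 m"
      "adj_13 m' = x^2 * y * z^2 * adj_13 m" "adj_22 m' = x^2 * y^2 * adj_22 m"
      "adj_23 m' = x^2 * y^2 * z * adj_23 m" "adj_33 m' = x^2 * y^2 * z^2 * adj_33 m"
      unfolding W adj_defs expo.simps fst_conv snd_conv by algebra+
    have H: "inv_H m' = x^3 * y^2 * z^2 * inv_H m" "hess_1 m' = x^3 * y^3 * z^2 * hess_1 m"
      "hess_2 m' = x^3 * y^2 * z^3 * hess_2 m"
      unfolding inv_H_def hess_1_def hess_2_def A W expo.simps fst_conv snd_conv by algebra+
    have "inv_S m' = t ^ (4 * a + 4 * b + 4 * c) * inv_S m"
      unfolding D W inv_S_def expo.simps fst_conv snd_conv by algebra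
    moreover have "inv_T m' = t ^ (6 * a + 6 * b + 6 * c) * inv_T m"
      unfolding D W inv_T_def expo.simps fst_conv snd_conv by algebra
    moreover have "inv_H m' = t ^ (3 * a + 2 * b + 2 * c) * inv_H m"
      unfolding D H ..
    moreover have "inv_G m' = t ^ (8 * a + 6 * b + 6 * c) * inv_G m"
      unfolding inv_G_def A H D by algebra
    ultimately show
      "inv_S (\<lambda>x. t ^ w x * m x) = t ^ (4 * a + 4 * b + 4 * c) * inv_S m"
      "inv_T (\<lambda>x. t ^ w x * m x) = t ^ (6 * a + 6 * b + 6 * c) * inv_T m"
      "inv_H (\<lambda>x. t ^ w x * m x) = t ^ (3 * a + 2 * b + 2 * c) * inv_H m"
      "inv_G (\<lambda>x. t ^ w x * m x) = t ^ (8 * a + 6 * b + 6 * c) * inv_G m"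
      unfolding m'_def by this+
  qed
  show "whomogeneous w (4 * a + 4 * b + 4 * c) (inv_S Var :: moment_poly)"
    "whomogeneous w (6 * a + 6 * b + 6 * c) (inv_T Var :: moment_poly)"
    "whomogeneous w (3 * a + 2 * b + 2 * c) (inv_H Var :: moment_poly)"
    "whomogeneous w (8 * a + 6 * b + 6 * c) (inv_G Var :: moment_poly)"
    by (rule whomogeneousI_scaling; simp only: peval_inv *)+
qed

lemma lookup_monom_of: "Poly_Mapping.lookup (monom_of xs) x = count_list xs x"
  by (induction xs) (auto simp: monom_of_def lookup_add lookup_single when_def)

lemma keys_monom_of: "Poly_Mapping.keys (monom_of xs) = set xs"
  by (auto simp: in_keys_iff lookup_monom_of count_list_0_iff)

lemma prod_Var: "prod_list (map Var xs) = (Poly_Mapping.single (monom_of xs) 1 :: moment_poly)"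
  by (induction xs) (simp_all add: monom_of_def Var_def mult_single)

lemma heval_Const_inv:
  fixes \<sigma> :: "mvar \<Rightarrow> ('v, complex) mpoly"
  shows "heval Const \<sigma> (inv_S Var) = inv_S \<sigma>" "heval Const \<sigma> (inv_T Var) = inv_T \<sigma>"
    "heval Const \<sigma> (inv_H Var) = inv_H \<sigma>" "heval Const \<sigma> (inv_G Var) = inv_G \<sigma>"
proof -
  interpret C: semiring_hom "Const :: complex \<Rightarrow> ('v, complex) mpoly" by (rule semiring_hom_Const)
  note simps = C.heval_add C.heval_mult C.heval_power heval_diff[OF semiring_hom_Const]
      heval_uminus[OF semiring_hom_Const] C.heval_Var C.heval_numeral
  show "heval Const \<sigma> (inv_S Var) = inv_S \<sigma>" "heval Const \<sigma> (inv_T Var) = inv_T \<sigma>"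
    "heval Const \<sigma> (inv_H Var) = inv_H \<sigma>" "heval Const \<sigma> (inv_G Var) = inv_G \<sigma>"
    unfolding inv_S_def inv_T_def inv_G_defs simps by simp_all
qed

text \<open>With the variables outside the given monomial set to 0, each invariant collapses to that
  monomial.\<close>

lemma leading_coeffs:
  "Poly_Mapping.lookup (inv_S Var :: moment_poly) (monom_of [M00, M02, M12, M30]) = 1"
  "Poly_Mapping.lookup (inv_T Var :: moment_poly) (monom_of [M00, M00, M03, M03, M30, M30]) = 1"
  "Poly_Mapping.lookup (inv_H Var :: moment_poly) (monom_of [M00, M02, M20]) = 1"
  "Poly_Mapping.lookup (inv_G Var :: moment_poly)
    (monom_of [M00, M00, M00, M02, M02, M02, M30, M30]) = 1"
proof -
  have *: "Poly_Mapping.lookup p (monom_of xs) = 1"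
    if "heval Const (\<lambda>x. if x \<in> set xs then Var x else 0) p = prod_list (map Var xs)"
    for p :: moment_poly and xs
    using lookup_restrict[of "monom_of xs" "set xs" p] that
    by (simp add: prod_Var keys_monom_of)
  show "Poly_Mapping.lookup (inv_S Var :: moment_poly) (monom_of [M00, M02, M12, M30]) = 1"
    by (rule *) (simp only: heval_Const_inv, simp add: inv_S_def algebra_simps)
  show "Poly_Mapping.lookup (inv_T Var :: moment_poly) (monom_of [M00, M00, M03, M03, M30, M30]) = 1"
    by (rule *) (simp only: heval_Const_inv, simp add: inv_T_def power2_eq_square algebra_simps)
  show "Poly_Mapping.lookup (inv_H Var :: moment_poly) (monom_of [M00, M02, M20]) = 1"
    by (rule *) (simp only: heval_Const_inv, simp add: inv_H_defs algebra_simps)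
  show "Poly_Mapping.lookup (inv_G Var :: moment_poly)
    (monom_of [M00, M00, M00, M02, M02, M02, M30, M30]) = 1"
    by (rule *) (simp only: heval_Const_inv, simp add: inv_G_defs power2_eq_square algebra_simps)
qed

subsection \<open>The Hessian and the bordered Hessian at $(0,0,1)$\<close>

text \<open>With this symmetric indexing the cubic is the sum of \<open>mv i j k\<close> times u_i
  u_j u_k over all triples, the factors 3 and 6 being absorbed; derivatives and substitutions become
  uniform in the indices.\<close>

definition mv :: "3 \<Rightarrow> 3 \<Rightarrow> 3 \<Rightarrow> mvar"
  where "mv i j k = (let n = (\<lambda>l. of_bool (i = l) + of_bool (j = l) + of_bool (k = l) :: nat) in
    SOME x. expo x = (n 1, n 2))"

lemma three_neq: "(1::3) \<noteq> 2" "(2::3) \<noteq> 1" "(1::3) \<noteq> 3" "(3::3) \<noteq> 1" "(2::3) \<noteq> 3" "(3::3) \<noteq> 2"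
  by simp_all

lemma expo_inj: "expo x = expo y \<longleftrightarrow> x = y"
  by (cases x; cases y) simp_all

lemma mv_eqI: "expo x = (n 1, n 2) \<Longrightarrow> n = (\<lambda>l. of_bool (i = l) + of_bool (j = l) + of_bool (k = l) :: nat) \<Longrightarrow> mv i j k = x"
  unfolding mv_def Let_def by (rule some_equality) (simp_all add: expo_inj[symmetric])

lemma mv_simps [simp]:
  "mv 1 1 1 = M30" "mv 1 1 2 = M21" "mv 1 1 3 = M20" "mv 1 2 1 = M21" "mv 1 2 2 = M12" "mv 1 2 3 = M11"
  "mv 1 3 1 = M20" "mv 1 3 2 = M11" "mv 1 3 3 = M10"
  "mv 2 1 1 = M21" "mv 2 1 2 = M12" "mv 2 1 3 = M11" "mv 2 2 1 = M12" "mv 2 2 2 = M03" "mv 2 2 3 = M02"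
  "mv 2 3 1 = M11" "mv 2 3 2 = M02" "mv 2 3 3 = M01"
  "mv 3 1 1 = M20" "mv 3 1 2 = M11" "mv 3 1 3 = M10" "mv 3 2 1 = M11" "mv 3 2 2 = M02" "mv 3 2 3 = M01"
  "mv 3 3 1 = M10" "mv 3 3 2 = M01" "mv 3 3 3 = M00"
  by (rule mv_eqI[OF _ refl]; simp add: three_neq)+

lemma cubic_dd_eq: "cubic_dd i j = 6 * (\<Sum>k\<in>UNIV. Const (Var (mv i j k)) * Var k)"
proof -
  have "\<forall>i j. cubic_dd i j = 6 * (\<Sum>k\<in>UNIV. Const (Var (mv i j k)) * Var k)"
    unfolding forall_3 cubic_dd_def gen_cubic_def cubic_def sum_3 mv_simps
    by (simp add: pdiff_add pdiff_mult power2_eq_square power3_eq_cube three_neq algebra_simps)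
  then show ?thesis by blast
qed

lemma at_001_add: "at_001 (p + q) = at_001 p + at_001 q"
  and at_001_mult: "at_001 (p * q) = at_001 p * at_001 q"
  and at_001_diff: "at_001 (p - q) = at_001 p - at_001 q"
  and at_001_uminus: "at_001 (- p) = - at_001 p"
  and at_001_zero [simp]: "at_001 0 = 0"
  by (simp_all add: at_001_def)

lemma at_001_cubic_dd: "at_001 (cubic_dd i j) = 6 * Var (mv i j 3)"
  by (simp add: cubic_dd_eq sum_3 at_001_def)

lemma at_001_pdiff_cubic_dd: "at_001 (pdiff k (cubic_dd i j)) = 6 * Var (mv i j k)"
proof -
  have "\<forall>k. at_001 (pdiff k (cubic_dd i j)) = 6 * Var (mv i j k)"
    unfolding forall_3 cubic_dd_eq sum_3
    by (simp add: at_001_def pdiff_add pdiff_mult three_neq)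
  then show ?thesis by blast
qed

lemma at_001_Hess: "at_001 Hess = 216 * inv_H Var"
proof (rule peval_inject)
  fix a :: "mvar \<Rightarrow> complex"
  show "peval a (at_001 Hess) = peval a (216 * inv_H Var)"
    unfolding Hess_def det_3 vec_lambda_beta at_001_diff at_001_add at_001_mult at_001_cubic_dd mv_simps
      peval_mult peval_add peval_diff peval_power peval_numeral peval_inv peval_Var inv_H_defs
    by algebra
qed

lemma at_001_Hess_d:
  "at_001 (Hess_d 1) = 216 * hess_1 Var" "at_001 (Hess_d 2) = 216 * hess_2 Var"
  "at_001 (Hess_d 3) = 648 * inv_H Var"
proof -
  have "peval a (at_001 (Hess_d 1)) = 216 * hess_1 a" "peval a (at_001 (Hess_d 2)) = 216 * hess_2 a"
    "peval a (at_001 (Hess_d 3)) = 648 * inv_H a" for a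
    unfolding Hess_d_def Hess_def det_3 vec_lambda_beta pdiff_diff pdiff_add pdiff_mult
      at_001_diff at_001_add at_001_mult at_001_cubic_dd at_001_pdiff_cubic_dd mv_simps
      peval_mult peval_add peval_diff peval_numeral peval_Var hess_1_def hess_2_def inv_H_defs
    by algebra+
  then show "at_001 (Hess_d 1) = 216 * hess_1 Var" "at_001 (Hess_d 2) = 216 * hess_2 Var"
    "at_001 (Hess_d 3) = 648 * inv_H Var"
    by (auto intro!: peval_inject simp: peval_inv peval_hess)
qed

lemma vector_4:
  "(vector [x, y, z, w] :: 'a::zero^4) $ 1 = x" "(vector [x, y, z, w] :: 'a^4) $ 2 = y"
  "(vector [x, y, z, w] :: 'a^4) $ 3 = z" "(vector [x, y, z, w] :: 'a^4) $ 4 = w"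
  by (simp_all add: vector_def)

lemma det_4:
  fixes A :: "'a::comm_ring_1^4^4"
  defines "m \<equiv> \<lambda>i j k. A$i$2 * (A$j$3 * A$k$4 - A$j$4 * A$k$3)
    - A$i$3 * (A$j$2 * A$k$4 - A$j$4 * A$k$2) + A$i$4 * (A$j$2 * A$k$3 - A$j$3 * A$k$2)"
  shows "det A = A$1$1 * m 2 3 4 - A$2$1 * m 1 3 4 + A$3$1 * m 1 2 4 - A$4$1 * m 1 2 3"
proof -
  have f1234: "finite {2::4, 3, 4}" "1 \<notin> {2::4, 3, 4}" and f234: "finite {3::4, 4}" "2 \<notin> {3::4, 4}"
    and f34: "finite {4::4}" "3 \<notin> {4::4}"
    by auto
  show ?thesis
    unfolding det_def UNIV_4 m_def
    unfolding sum_over_permutations_insert[OF f1234] sum_over_permutations_insert[OF f234]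
      sum_over_permutations_insert[OF f34] permutes_sing
    by (simp add: sign_swap_id permutation_swap_id sign_compose sign_id permutation_compose
        transpose_def algebra_simps)
qed

text \<open>The constant is 6^8: every term has two second derivatives, each with a factor 6, and
  two entries of the gradient of the Hessian, each with a factor 6^3.\<close>

lemma at_001_Bordered: "at_001 Bordered = - 1679616 * inv_G Var"
proof (rule peval_inject)
  fix a :: "mvar \<Rightarrow> complex"
  show "peval a (at_001 Bordered) = peval a (- 1679616 * inv_G Var)"
    unfolding Bordered_def det_4 vector_4 at_001_diff at_001_add at_001_mult at_001_zero at_001_cubic_dd
      at_001_Hess_d mv_simps peval_mult peval_add peval_diff peval_uminus peval_power peval_numeral peval_zero peval_inv
      peval_hess peval_Var inv_G_def adj_defs
    by algebra
qed

lemma Const_mult_numeral_mult: "Const c * (numeral k * p) = Const (c * numeral k) * p"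
  by (simp add: Const_mult mult.assoc)

lemma affine_h_iff: "affine_h h \<longleftrightarrow> h = inv_H Var"
proof
  assume "affine_h h"
  then obtain c where c: "h = Const c * (216 * inv_H Var)"
    and 1: "Poly_Mapping.lookup h (monom_of [M00, M02, M20]) = 1"
    unfolding affine_h_def at_001_Hess by blast
  have h: "h = Const (c * 216) * inv_H Var" by (simp add: c Const_mult mult.assoc)
  have "c * 216 = 1"
    using 1 leading_coeffs(3) unfolding h by (simp add: lookup_Const_mult)
  then show "h = inv_H Var" by (simp add: h)
next
  assume h: "h = inv_H Var"
  have "h = Const (1 / 216) * at_001 Hess"
    by (simp add: h at_001_Hess Const_mult_numeral_mult)
  moreover note lead = leading_coeffs(3)[folded h]
  moreover have "content_one h"
    using content_oneI[OF _ lead] int_coeffs_inv(3) h by simp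
  ultimately show "affine_h h"
    unfolding affine_h_def by (intro conjI exI)
qed

lemma affine_g_iff: "affine_g g \<longleftrightarrow> g = inv_G Var"
proof
  assume "affine_g g"
  then obtain c where c: "g = Const c * (- 1679616 * inv_G Var)"
    and 1: "Poly_Mapping.lookup g (monom_of [M00, M00, M00, M02, M02, M02, M30, M30]) = 1"
    unfolding affine_g_def at_001_Bordered by blast
  have g: "g = Const (c * - 1679616) * inv_G Var" by (simp add: c Const_mult Const_uminus mult.assoc)
  have "c * - 1679616 = 1"
    using 1 leading_coeffs(4) unfolding g by (simp add: lookup_Const_mult)
  then show "g = inv_G Var" by (simp only: g) simp
next
  assume g: "g = inv_G Var"
  have "Const (1 / 1679616) * (1679616 * inv_G Var) = (inv_G Var :: moment_poly)"
    by (simp add: Const_mult_numeral_mult)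
  then have "g = Const (- 1 / 1679616) * at_001 Bordered"
    by (simp add: g at_001_Bordered Const_uminus)
  moreover note lead = leading_coeffs(4)[folded g]
  moreover have "content_one g"
    using content_oneI[OF _ lead] int_coeffs_inv(4) g by simp
  ultimately show "affine_g g"
    unfolding affine_g_def by (intro conjI exI)
qed

subsection \<open>Linear substitutions in ternary cubics\<close>

fun idx :: "mvar \<Rightarrow> 3 \<times> 3 \<times> 3" where
  "idx M30 = (1, 1, 1)"
| "idx M21 = (1, 1, 2)"
| "idx M20 = (1, 1, 3)"
| "idx M12 = (1, 2, 2)"
| "idx M11 = (1, 2, 3)"
| "idx M10 = (1, 3, 3)"
| "idx M03 = (2, 2, 2)"
| "idx M02 = (2, 2, 3)"
| "idx M01 = (2, 3, 3)"
| "idx M00 = (3, 3, 3)"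

text \<open>The pull-back of the symmetric trilinear form with entries \<open>mv p q r\<close>;
  \<open>cubic_act\<close> identifies it with composition of the cubic with
  \<open>A\<close>.\<close>

definition act :: "complex^3^3 \<Rightarrow> (mvar \<Rightarrow> complex) \<Rightarrow> mvar \<Rightarrow> complex"
  where "act A m x = (case idx x of (i, j, k) \<Rightarrow>
    \<Sum>p\<in>UNIV. \<Sum>q\<in>UNIV. \<Sum>r\<in>UNIV. A$p$i * A$q$j * A$r$k * m (mv p q r))"

lemma cubic_act: "cubic (act A m) u = cubic m (A *v u)"
  unfolding cubic_def act_def idx.simps prod.case matrix_vector_mult_def vec_lambda_beta sum_3 mv_simps
  by algebra

text \<open>Ten points suffice: the unit vectors, the sums and differences of two of them, and
  (1,1,1). A sum and a difference together separate the two mixed coefficients.\<close>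

lemma cubic_inject:
  fixes m m' :: "mvar \<Rightarrow> complex"
  assumes "\<And>u. cubic m u = cubic m' u"
  shows "m = m'"
proof
  have *: "cubic m (vector [x, y, z]) = cubic m' (vector [x, y, z])" for x y z
    by (rule assms)
  note ev = *[unfolded cubic_def vector_3]
  have 1: "m M30 = m' M30" "m M03 = m' M03" "m M00 = m' M00"
    using ev[of 1 0 0] ev[of 0 1 0] ev[of 0 0 1] by simp_all
  have sym: "p = p' \<and> q = q'"
    if "3 * p + 3 * q = 3 * p' + 3 * q'" "3 * q - 3 * p = 3 * q' - 3 * p'" for p q p' q' :: complex
    using that by algebra
  have 2: "m M21 = m' M21 \<and> m M12 = m' M12"
    using ev[of 1 1 0] ev[of 1 "-1" 0] 1 by (intro sym) (simp_all add: algebra_simps)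
  have 3: "m M20 = m' M20 \<and> m M10 = m' M10"
    using ev[of 1 0 1] ev[of 1 0 "-1"] 1 by (intro sym) (simp_all add: algebra_simps)
  have 4: "m M02 = m' M02 \<and> m M01 = m' M01"
    using ev[of 0 1 1] ev[of 0 1 "-1"] 1 by (intro sym) (simp_all add: algebra_simps)
  have 5: "m M11 = m' M11"
    using ev[of 1 1 1] 1 2 3 4 by simp
  show "m x = m' x" for x
    by (cases x) (use 1 2 3 4 5 in auto)
qed

lemma act_unique: "(\<And>u. cubic m' u = cubic m (A *v u)) \<Longrightarrow> m' = act A m"
  by (rule cubic_inject) (simp add: cubic_act)

lemma act_mult: "act (A ** B) m = act B (act A m)"
  by (rule act_unique[symmetric]) (simp add: cubic_act matrix_vector_mul_assoc)

lemma act_mat_1 [simp]: "act (mat 1) m = m"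
  by (rule act_unique[symmetric]) simp

lemma act_scale: "act (\<chi> i j. c * A$i$j) m = (\<lambda>x. c ^ 3 * act A m x)"
proof
  fix x
  obtain i j k where "idx x = (i, j, k)" by (cases "idx x") auto
  then show "act (\<chi> i j. c * A$i$j) m x = c ^ 3 * act A m x"
    by (simp add: act_def sum_distrib_left power3_eq_cube ac_simps)
qed

lemma sl3_invariant_iff:
  "sl3_invariant p \<longleftrightarrow> (\<forall>A m. det A = 1 \<longrightarrow> peval (act A m) p = peval m p)"
  unfolding sl3_invariant_def by (metis act_unique cubic_act)

lemma complex_cube_root: "\<exists>c. c ^ 3 = (z::complex)"
proof (cases "z = 0")
  case False
  then have "exp (Ln z / 3) ^ 3 = z"
    by (simp add: power3_eq_cube flip: exp_add)
  then show ?thesis ..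
qed (auto intro: exI[of _ 0])

text \<open>Dividing \<open>A\<close> by a cube root of its determinant gives a matrix of
  determinant 1, and a scalar matrix c multiplies all coefficients by c^3, which homogeneity turns
  into the power of the determinant.\<close>

lemma sl3_invariant_gl3:
  assumes inv: "sl3_invariant p" and hom: "homogeneous d p" and det: "det A \<noteq> 0"
  shows "peval (act A m) p = det A ^ d * peval m p"
proof -
  obtain c where c: "c ^ 3 = det A" using complex_cube_root by blast
  with det have "c \<noteq> 0" by auto
  define B where "B = (\<chi> i j. A$i$j / c)"
  have A: "A = (\<chi> i j. c * B$i$j)"
    using \<open>c \<noteq> 0\<close> by (simp add: B_def vec_eq_iff)
  have "det A = c ^ 3 * det B"
    by (subst A) (simp add: det_3 power3_eq_cube algebra_simps)
  with c det have "det B = 1" by simp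
  have "peval (act A m) p = peval (\<lambda>x. (c ^ 3) ^ 1 * act B m x) p"
    by (subst A) (simp add: act_scale)
  also have "\<dots> = det A ^ d * peval (act B m) p"
    using peval_weighted[of "\<lambda>_. 1" d p "c ^ 3" "act B m"] hom c
    by (simp add: homogeneous_iff_whomogeneous)
  also have "peval (act B m) p = peval m p"
    using inv \<open>det B = 1\<close> by (simp add: sl3_invariant_iff)
  finally show ?thesis .
qed

subsection \<open>Existence of the Aronhold invariants\<close>

definition transvection :: "3 \<Rightarrow> 3 \<Rightarrow> complex \<Rightarrow> complex^3^3"
  where "transvection i j t = (\<chi> k l. of_bool (k = l) + of_bool (k = i \<and> l = j) * t)"

lemma transvection_mult:
  "(transvection i j t ** A) $ k $ l = A$k$l + (if k = i then t * A$j$l else 0)"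
proof -
  have "(transvection i j t ** A) $ k $ l =
      (\<Sum>q\<in>UNIV. of_bool (k = q) * A$q$l) + (\<Sum>q\<in>UNIV. of_bool (q = j) * (of_bool (k = i) * t * A$q$l))"
    unfolding matrix_matrix_mult_def transvection_def vec_lambda_beta sum.distrib[symmetric]
    by (intro sum.cong) (auto simp: algebra_simps)
  then show ?thesis by (simp add: of_bool_def if_distrib[of "\<lambda>x. x * _"] cong: if_cong)
qed

lemma det_transvection_mult:
  assumes "i \<noteq> j"
  shows "det (transvection i j t ** A) = det A"
proof -
  have "\<forall>i j. i \<noteq> j \<longrightarrow> det (transvection i j t ** A) = det A"
    unfolding forall_3 det_3 transvection_mult
    by (simp add: three_neq algebra_simps)
  with assms show ?thesis by blast
qed

lemma transvection_inverse:
  assumes "i \<noteq> j"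
  shows "transvection i j (- t) ** (transvection i j t ** A) = A"
  using assms by (simp add: vec_eq_iff transvection_mult)

text \<open>Gaussian elimination by row additions alone: a vanishing pivot is repaired by adding
  another row, so that no permutations occur. The claims are numbered in the order of elimination
  and proved backwards.\<close>

lemma gauss_induct:
  assumes T: "\<And>A i j t. i \<noteq> j \<Longrightarrow> P (transvection i j t ** A) \<Longrightarrow> P A"
    and D: "\<And>A. (\<And>i j. i \<noteq> j \<Longrightarrow> A$i$j = 0) \<Longrightarrow> P A"
    and det: "det A \<noteq> 0"
  shows "P A"
proof -
  note tm = transvection_mult three_neq
  have 7: "P A" if "det A \<noteq> 0" "A$2$1 = 0" "A$3$1 = 0" "A$3$2 = 0" "A$1$2 = 0" "A$1$3 = 0" for A
  proof (rule T[where i = 2 and j = 3 and t = "- A$2$3 / A$3$3"])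
    have "A$3$3 \<noteq> 0" using that by (auto simp: det_3)
    then have "\<forall>i j. i \<noteq> j \<longrightarrow> (transvection 2 3 (- A$2$3 / A$3$3) ** A)$i$j = 0"
      unfolding forall_3 using that by (simp add: tm)
    then show "P (transvection 2 3 (- A$2$3 / A$3$3) ** A)" by (intro D) blast
  qed simp
  have 6: "P A" if "det A \<noteq> 0" "A$2$1 = 0" "A$3$1 = 0" "A$3$2 = 0" "A$1$2 = 0" for A
  proof (rule T[where i = 1 and j = 3 and t = "- A$1$3 / A$3$3"])
    have "A$3$3 \<noteq> 0" using that by (auto simp: det_3)
    then show "P (transvection 1 3 (- A$1$3 / A$3$3) ** A)"
      using that by (intro 7) (simp_all add: tm det_transvection_mult)
  qed simp
  have 5: "P A" if "det A \<noteq> 0" "A$2$1 = 0" "A$3$1 = 0" "A$3$2 = 0" for A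
  proof (rule T[where i = 1 and j = 2 and t = "- A$1$2 / A$2$2"])
    have "A$2$2 \<noteq> 0" using that by (auto simp: det_3)
    then show "P (transvection 1 2 (- A$1$2 / A$2$2) ** A)"
      using that by (intro 6) (simp_all add: tm det_transvection_mult)
  qed simp
  have 4: "P A" if "det A \<noteq> 0" "A$2$1 = 0" "A$3$1 = 0" "A$2$2 \<noteq> 0" for A
    by (rule T[where i = 3 and j = 2 and t = "- A$3$2 / A$2$2"])
      (use that in \<open>auto intro!: 5 simp: tm det_transvection_mult\<close>)
  have 3: "P A" if "det A \<noteq> 0" "A$2$1 = 0" "A$3$1 = 0" for A
  proof (cases "A$2$2 = 0")
    case True
    then have "A$3$2 \<noteq> 0" using that by (auto simp: det_3)
    show ?thesis
      by (rule T[where i = 2 and j = 3 and t = 1])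
        (use that True \<open>A$3$2 \<noteq> 0\<close> in \<open>auto intro!: 4 simp: tm det_transvection_mult\<close>)
  qed (use that 4 in auto)
  have 2: "P A" if "det A \<noteq> 0" "A$2$1 = 0" "A$1$1 \<noteq> 0" for A
    by (rule T[where i = 3 and j = 1 and t = "- A$3$1 / A$1$1"])
      (use that in \<open>auto intro!: 3 simp: tm det_transvection_mult\<close>)
  have 1: "P A" if "det A \<noteq> 0" "A$1$1 \<noteq> 0" for A
    by (rule T[where i = 2 and j = 1 and t = "- A$2$1 / A$1$1"])
      (use that in \<open>auto intro!: 2 simp: tm det_transvection_mult\<close>)
  show ?thesis
  proof (cases "A$1$1 = 0")
    case True
    with det have "A$2$1 \<noteq> 0 \<or> A$3$1 \<noteq> 0" by (auto simp: det_3)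
    then show ?thesis
    proof
      assume "A$2$1 \<noteq> 0"
      show ?thesis
        by (rule T[where i = 1 and j = 2 and t = 1])
          (use True det \<open>A$2$1 \<noteq> 0\<close> in \<open>auto intro!: 1 simp: tm det_transvection_mult\<close>)
    next
      assume "A$3$1 \<noteq> 0"
      show ?thesis
        by (rule T[where i = 1 and j = 3 and t = 1])
          (use True det \<open>A$3$1 \<noteq> 0\<close> in \<open>auto intro!: 1 simp: tm det_transvection_mult\<close>)
    qed
  qed (use det 1 in auto)
qed

lemma act_transvection_12:
  "act (transvection 1 2 t) m M00 = m M00"
  "act (transvection 1 2 t) m M10 = m M10"
  "act (transvection 1 2 t) m M01 = m M01 + t*m M10"
  "act (transvection 1 2 t) m M20 = m M20"
  "act (transvection 1 2 t) m M11 = m M11 + t*m M20"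
  "act (transvection 1 2 t) m M02 = m M02 + 2*t*m M11 + t^2*m M20"
  "act (transvection 1 2 t) m M30 = m M30"
  "act (transvection 1 2 t) m M21 = m M21 + t*m M30"
  "act (transvection 1 2 t) m M12 = m M12 + 2*t*m M21 + t^2*m M30"
  "act (transvection 1 2 t) m M03 = m M03 + 3*t*m M12 + 3*t^2*m M21 + t^3*m M30"
  unfolding act_def idx.simps prod.case sum_3 mv_simps transvection_def vec_lambda_beta
  by (simp_all add: three_neq power2_eq_square power3_eq_cube algebra_simps)

lemma act_transvection_13:
  "act (transvection 1 3 t) m M00 = m M00 + 3*t*m M10 + 3*t^2*m M20 + t^3*m M30"
  "act (transvection 1 3 t) m M10 = m M10 + 2*t*m M20 + t^2*m M30"
  "act (transvection 1 3 t) m M01 = m M01 + 2*t*m M11 + t^2*m M21"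
  "act (transvection 1 3 t) m M20 = m M20 + t*m M30"
  "act (transvection 1 3 t) m M11 = m M11 + t*m M21"
  "act (transvection 1 3 t) m M02 = m M02 + t*m M12"
  "act (transvection 1 3 t) m M30 = m M30"
  "act (transvection 1 3 t) m M21 = m M21"
  "act (transvection 1 3 t) m M12 = m M12"
  "act (transvection 1 3 t) m M03 = m M03"
  unfolding act_def idx.simps prod.case sum_3 mv_simps transvection_def vec_lambda_beta
  by (simp_all add: three_neq power2_eq_square power3_eq_cube algebra_simps)

lemma act_transvection_21:
  "act (transvection 2 1 t) m M00 = m M00"
  "act (transvection 2 1 t) m M10 = m M10 + t*m M01"
  "act (transvection 2 1 t) m M01 = m M01"
  "act (transvection 2 1 t) m M20 = m M20 + 2*t*m M11 + t^2*m M02"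
  "act (transvection 2 1 t) m M11 = m M11 + t*m M02"
  "act (transvection 2 1 t) m M02 = m M02"
  "act (transvection 2 1 t) m M30 = m M30 + 3*t*m M21 + 3*t^2*m M12 + t^3*m M03"
  "act (transvection 2 1 t) m M21 = m M21 + 2*t*m M12 + t^2*m M03"
  "act (transvection 2 1 t) m M12 = m M12 + t*m M03"
  "act (transvection 2 1 t) m M03 = m M03"
  unfolding act_def idx.simps prod.case sum_3 mv_simps transvection_def vec_lambda_beta
  by (simp_all add: three_neq power2_eq_square power3_eq_cube algebra_simps)

lemma act_transvection_23:
  "act (transvection 2 3 t) m M00 = m M00 + 3*t*m M01 + 3*t^2*m M02 + t^3*m M03"
  "act (transvection 2 3 t) m M10 = m M10 + 2*t*m M11 + t^2*m M12"
  "act (transvection 2 3 t) m M01 = m M01 + 2*t*m M02 + t^2*m M03"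
  "act (transvection 2 3 t) m M20 = m M20 + t*m M21"
  "act (transvection 2 3 t) m M11 = m M11 + t*m M12"
  "act (transvection 2 3 t) m M02 = m M02 + t*m M03"
  "act (transvection 2 3 t) m M30 = m M30"
  "act (transvection 2 3 t) m M21 = m M21"
  "act (transvection 2 3 t) m M12 = m M12"
  "act (transvection 2 3 t) m M03 = m M03"
  unfolding act_def idx.simps prod.case sum_3 mv_simps transvection_def vec_lambda_beta
  by (simp_all add: three_neq power2_eq_square power3_eq_cube algebra_simps)

lemma act_transvection_31:
  "act (transvection 3 1 t) m M00 = m M00"
  "act (transvection 3 1 t) m M10 = m M10 + t*m M00"
  "act (transvection 3 1 t) m M01 = m M01"
  "act (transvection 3 1 t) m M20 = m M20 + 2*t*m M10 + t^2*m M00"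
  "act (transvection 3 1 t) m M11 = m M11 + t*m M01"
  "act (transvection 3 1 t) m M02 = m M02"
  "act (transvection 3 1 t) m M30 = m M30 + 3*t*m M20 + 3*t^2*m M10 + t^3*m M00"
  "act (transvection 3 1 t) m M21 = m M21 + 2*t*m M11 + t^2*m M01"
  "act (transvection 3 1 t) m M12 = m M12 + t*m M02"
  "act (transvection 3 1 t) m M03 = m M03"
  unfolding act_def idx.simps prod.case sum_3 mv_simps transvection_def vec_lambda_beta
  by (simp_all add: three_neq power2_eq_square power3_eq_cube algebra_simps)

lemma act_transvection_32:
  "act (transvection 3 2 t) m M00 = m M00"
  "act (transvection 3 2 t) m M10 = m M10"
  "act (transvection 3 2 t) m M01 = m M01 + t*m M00"
  "act (transvection 3 2 t) m M20 = m M20"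
  "act (transvection 3 2 t) m M11 = m M11 + t*m M10"
  "act (transvection 3 2 t) m M02 = m M02 + 2*t*m M01 + t^2*m M00"
  "act (transvection 3 2 t) m M30 = m M30"
  "act (transvection 3 2 t) m M21 = m M21 + t*m M20"
  "act (transvection 3 2 t) m M12 = m M12 + 2*t*m M11 + t^2*m M10"
  "act (transvection 3 2 t) m M03 = m M03 + 3*t*m M02 + 3*t^2*m M01 + t^3*m M00"
  unfolding act_def idx.simps prod.case sum_3 mv_simps transvection_def vec_lambda_beta
  by (simp_all add: three_neq power2_eq_square power3_eq_cube algebra_simps)

lemmas act_transvection =
  act_transvection_12 act_transvection_13 act_transvection_21 act_transvection_23 act_transvection_31 act_transvection_32

lemma inv_S_transvection:
  assumes "i \<noteq> j"
  shows "inv_S (act (transvection i j t) m) = inv_S m"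
proof -
  have a: "inv_S (act (transvection 1 2 t) m) = inv_S m"
    unfolding inv_S_def act_transvection by algebra
  have b: "inv_S (act (transvection 1 3 t) m) = inv_S m"
    unfolding inv_S_def act_transvection by algebra
  have c: "inv_S (act (transvection 2 1 t) m) = inv_S m"
    unfolding inv_S_def act_transvection by algebra
  have d: "inv_S (act (transvection 2 3 t) m) = inv_S m"
    unfolding inv_S_def act_transvection by algebra
  have e: "inv_S (act (transvection 3 1 t) m) = inv_S m"
    unfolding inv_S_def act_transvection by algebra
  have f: "inv_S (act (transvection 3 2 t) m) = inv_S m"
    unfolding inv_S_def act_transvection by algebra
  have "\<forall>i j. i \<noteq> j \<longrightarrow> inv_S (act (transvection i j t) m) = inv_S m"
    unfolding forall_3 by (intro conjI impI a b c d e f notI) (simp_all add: three_neq)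
  with assms show ?thesis by blast
qed

lemma inv_T_transvection:
  assumes "i \<noteq> j"
  shows "inv_T (act (transvection i j t) m) = inv_T m"
proof -
  have a: "inv_T (act (transvection 1 2 t) m) = inv_T m"
    unfolding inv_T_def act_transvection by algebra
  have b: "inv_T (act (transvection 1 3 t) m) = inv_T m"
    unfolding inv_T_def act_transvection by algebra
  have c: "inv_T (act (transvection 2 1 t) m) = inv_T m"
    unfolding inv_T_def act_transvection by algebra
  have d: "inv_T (act (transvection 2 3 t) m) = inv_T m"
    unfolding inv_T_def act_transvection by algebra
  have e: "inv_T (act (transvection 3 1 t) m) = inv_T m"
    unfolding inv_T_def act_transvection by algebra
  have f: "inv_T (act (transvection 3 2 t) m) = inv_T m"
    unfolding inv_T_def act_transvection by algebra
  have "\<forall>i j. i \<noteq> j \<longrightarrow> inv_T (act (transvection i j t) m) = inv_T m"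
    unfolding forall_3 by (intro conjI impI a b c d e f notI) (simp_all add: three_neq)
  with assms show ?thesis by blast
qed

lemma act_diagonal:
  assumes "\<And>i j. i \<noteq> j \<Longrightarrow> A$i$j = 0"
  shows "act A m x = A$1$1 ^ fst (expo x) * A$2$2 ^ snd (expo x)
    * A$3$3 ^ (3 - fst (expo x) - snd (expo x)) * m x"
  using assms three_neq
  by (cases x) (simp_all add: act_def sum_3 power2_eq_square power3_eq_cube)

text \<open>By \<open>act_mult\<close> a transvection split off from \<open>A\<close> can be moved
  onto \<open>m\<close>, where it changes neither \<open>f\<close> nor the determinant; a diagonal
  matrix remains. Since \<open>m\<close> changes on the way, the induction is over a claim for all
  \<open>m\<close>.\<close>

lemma invariant_of_transvections:
  assumes T: "\<And>i j t m. i \<noteq> j \<Longrightarrow> f (act (transvection i j t) m) = (f m :: complex)"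
    and w: "\<And>a b c m. f (\<lambda>x. a ^ fst (expo x) * b ^ snd (expo x)
      * c ^ (3 - fst (expo x) - snd (expo x)) * m x) = (a * b * c) ^ d * f m"
    and "det A \<noteq> 0"
  shows "f (act A m) = det A ^ d * f m"
proof -
  have "\<forall>m. f (act A m) = det A ^ d * f m"
    using assms(3)
  proof (rule gauss_induct[rotated 2])
    fix A i j t
    assume ij: "i \<noteq> (j::3)"
      and *: "\<forall>m. f (act (transvection i j t ** A) m) = det (transvection i j t ** A) ^ d * f m"
    show "\<forall>m. f (act A m) = det A ^ d * f m"
    proof
      fix m
      have "A = transvection i j (- t) ** (transvection i j t ** A)"
        by (simp add: transvection_inverse ij)
      then have "f (act A m) = f (act (transvection i j t ** A) (act (transvection i j (- t)) m))"
        by (metis act_mult)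
      then show "f (act A m) = det A ^ d * f m"
        by (simp add: * det_transvection_mult ij T)
    qed
  next
    fix A :: "complex^3^3" assume A: "\<And>i j. i \<noteq> j \<Longrightarrow> A$i$j = 0"
    have "det A = A$1$1 * A$2$2 * A$3$3"
      using A three_neq by (simp add: det_3)
    moreover have "act A m = (\<lambda>x. A$1$1 ^ fst (expo x) * A$2$2 ^ snd (expo x)
        * A$3$3 ^ (3 - fst (expo x) - snd (expo x)) * m x)" for m
      using act_diagonal[OF A] by blast
    ultimately show "\<forall>m. f (act A m) = det A ^ d * f m"
      by (simp only: w) simp
  qed
  then show ?thesis by blast
qed

lemma inv_S_act: "det A \<noteq> 0 \<Longrightarrow> inv_S (act A m) = det A ^ 4 * inv_S m"
proof (rule invariant_of_transvections)
  fix a b c :: complex and m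
  show "inv_S (\<lambda>x. a ^ fst (expo x) * b ^ snd (expo x) * c ^ (3 - fst (expo x) - snd (expo x)) * m x)
      = (a * b * c) ^ 4 * inv_S m"
    unfolding inv_S_def by (simp, algebra)
qed (simp_all add: inv_S_transvection)

lemma inv_T_act: "det A \<noteq> 0 \<Longrightarrow> inv_T (act A m) = det A ^ 6 * inv_T m"
proof (rule invariant_of_transvections)
  fix a b c :: complex and m
  show "inv_T (\<lambda>x. a ^ fst (expo x) * b ^ snd (expo x) * c ^ (3 - fst (expo x) - snd (expo x)) * m x)
      = (a * b * c) ^ 6 * inv_T m"
    unfolding inv_T_def by (simp, algebra)
qed (simp_all add: inv_T_transvection)

lemma homogeneous_inv:
  "homogeneous 4 (inv_S Var :: moment_poly)" "homogeneous 6 (inv_T Var :: moment_poly)"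
  "homogeneous 3 (inv_H Var :: moment_poly)" "homogeneous 8 (inv_G Var :: moment_poly)"
  using whomogeneous_inv[of 1 0 0] by (simp_all add: homogeneous_iff_whomogeneous)

lemma affine_s_inv_S: "affine_s (inv_S Var)"
  unfolding affine_s_def sl3_invariant_iff peval_inv
  using homogeneous_inv leading_coeffs by (simp add: inv_S_act content_oneI[OF int_coeffs_inv(1)])

lemma affine_t_inv_T: "affine_t (inv_T Var)"
  unfolding affine_t_def sl3_invariant_iff peval_inv
  using homogeneous_inv leading_coeffs by (simp add: inv_T_act content_oneI[OF int_coeffs_inv(2)])

subsection \<open>Uniqueness of the Aronhold invariants\<close>

lemma sl3_invariant_diff: "sl3_invariant p \<Longrightarrow> sl3_invariant q \<Longrightarrow> sl3_invariant (p - q)"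
  by (simp add: sl3_invariant_iff)

lemma homogeneous_diff: "homogeneous d p \<Longrightarrow> homogeneous d q \<Longrightarrow> homogeneous d (p - q :: moment_poly)"
  by (simp add: homogeneous_iff_whomogeneous whomogeneous_diff)

text \<open>A diagonal matrix with one entry \<open>t\<close> and the others 1 has determinant
  \<open>t\<close> and scales the coefficient of index (i,j) by t^i, respectively t^j.\<close>

lemma sl3_invariant_weights:
  assumes "sl3_invariant p" "homogeneous d p"
  shows "whomogeneous (\<lambda>x. fst (expo x)) d p" "whomogeneous (\<lambda>x. snd (expo x)) d p"
proof -
  have "peval (\<lambda>x. t ^ fst (expo x) * a x) p = t ^ d * peval a p" if "t \<noteq> 0" for t a
  proof -
    define A :: "complex^3^3" where "A = (\<chi> i j. if i = j then if i = 1 then t else 1 else 0)"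
    have A: "i \<noteq> j \<Longrightarrow> A$i$j = 0" for i j by (simp add: A_def)
    have "act A a = (\<lambda>x. t ^ fst (expo x) * a x)"
      using act_diagonal[OF A, of a] three_neq by (simp add: fun_eq_iff A_def)
    moreover have "det A = t" by (simp add: A_def det_3 three_neq)
    ultimately show ?thesis using sl3_invariant_gl3[OF assms, of A a] that by simp
  qed
  then show "whomogeneous (\<lambda>x. fst (expo x)) d p" by (rule whomogeneousI_scaling)
  have "peval (\<lambda>x. t ^ snd (expo x) * a x) p = t ^ d * peval a p" if "t \<noteq> 0" for t a
  proof -
    define A :: "complex^3^3" where "A = (\<chi> i j. if i = j then if i = 2 then t else 1 else 0)"
    have A: "i \<noteq> j \<Longrightarrow> A$i$j = 0" for i j by (simp add: A_def)
    have "act A a = (\<lambda>x. t ^ snd (expo x) * a x)"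
      using act_diagonal[OF A, of a] three_neq by (simp add: fun_eq_iff A_def)
    moreover have "det A = t" by (simp add: A_def det_3 three_neq)
    ultimately show ?thesis using sl3_invariant_gl3[OF assms, of A a] that by simp
  qed
  then show "whomogeneous (\<lambda>x. snd (expo x)) d p" by (rule whomogeneousI_scaling)
qed

section \<open>Polynomials on lines and on coordinate subspaces\<close>

lemma peval_on_line: "\<exists>q. \<forall>t. peval (\<lambda>x. a x + t * b x) p = poly q (t :: 'a::comm_ring_1)"
proof (induction p rule: mpoly_induct)
  case (Const c)
  show ?case by (intro exI[of _ "[:c:]"]) simp
next
  case (Var x)
  show ?case by (intro exI[of _ "[:a x, b x:]"]) simp
next
  case (add p q)
  then obtain f g where "\<forall>t. peval (\<lambda>x. a x + t * b x) p = poly f t"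
    and "\<forall>t. peval (\<lambda>x. a x + t * b x) q = poly g t" by blast
  then show ?case by (intro exI[of _ "f + g"]) simp
next
  case (mult p q)
  then obtain f g where "\<forall>t. peval (\<lambda>x. a x + t * b x) p = poly f t"
    and "\<forall>t. peval (\<lambda>x. a x + t * b x) q = poly g t" by blast
  then show ?case by (intro exI[of _ "f * g"]) simp
qed

lemma peval_line_vanishes:
  fixes p :: "('v, complex) mpoly"
  assumes "infinite T" "\<And>t. t \<in> T \<Longrightarrow> peval (\<lambda>x. a x + t * b x) p = 0"
  shows "peval (\<lambda>x. a x + t * b x) p = 0"
proof -
  obtain q where q: "\<And>t. peval (\<lambda>x. a x + t * b x) p = poly q t"
    using peval_on_line[of a b p] by blast
  have "q = 0"
    using poly_roots_finite[of q] assms q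
    by (metis (mono_tags, lifting) finite_subset mem_Collect_eq subsetI)
  then show ?thesis by (simp add: q)
qed

lemma meval_monom_of: "meval a (monom_of xs) = prod_list (map a xs)"
  by (induction xs) (simp_all add: monom_of_def meval_add)

lemma wdeg_mvar:
  "wdeg w m = w M00 * Poly_Mapping.lookup m M00 + w M10 * Poly_Mapping.lookup m M10
    + w M01 * Poly_Mapping.lookup m M01 + w M20 * Poly_Mapping.lookup m M20
    + w M11 * Poly_Mapping.lookup m M11 + w M02 * Poly_Mapping.lookup m M02
    + w M30 * Poly_Mapping.lookup m M30 + w M21 * Poly_Mapping.lookup m M21
    + w M12 * Poly_Mapping.lookup m M12 + w M03 * Poly_Mapping.lookup m M03"
  by (subst wdeg_superset[OF finite subset_UNIV]) (simp add: UNIV_mvar)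

lemma monom_of_eqI:
  assumes "\<And>x. x \<in> {M00, M10, M01, M20, M11, M02, M30, M21, M12, M03} \<Longrightarrow> Poly_Mapping.lookup m x = count_list xs x"
  shows "m = monom_of xs"
  using assms by (intro poly_mapping_eqI) (simp only: UNIV_mvar[symmetric] lookup_monom_of UNIV_I)

lemma peval_support:
  assumes a: "\<And>x. x \<notin> A \<Longrightarrow> a x = 0" and K: "finite K"
    and supp: "\<And>m. m \<in> Poly_Mapping.keys p \<Longrightarrow> Poly_Mapping.keys m \<subseteq> A \<Longrightarrow> m \<in> K"
  shows "peval a p = (\<Sum>m\<in>K. Poly_Mapping.lookup p m * meval a m)"
proof -
  have "meval a m = 0" if m: "m \<in> Poly_Mapping.keys p" "m \<notin> K" for m
  proof -
    obtain x where x: "x \<in> Poly_Mapping.keys m" "x \<notin> A" using supp m by blast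
    then have "a x ^ Poly_Mapping.lookup m x = 0" by (simp add: a in_keys_iff zero_power)
    with x(1) show ?thesis unfolding meval_def by (auto intro: prod_zero)
  qed
  then show ?thesis
    unfolding peval_eq_heval heval_def
    by (intro sum.mono_neutral_cong) (auto simp: K in_keys_iff)
qed

section \<open>A normal form of ternary cubics and its residual substitutions\<close>

definition shear :: "complex \<Rightarrow> complex \<Rightarrow> complex \<Rightarrow> complex^3^3"
  where "shear e s r = vector [vector [1, 0, e], vector [s, 1, r], vector [0, 0, 1]]"

lemma shear_simps [simp]:
  "shear e s r $ 1 $ 1 = 1" "shear e s r $ 1 $ 2 = 0" "shear e s r $ 1 $ 3 = e"
  "shear e s r $ 2 $ 1 = s" "shear e s r $ 2 $ 2 = 1" "shear e s r $ 2 $ 3 = r"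
  "shear e s r $ 3 $ 1 = 0" "shear e s r $ 3 $ 2 = 0" "shear e s r $ 3 $ 3 = 1"
  by (simp_all add: shear_def)

lemma det_shear: "det (shear e s r) = 1"
  by (simp add: det_3)

text \<open>A point of the curve is moved to \<open>(0, 1, 0)\<close>, its tangent to the line \<open>u\<^sub>3 = 0\<close>; completing the
  square in \<open>u\<^sub>2\<close> then removes two more coefficients.\<close>
lemma sl3_invariant_zeroI:
  assumes inv: "sl3_invariant p" and hom: "homogeneous d p"
    and zero: "\<And>a. a M03 = 0 \<Longrightarrow> a M12 = 0 \<Longrightarrow> a M11 = 0 \<Longrightarrow> a M01 = 0 \<Longrightarrow> peval a p = 0"
  shows "p = 0"
proof -
  have red: "peval m p = 0" if "det A \<noteq> 0" "peval (act A m) p = 0" for A m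
    using sl3_invariant_gl3[OF inv hom that(1), of m] that by simp
  note act_simps = act_def sum_3 power2_eq_square power3_eq_cube three_neq
  have 1: "peval m p = 0" if m: "m M03 = 0" "m M12 = 0" "m M02 \<noteq> 0" for m
  proof -
    define s r where "s = - m M11 / m M02" and "r = - m M01 / (2 * m M02)"
    have sr: "s * m M02 = - m M11" "2 * r * m M02 = - m M01"
      using m(3) by (simp_all add: s_def r_def)
    have "peval (act (shear 0 s r) m) p = 0"
    proof (rule zero)
      show "act (shear 0 s r) m M11 = 0" "act (shear 0 s r) m M01 = 0"
        using m sr by (simp_all add: act_simps) algebra+
    qed (use m in \<open>simp_all add: act_simps\<close>)
    then show ?thesis using red[of "shear 0 s r" m] by (simp add: det_shear)
  qed
  have 2: "peval m p = 0" if m: "m M03 = 0" "m M12 = 0" for m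
  proof -
    show ?thesis
    proof (cases "m M02 = 0")
      case True
      \<comment> \<open>The degenerate case follows by density: the value is a polynomial in the
        coordinate \<open>M02\<close>, and it is 0 whenever that coordinate is nonzero.\<close>
      have "peval (\<lambda>x. m x + 0 * of_bool (x = M02)) p = 0"
        by (rule peval_line_vanishes[where T = "UNIV - {0}"])
          (use m True in \<open>auto simp: infinite_UNIV_char_0 intro: 1\<close>)
      then show ?thesis by simp
    qed (use m 1 in auto)
  qed
  have 3: "peval m p = 0" if m: "m M03 = 0" for m
  proof (cases "m M02 = 0")
    case True
    \<comment> \<open>Exchanging u_1 and u_3 turns the vanishing \<open>M02\<close> into a vanishing
      \<open>M12\<close>.\<close>
    define A :: "complex^3^3" where "A = vector [vector [0, 0, 1], vector [0, 1, 0], vector [1, 0, 0]]"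
    have A: "A$1$1 = 0" "A$1$2 = 0" "A$1$3 = 1" "A$2$1 = 0" "A$2$2 = 1"
      "A$2$3 = 0" "A$3$1 = 1" "A$3$2 = 0" "A$3$3 = 0"
      by (simp_all add: A_def)
    have "det A = -1" by (simp add: det_3 A)
    moreover have "peval (act A m) p = 0"
      by (rule 2) (use m True in \<open>simp_all add: act_simps A\<close>)
    ultimately show ?thesis using red[of A m] by simp
  next
    case False
    define A :: "complex^3^3" where
      "A = vector [vector [1, 0, 0], vector [0, 1, 0], vector [- m M12 / m M02, 0, 1]]"
    have A: "A$1$1 = 1" "A$1$2 = 0" "A$1$3 = 0" "A$2$1 = 0" "A$2$2 = 1"
      "A$2$3 = 0" "A$3$1 = - m M12 / m M02" "A$3$2 = 0" "A$3$3 = 1"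
      by (simp_all add: A_def)
    have "det A = 1" by (simp add: det_3 A)
    moreover have "peval (act A m) p = 0"
      by (rule 2) (use m False in \<open>simp_all add: act_simps A field_simps\<close>)
    ultimately show ?thesis using red[of A m] by simp
  qed
  show "p = 0"
  proof (rule peval_eq_0_imp_zero)
    fix m
    show "peval m p = 0"
    proof (cases "m M03 = 0")
      case False
      \<comment> \<open>A root gives a point of the curve on the line u_1 = 0, which the
        substitution below moves to (0,1,0).\<close>
      have "degree [:m M00, 3 * m M01, 3 * m M02, m M03:] > 0"
        using False by simp
      from alg_closed_imp_poly_has_root[OF this]
      obtain \<zeta> where \<zeta>: "poly [:m M00, 3 * m M01, 3 * m M02, m M03:] \<zeta> = 0" ..
      define A :: "complex^3^3" where "A = vector [vector [1, 0, 0], vector [0, \<zeta>, 1], vector [0, 1, 0]]"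
      have A: "A$1$1 = 1" "A$1$2 = 0" "A$1$3 = 0" "A$2$1 = 0" "A$2$2 = \<zeta>"
        "A$2$3 = 1" "A$3$1 = 0" "A$3$2 = 1" "A$3$3 = 0"
        by (simp_all add: A_def)
      have "det A = -1" by (simp add: det_3 A)
      moreover have "peval (act A m) p = 0"
        by (rule 3) (use \<zeta> in \<open>simp add: act_simps A algebra_simps\<close>)
      ultimately show ?thesis using red[of A m] by simp
    qed (rule 3)
  qed
qed

text \<open>The small linear space left by the preceding reduction: 3 \<alpha> u_2^2 u_3 + 3 \<beta>
  u_1^2 u_2 plus a binary cubic in u_1 and u_3. For \<beta> = 0 this is a Weierstrass form.\<close>

definition slice :: "complex \<Rightarrow> complex \<Rightarrow> complex \<Rightarrow> complex \<Rightarrow> complex \<Rightarrow> complex \<Rightarrow> mvar \<Rightarrow> complex"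
  where "slice \<beta> \<alpha> a b c e = (\<lambda>x. case x of M21 \<Rightarrow> \<beta> | M02 \<Rightarrow> \<alpha> | M30 \<Rightarrow> a | M20 \<Rightarrow> b | M10 \<Rightarrow> c
    | M00 \<Rightarrow> e | _ \<Rightarrow> 0)"

lemma slice_simps [simp]:
  "slice \<beta> \<alpha> a b c e M21 = \<beta>" "slice \<beta> \<alpha> a b c e M02 = \<alpha>" "slice \<beta> \<alpha> a b c e M30 = a"
  "slice \<beta> \<alpha> a b c e M20 = b" "slice \<beta> \<alpha> a b c e M10 = c" "slice \<beta> \<alpha> a b c e M00 = e"
  "slice \<beta> \<alpha> a b c e M11 = 0" "slice \<beta> \<alpha> a b c e M01 = 0" "slice \<beta> \<alpha> a b c e M12 = 0"
  "slice \<beta> \<alpha> a b c e M03 = 0"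
  by (simp_all add: slice_def)

text \<open>The two hypotheses say that the sheared cubic again has vanishing \<open>M11\<close> and
  \<open>M01\<close>. Equal values of an invariant at both cubics then yield linear relations
  between its coefficients on the slice.\<close>

lemma act_shear_slice:
  assumes "6 * \<alpha> * s + 6 * \<beta> * e = 0" "2 * \<alpha> * r + \<beta> * e^2 = 0"
  shows "act (shear e s r) (slice \<beta> \<alpha> a b c d) = slice \<beta> \<alpha> (a + 3 * \<beta> * s)
    (b + e * a + \<alpha> * s^2 + \<beta> * (r + 2 * e * s)) (c + 2 * e * b + e^2 * a + 2 * \<alpha> * s * r + \<beta> * (e^2 * s + 2 * e * r))
    (d + 3 * e * c + 3 * e^2 * b + e^3 * a + 3 * \<alpha> * r^2 + 3 * \<beta> * e^2 * r)"
proof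
  fix x
  show "act (shear e s r) (slice \<beta> \<alpha> a b c d) x = slice \<beta> \<alpha> (a + 3 * \<beta> * s)
    (b + e * a + \<alpha> * s^2 + \<beta> * (r + 2 * e * s)) (c + 2 * e * b + e^2 * a + 2 * \<alpha> * s * r + \<beta> * (e^2 * s + 2 * e * r))
    (d + 3 * e * c + 3 * e^2 * b + e^3 * a + 3 * \<alpha> * r^2 + 3 * \<beta> * e^2 * r) x"
  proof (cases x)
    case M00
    show ?thesis
      unfolding M00 act_def idx.simps prod.case sum_3 mv_simps slice_simps shear_simps
      by algebra
  next
    case M10
    show ?thesis
      unfolding M10 act_def idx.simps prod.case sum_3 mv_simps slice_simps shear_simps
      by algebra
  next
    case M01
    show ?thesis
      unfolding M01 act_def idx.simps prod.case sum_3 mv_simps slice_simps shear_simps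
      using assms by algebra
  next
    case M20
    show ?thesis
      unfolding M20 act_def idx.simps prod.case sum_3 mv_simps slice_simps shear_simps
      by algebra
  next
    case M11
    show ?thesis
      unfolding M11 act_def idx.simps prod.case sum_3 mv_simps slice_simps shear_simps
      using assms by algebra
  next
    case M02
    show ?thesis
      unfolding M02 act_def idx.simps prod.case sum_3 mv_simps slice_simps shear_simps
      by simp
  next
    case M30
    show ?thesis
      unfolding M30 act_def idx.simps prod.case sum_3 mv_simps slice_simps shear_simps
      by algebra
  next
    case M21
    show ?thesis
      unfolding M21 act_def idx.simps prod.case sum_3 mv_simps slice_simps shear_simps
      by simp
  next
    case M12
    show ?thesis
      unfolding M12 act_def idx.simps prod.case sum_3 mv_simps slice_simps shear_simps
      by simp
  next
    case M03
    show ?thesis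
      unfolding M03 act_def idx.simps prod.case sum_3 mv_simps slice_simps shear_simps
      by simp
  qed
qed

lemma sl3_invariant_shear:
  assumes "sl3_invariant p"
  shows "6 * \<alpha> * s + 6 * \<beta> * e = 0 \<Longrightarrow> 2 * \<alpha> * r + \<beta> * e^2 = 0 \<Longrightarrow>
    peval (slice \<beta> \<alpha> (a + 3 * \<beta> * s)
    (b + e * a + \<alpha> * s^2 + \<beta> * (r + 2 * e * s)) (c + 2 * e * b + e^2 * a + 2 * \<alpha> * s * r + \<beta> * (e^2 * s + 2 * e * r))
    (d + 3 * e * c + 3 * e^2 * b + e^3 * a + 3 * \<alpha> * r^2 + 3 * \<beta> * e^2 * r)) p = peval (slice \<beta> \<alpha> a b c d) p"
  using assms unfolding sl3_invariant_iff by (metis act_shear_slice det_shear)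

lemma supp_bound:
  assumes "sl3_invariant p" "homogeneous d p" "m \<in> Poly_Mapping.keys p"
  shows "wdeg (\<lambda>_. 1) m = d" "wdeg (\<lambda>x. fst (expo x)) m = d" "wdeg (\<lambda>x. snd (expo x)) m = d"
  using assms sl3_invariant_weights[OF assms(1,2)]
  by (auto simp: homogeneous_def whomogeneous_def)

lemma not_keys_lookup: "Poly_Mapping.keys m \<subseteq> A \<Longrightarrow> x \<notin> A \<Longrightarrow> Poly_Mapping.lookup m x = 0"
  by (metis in_keys_iff subsetD)

lemma monom_of_neq: "count_list xs x \<noteq> count_list ys x \<Longrightarrow> monom_of xs \<noteq> monom_of ys"
  by (metis lookup_monom_of)

text \<open>The hypotheses are the degree and the two weights of a monomial in the six coordinates
  of the slice; a quartic invariant thus has at most three coefficients there.\<close>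

lemma weights4:
  fixes n21 n02 n30 n20 n10 n00 :: nat
  assumes 1: "n21 + n02 + n30 + n20 + n10 + n00 = 4"
    and 2: "2 * n21 + 3 * n30 + 2 * n20 + n10 = 4" and 3: "n21 + 2 * n02 = 4"
  shows "[n21, n02, n30, n20, n10, n00] \<in> set [[2, 1, 0, 0, 0, 1], [0, 2, 1, 0, 1, 0], [0, 2, 0, 2, 0, 0]]"
proof -
  have *: "n02 = 0 \<or> n02 = 1 \<or> n02 = 2" "n30 = 0 \<or> n30 = 1" "n20 = 0 \<or> n20 = 1 \<or> n20 = 2"
    using 2 3 by linarith+
  have n21: "n21 = 4 - 2 * n02" using 3 by simp
  have n10: "n10 = 4 - 2 * n21 - 3 * n30 - 2 * n20" using 2 by simp
  have n00: "n00 = 4 - n21 - n02 - n30 - n20 - n10" using 1 by simp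
  show ?thesis
    using * assms unfolding n00 n10 n21 by (elim disjE) simp_all
qed
lemma weights6:
  fixes n21 n02 n30 n20 n10 n00 :: nat
  assumes 1: "n21 + n02 + n30 + n20 + n10 + n00 = 6"
    and 2: "2 * n21 + 3 * n30 + 2 * n20 + n10 = 6" and 3: "n21 + 2 * n02 = 6"
  shows "[n21, n02, n30, n20, n10, n00] \<in> set [[0, 3, 2, 0, 0, 1], [0, 3, 1, 1, 1, 0], [0, 3, 0, 3, 0, 0],
    [2, 2, 0, 1, 0, 1], [2, 2, 0, 0, 2, 0]]"
proof -
  have *: "n02 = 0 \<or> n02 = 1 \<or> n02 = 2 \<or> n02 = 3" "n30 = 0 \<or> n30 = 1 \<or> n30 = 2" "n20 = 0 \<or> n20 = 1 \<or> n20 = 2 \<or> n20 = 3"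
    using 2 3 by linarith+
  have n21: "n21 = 6 - 2 * n02" using 3 by simp
  have n10: "n10 = 6 - 2 * n21 - 3 * n30 - 2 * n20" using 2 by simp
  have n00: "n00 = 6 - n21 - n02 - n30 - n20 - n10" using 1 by simp
  show ?thesis
    using * assms unfolding n00 n10 n21 by (elim disjE) simp_all
qed

text \<open>For the three coefficients on the slice, two relations come from shears and a third from
  the vanishing leading coefficient.\<close>

lemma quartic_invariant_zero:
  assumes inv: "sl3_invariant p" and hom: "homogeneous 4 p"
    and lead: "Poly_Mapping.lookup p (monom_of [M00, M02, M12, M30]) = 0"
  shows "p = 0"
proof -
  let ?K = "{monom_of [M21, M21, M02, M00], monom_of [M02, M02, M30, M10], monom_of [M02, M02, M20, M20]}"
  define c1 c2 c3 where "c1 = Poly_Mapping.lookup p (monom_of [M21, M21, M02, M00])"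
    and "c2 = Poly_Mapping.lookup p (monom_of [M02, M02, M30, M10])"
    and "c3 = Poly_Mapping.lookup p (monom_of [M02, M02, M20, M20])"
  have sl: "peval a p = c1 * a M21^2 * a M02 * a M00 + c2 * a M02^2 * a M30 * a M10 + c3 * a M02^2 * a M20^2"
    if a: "a M03 = 0" "a M12 = 0" "a M11 = 0" "a M01 = 0" for a
  proof -
    have "peval a p = (\<Sum>m\<in>?K. Poly_Mapping.lookup p m * meval a m)"
    proof (rule peval_support[where A = "UNIV - {M03, M12, M11, M01}"])
      show "a x = 0" if "x \<notin> UNIV - {M03, M12, M11, M01}" for x using a that by auto
    next
      fix m assume m: "m \<in> Poly_Mapping.keys p" and "Poly_Mapping.keys m \<subseteq> UNIV - {M03, M12, M11, M01}"
      then have z: "Poly_Mapping.lookup m M03 = 0" "Poly_Mapping.lookup m M12 = 0"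
        "Poly_Mapping.lookup m M11 = 0" "Poly_Mapping.lookup m M01 = 0"
        by (auto intro: not_keys_lookup)
      note w = supp_bound[OF inv hom m, unfolded wdeg_mvar z, simplified]
      let ?L = "[Poly_Mapping.lookup m M21, Poly_Mapping.lookup m M02, Poly_Mapping.lookup m M30,
          Poly_Mapping.lookup m M20, Poly_Mapping.lookup m M10, Poly_Mapping.lookup m M00]"
      have "?L
        \<in> set [[2, 1, 0, 0, 0, 1], [0, 2, 1, 0, 1, 0], [0, 2, 0, 2, 0, 0]]"
        by (rule weights4) (use w in linarith)+
      moreover have "?L = [2, 1, 0, 0, 0, 1] \<Longrightarrow> m = monom_of [M21, M21, M02, M00]"
        "?L = [0, 2, 1, 0, 1, 0] \<Longrightarrow> m = monom_of [M02, M02, M30, M10]"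
        "?L = [0, 2, 0, 2, 0, 0] \<Longrightarrow> m = monom_of [M02, M02, M20, M20]"
        using z by (auto intro!: monom_of_eqI)
      ultimately show "m \<in> ?K"
        unfolding set_simps insert_iff empty_iff by blast
    qed simp
    also have "\<dots> = c1 * a M21^2 * a M02 * a M00 + c2 * a M02^2 * a M30 * a M10 + c3 * a M02^2 * a M20^2"
      using monom_of_neq[of "[M21, M21, M02, M00]" M21 "[M02, M02, M30, M10]"]
        monom_of_neq[of "[M21, M21, M02, M00]" M21 "[M02, M02, M20, M20]"]
        monom_of_neq[of "[M02, M02, M30, M10]" M20 "[M02, M02, M20, M20]"]
      by (simp add: meval_monom_of c1_def c2_def c3_def power2_eq_square)
    finally show ?thesis .
  qed
  \<comment> \<open>The cubic u_1^3 + 3 u_2^2 u_3 under u_1 -> u_1 + u_3.\<close>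
  have r1: "c2 + c3 = 0"
    using sl3_invariant_shear[OF inv, of 1 0 0 1 0 1 0 0 0] by (simp add: sl)
  \<comment> \<open>The cubic 3 u_1^2 u_2 + 3 u_2^2 u_3 under a shear with e = 1; then s = -1 and r
    = -1/2 are forced.\<close>
  have r2: "- 3 / 4 * c1 + 3 * c2 + 9 / 4 * c3 = 0"
    using sl3_invariant_shear[OF inv, of 1 "-1" 1 1 "- 1 / 2" 0 0 0 0]
    by (simp add: sl power2_eq_square algebra_simps)
  have "c3 = 0"
  proof -
    \<comment> \<open>At u_1^3 + 3 u_1 u_2^2 + 3 u_2^2 u_3 + u_3^3 the weights leave only the
      leading monomial. Replacing u_3 by u_3 - u_1 brings this cubic into the slice, where the value
      of \<open>p\<close> is \<open>c3\<close>.\<close>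
    define a :: "mvar \<Rightarrow> complex" where "a = (\<lambda>x. of_bool (x \<in> {M00, M02, M12, M30}))"
    define A :: "complex^3^3" where "A = vector [vector [1, 0, 0], vector [0, 1, 0], vector [- 1, 0, 1]]"
    have "peval a p = (\<Sum>m\<in>{monom_of [M00, M02, M12, M30]}. Poly_Mapping.lookup p m * meval a m)"
    proof (rule peval_support[where A = "{M00, M02, M12, M30}"])
      fix m assume m: "m \<in> Poly_Mapping.keys p" and s: "Poly_Mapping.keys m \<subseteq> {M00, M02, M12, M30}"
      then have z: "Poly_Mapping.lookup m M03 = 0" "Poly_Mapping.lookup m M11 = 0"
        "Poly_Mapping.lookup m M01 = 0" "Poly_Mapping.lookup m M10 = 0"
        "Poly_Mapping.lookup m M20 = 0" "Poly_Mapping.lookup m M21 = 0"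
        by (auto intro: not_keys_lookup)
      note w = supp_bound[OF inv hom m, unfolded wdeg_mvar z, simplified]
      have "Poly_Mapping.lookup m M30 = 1" using w by linarith
      with w have "Poly_Mapping.lookup m M12 = 1" "Poly_Mapping.lookup m M02 = 1"
        "Poly_Mapping.lookup m M30 = 1" "Poly_Mapping.lookup m M00 = 1"
        by linarith+
      then show "m \<in> {monom_of [M00, M02, M12, M30]}"
        using z by (auto intro!: monom_of_eqI)
    qed (auto simp: a_def)
    then have "peval a p = 0" by (simp add: lead)
    moreover have "det A = 1" by (simp add: A_def det_3)
    ultimately have "peval (act A a) p = 0"
      using inv unfolding sl3_invariant_iff by simp
    moreover have "act A a M03 = 0" "act A a M12 = 0" "act A a M11 = 0" "act A a M01 = 0"
      "act A a M02 = 1" "act A a M21 = 0" "act A a M30 = 0" "act A a M20 = 1"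
      by (simp_all add: act_def A_def a_def sum_3)
    ultimately show ?thesis by (simp add: sl)
  qed
  with r1 r2 have "c1 = 0" "c2 = 0" "c3 = 0" by auto
  then show ?thesis by (intro sl3_invariant_zeroI[OF inv hom]) (simp add: sl)
qed

lemma sextic_invariant_zero:
  assumes inv: "sl3_invariant p" and hom: "homogeneous 6 p"
    and lead: "Poly_Mapping.lookup p (monom_of [M00, M00, M03, M03, M30, M30]) = 0"
  shows "p = 0"
proof -
  let ?m1 = "[M02, M02, M02, M30, M30, M00]" and ?m2 = "[M02, M02, M02, M30, M20, M10]"
    and ?m3 = "[M02, M02, M02, M20, M20, M20]" and ?m4 = "[M21, M21, M02, M02, M20, M00]"
    and ?m5 = "[M21, M21, M02, M02, M10, M10]"
  let ?K = "{monom_of ?m1, monom_of ?m2, monom_of ?m3, monom_of ?m4, monom_of ?m5}"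
  define d1 d2 d3 d4 d5 where "d1 = Poly_Mapping.lookup p (monom_of ?m1)"
    and "d2 = Poly_Mapping.lookup p (monom_of ?m2)" and "d3 = Poly_Mapping.lookup p (monom_of ?m3)"
    and "d4 = Poly_Mapping.lookup p (monom_of ?m4)" and "d5 = Poly_Mapping.lookup p (monom_of ?m5)"
  have sl: "peval a p = a M02^3 * (d1 * a M30^2 * a M00 + d2 * a M30 * a M20 * a M10 + d3 * a M20^3)
      + a M21^2 * a M02^2 * (d4 * a M20 * a M00 + d5 * a M10^2)"
    if a: "a M03 = 0" "a M12 = 0" "a M11 = 0" "a M01 = 0" for a
  proof -
    have "peval a p = (\<Sum>m\<in>?K. Poly_Mapping.lookup p m * meval a m)"
    proof (rule peval_support[where A = "UNIV - {M03, M12, M11, M01}"])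
      show "a x = 0" if "x \<notin> UNIV - {M03, M12, M11, M01}" for x using a that by auto
    next
      fix m assume m: "m \<in> Poly_Mapping.keys p" and "Poly_Mapping.keys m \<subseteq> UNIV - {M03, M12, M11, M01}"
      then have z: "Poly_Mapping.lookup m M03 = 0" "Poly_Mapping.lookup m M12 = 0"
        "Poly_Mapping.lookup m M11 = 0" "Poly_Mapping.lookup m M01 = 0"
        by (auto intro: not_keys_lookup)
      note w = supp_bound[OF inv hom m, unfolded wdeg_mvar z, simplified]
      let ?L = "[Poly_Mapping.lookup m M21, Poly_Mapping.lookup m M02, Poly_Mapping.lookup m M30,
          Poly_Mapping.lookup m M20, Poly_Mapping.lookup m M10, Poly_Mapping.lookup m M00]"
      have "?L
        \<in> set [[0, 3, 2, 0, 0, 1], [0, 3, 1, 1, 1, 0], [0, 3, 0, 3, 0, 0], [2, 2, 0, 1, 0, 1], [2, 2, 0, 0, 2, 0]]"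
        by (rule weights6) (use w in linarith)+
      moreover have "?L = [0, 3, 2, 0, 0, 1] \<Longrightarrow> m = monom_of ?m1"
        "?L = [0, 3, 1, 1, 1, 0] \<Longrightarrow> m = monom_of ?m2"
        "?L = [0, 3, 0, 3, 0, 0] \<Longrightarrow> m = monom_of ?m3"
        "?L = [2, 2, 0, 1, 0, 1] \<Longrightarrow> m = monom_of ?m4"
        "?L = [2, 2, 0, 0, 2, 0] \<Longrightarrow> m = monom_of ?m5"
        using z by (auto intro!: monom_of_eqI)
      ultimately show "m \<in> ?K"
        unfolding set_simps insert_iff empty_iff by blast
    qed simp
    also have "\<dots> = a M02^3 * (d1 * a M30^2 * a M00 + d2 * a M30 * a M20 * a M10 + d3 * a M20^3)
      + a M21^2 * a M02^2 * (d4 * a M20 * a M00 + d5 * a M10^2)"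
      using monom_of_neq[of ?m1 M10 ?m2] monom_of_neq[of ?m1 M30 ?m3] monom_of_neq[of ?m1 M30 ?m4]
        monom_of_neq[of ?m1 M30 ?m5] monom_of_neq[of ?m2 M30 ?m3] monom_of_neq[of ?m2 M30 ?m4]
        monom_of_neq[of ?m2 M30 ?m5] monom_of_neq[of ?m3 M21 ?m4] monom_of_neq[of ?m3 M21 ?m5]
        monom_of_neq[of ?m4 M20 ?m5]
      by (simp add: meval_monom_of d1_def d2_def d3_def d4_def d5_def power2_eq_square power3_eq_cube algebra_simps)
    finally show ?thesis .
  qed
  have r1: "d1 + d2 + d3 = 0"
    using sl3_invariant_shear[OF inv, of 1 0 0 1 0 1 0 0 0] by (simp add: sl)
  \<comment> \<open>Here u_1 -> u_1 - u_3 is applied to u_1^3 + 3 u_1^2 u_3 + 3 u_2^2 u_3.\<close>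
  have r2: "d1 * 2 = d3"
    using sl3_invariant_shear[OF inv, of 1 0 0 "-1" 0 1 1 0 0] by (simp add: sl)
  have "d1 = 0"
  proof -
    \<comment> \<open>On the Fermat cubic only the leading monomial survives. Substituting u_2 +
      u_3, u_3 - u_2, u_1 turns it into u_1^3 + 6 u_2^2 u_3 + 2 u_3^3, which lies in the
      slice.\<close>
    define a :: "mvar \<Rightarrow> complex" where "a = (\<lambda>x. of_bool (x \<in> {M00, M03, M30}))"
    define A :: "complex^3^3" where "A = vector [vector [0, 1, 1], vector [0, - 1, 1], vector [1, 0, 0]]"
    let ?m = "[M00, M00, M03, M03, M30, M30]"
    have "peval a p = (\<Sum>m\<in>{monom_of ?m}. Poly_Mapping.lookup p m * meval a m)"
    proof (rule peval_support[where A = "{M00, M03, M30}"])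
      fix m assume m: "m \<in> Poly_Mapping.keys p" and s: "Poly_Mapping.keys m \<subseteq> {M00, M03, M30}"
      then have z: "Poly_Mapping.lookup m M02 = 0" "Poly_Mapping.lookup m M11 = 0"
        "Poly_Mapping.lookup m M01 = 0" "Poly_Mapping.lookup m M10 = 0" "Poly_Mapping.lookup m M12 = 0"
        "Poly_Mapping.lookup m M20 = 0" "Poly_Mapping.lookup m M21 = 0"
        by (auto intro: not_keys_lookup)
      note w = supp_bound[OF inv hom m, unfolded wdeg_mvar z, simplified]
      have "Poly_Mapping.lookup m M03 = 2" "Poly_Mapping.lookup m M30 = 2" "Poly_Mapping.lookup m M00 = 2"
        using w by linarith+
      then show "m \<in> {monom_of ?m}"
        using z by (auto intro!: monom_of_eqI)
    qed (auto simp: a_def)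
    then have "peval a p = 0" by (simp add: lead)
    moreover have "det A = 2" by (simp add: A_def det_3)
    ultimately have "peval (act A a) p = 0"
      using sl3_invariant_gl3[OF inv hom, of A a] by simp
    moreover have "act A a M03 = 0" "act A a M12 = 0" "act A a M11 = 0" "act A a M01 = 0"
      "act A a M02 = 2" "act A a M21 = 0" "act A a M30 = 1" "act A a M20 = 0" "act A a M00 = 2"
      by (simp_all add: act_def A_def a_def sum_3)
    ultimately show ?thesis by (simp add: sl)
  qed
  with r1 r2 have d: "d1 = 0" "d2 = 0" "d3 = 0" by auto
  \<comment> \<open>With \<open>d1\<close>, \<open>d2\<close>, \<open>d3\<close> gone, two cubics
    with \<beta> = 1 that differ in the coefficient of u_3^3 give independent relations for
    \<open>d4\<close> and \<open>d5\<close>.\<close>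
  have r4: "9 / 8 * d4 + d5 = 0"
    using sl3_invariant_shear[OF inv, of 1 "-1" 1 1 "- 1 / 2" 0 0 0 0]
    by (simp add: sl d power2_eq_square algebra_simps)
  have r5: "- 3 / 8 * d4 + d5 = 0"
    using sl3_invariant_shear[OF inv, of 1 "-1" 1 1 "- 1 / 2" 0 0 0 1]
    by (simp add: sl d power2_eq_square algebra_simps)
  have "d4 = 0" "d5 = 0"
    using r4 r5 by algebra+
  with d show ?thesis by (intro sl3_invariant_zeroI[OF inv hom]) (simp add: sl)
qed

lemma affine_s_iff: "affine_s s \<longleftrightarrow> s = inv_S Var"
proof
  assume s: "affine_s s"
  have "s - inv_S Var = 0"
    using s affine_s_inv_S unfolding affine_s_def
    by (intro quartic_invariant_zero)
      (simp_all add: sl3_invariant_diff homogeneous_diff lookup_minus)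
  then show "s = inv_S Var" by simp
qed (simp add: affine_s_inv_S)

lemma affine_t_iff: "affine_t t \<longleftrightarrow> t = inv_T Var"
proof
  assume t: "affine_t t"
  have "t - inv_T Var = 0"
    using t affine_t_inv_T unfolding affine_t_def
    by (intro sextic_invariant_zero)
      (simp_all add: sl3_invariant_diff homogeneous_diff lookup_minus)
  then show "t = inv_T Var" by simp
qed (simp add: affine_t_inv_T)

subsection \<open>Counting the terms\<close>

text \<open>Iterated dense coefficient lists: \<open>NL [p\<^sub>0, p\<^sub>1, \<dots>]\<close> stands for \<open>\<Sum>\<^sub>i p\<^sub>i x\<^sup>i\<close>, with the \<open>p\<^sub>i\<close> in the
  remaining variables.\<close>

datatype npoly = NC int | NL "npoly list"

fun nadd :: "npoly \<Rightarrow> npoly \<Rightarrow> npoly" and ladd :: "npoly list \<Rightarrow> npoly list \<Rightarrow> npoly list"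
  and cadd :: "npoly \<Rightarrow> npoly list \<Rightarrow> npoly list" and addc :: "npoly list \<Rightarrow> npoly \<Rightarrow> npoly list" where
  "nadd (NC a) (NC b) = NC (a + b)"
| "nadd (NC a) (NL ys) = NL (cadd (NC a) ys)"
| "nadd (NL xs) (NC b) = NL (addc xs (NC b))"
| "nadd (NL xs) (NL ys) = NL (ladd xs ys)"
| "cadd p [] = [p]"
| "cadd p (y # ys) = nadd p y # ys"
| "addc [] q = [q]"
| "addc (x # xs) q = nadd x q # xs"
| "ladd [] ys = ys"
| "ladd (x # xs) [] = x # xs"
| "ladd (x # xs) (y # ys) = nadd x y # ladd xs ys"

fun nmul :: "npoly \<Rightarrow> npoly \<Rightarrow> npoly" and lmul :: "npoly list \<Rightarrow> npoly list \<Rightarrow> npoly list"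
 and lsc :: "npoly \<Rightarrow> npoly list \<Rightarrow> npoly list" and rsc :: "npoly list \<Rightarrow> npoly \<Rightarrow> npoly list" where
  "nmul (NC a) (NC b) = NC (a * b)"
| "nmul (NC a) (NL ys) = NL (lsc (NC a) ys)"
| "nmul (NL xs) (NC b) = NL (rsc xs (NC b))"
| "nmul (NL xs) (NL ys) = NL (lmul xs ys)"
| "lmul [] ys = []"
| "lmul (x # xs) ys = ladd (lsc x ys) (NL [] # lmul xs ys)"
| "lsc x [] = []"
| "lsc x (y # ys) = nmul x y # lsc x ys"
| "rsc [] q = []"
| "rsc (x # xs) q = nmul x q # rsc xs q"

fun ncount :: "npoly \<Rightarrow> nat" and lcount :: "npoly list \<Rightarrow> nat" where
  "ncount (NC a) = (if a = 0 then 0 else 1)"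
| "ncount (NL xs) = lcount xs"
| "lcount [] = 0"
| "lcount (x # xs) = ncount x + lcount xs"

fun nsem :: "(nat \<Rightarrow> 'a::comm_ring_1) \<Rightarrow> npoly \<Rightarrow> 'a" and lsem :: "(nat \<Rightarrow> 'a) \<Rightarrow> npoly list \<Rightarrow> 'a" where
  "nsem f (NC c) = of_int c"
| "nsem f (NL xs) = lsem f xs"
| "lsem f [] = 0"
| "lsem f (x # xs) = nsem (\<lambda>i. f (Suc i)) x + f 0 * lsem f xs"

lemma nsem_nadd:
  fixes f :: "nat \<Rightarrow> 'a::comm_ring_1"
  shows "nsem f (nadd p q) = nsem f p + nsem f q"
    and "lsem f (ladd xs ys) = lsem f xs + lsem f ys"
    and "lsem f (cadd p ys) = nsem (\<lambda>i. f (Suc i)) p + lsem f ys"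
    and "lsem f (addc xs q) = lsem f xs + nsem (\<lambda>i. f (Suc i)) q"
  by (induction p q and xs ys and p ys and xs q arbitrary: f and f and f and f
      rule: nadd_ladd_cadd_addc.induct)
    (simp_all add: algebra_simps)

lemma nsem_nmul:
  fixes f :: "nat \<Rightarrow> 'a::comm_ring_1"
  shows "nsem f (nmul p q) = nsem f p * nsem f q"
    and "lsem f (lmul xs ys) = lsem f xs * lsem f ys"
    and "lsem f (lsc p ys) = nsem (\<lambda>i. f (Suc i)) p * lsem f ys"
    and "lsem f (rsc xs q) = lsem f xs * nsem (\<lambda>i. f (Suc i)) q"
  by (induction p q and xs ys and p ys and xs q arbitrary: f and f and f and f
      rule: nmul_lmul_lsc_rsc.induct)
    (simp_all add: nsem_nadd algebra_simps)

lemma peval_of_int [simp]: "peval a (of_int k) = (of_int k :: 'a::comm_ring_1)"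
  by (cases k rule: int_diff_cases) (simp add: peval_eq_heval heval_diff semiring_hom_id peval.heval_of_nat)

lemma peval_nsem:
  fixes f :: "nat \<Rightarrow> ('v, 'a::comm_ring_1) mpoly"
  shows "peval a (nsem f p) = nsem (\<lambda>i. peval a (f i)) p"
    and "peval a (lsem f xs) = lsem (\<lambda>i. peval a (f i)) xs"
  by (induction p and xs arbitrary: f and f rule: ncount_lcount.induct) simp_all

lemma lookup_single_mult:
  "Poly_Mapping.lookup (Poly_Mapping.single n (1::'a::comm_semiring_1) * p) (n + m) =
    Poly_Mapping.lookup p (m :: 'v \<Rightarrow>\<^sub>0 nat)"
  by (induction p rule: mpoly_induct_single)
    (simp_all add: mult_single lookup_single when_def distrib_left lookup_add)

lemma keys_Var_mult:
  fixes p :: "('v, 'a::comm_semiring_1) mpoly"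
  shows "Poly_Mapping.keys (Var x * p) = (\<lambda>m. Poly_Mapping.single x 1 + m) ` Poly_Mapping.keys p"
proof -
  have "Poly_Mapping.keys (Var x * p) \<subseteq> (\<lambda>m. Poly_Mapping.single x 1 + m) ` Poly_Mapping.keys p"
    using keys_mult[of "Var x" p] by (auto simp: Var_def)
  then show ?thesis
    using lookup_single_mult[of "Poly_Mapping.single x 1" p] by (auto simp: in_keys_iff Var_def)
qed

lemma keys_add_disjoint:
  assumes "Poly_Mapping.keys p \<inter> Poly_Mapping.keys q = {}"
  shows "Poly_Mapping.keys (p + q) = Poly_Mapping.keys p \<union> Poly_Mapping.keys (q :: 'k \<Rightarrow>\<^sub>0 'a::comm_monoid_add)"
proof -
  have "k \<in> Poly_Mapping.keys (p + q)" if "k \<in> Poly_Mapping.keys p \<union> Poly_Mapping.keys q" for k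
  proof -
    have "Poly_Mapping.lookup p k = 0 \<or> Poly_Mapping.lookup q k = 0"
      using assms by (metis disjoint_iff in_keys_iff)
    then show ?thesis using that by (auto simp: in_keys_iff lookup_add)
  qed
  then show ?thesis using Poly_Mapping.keys_add[of p q] by blast
qed

lemma keys_of_int:
  "Poly_Mapping.keys (of_int c :: ('v, complex) mpoly) = (if c = 0 then {} else {0})"
  by (auto simp: in_keys_iff lookup_of_int when_def split: if_splits)

text \<open>The part free of the current variable and the multiples of that variable share no
  monomial, so nothing cancels and the nonzero leaves correspond to the terms. The index
  \<open>k\<close> records the variables already split off.\<close>

lemma keys_nsem_Var:
  fixes f :: "nat \<Rightarrow> (nat, complex) mpoly"
  assumes "\<And>i. f i = Var (k + i)"
  shows "(\<forall>m\<in>Poly_Mapping.keys (nsem f p). \<forall>j<k. Poly_Mapping.lookup m j = 0) \<and>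
      card (Poly_Mapping.keys (nsem f p)) = ncount p"
    and "(\<forall>m\<in>Poly_Mapping.keys (lsem f xs). \<forall>j<k. Poly_Mapping.lookup m j = 0) \<and>
      card (Poly_Mapping.keys (lsem f xs)) = lcount xs"
  using assms
proof (induction p and xs arbitrary: k f and k f rule: ncount_lcount.induct)
  case (1 c)
  then show ?case by (simp add: keys_of_int)
next
  case (4 x xs)
  let ?A = "nsem (\<lambda>i. f (Suc i)) x" and ?B = "lsem f xs"
  have f: "f 0 = Var k" using 4(3) by simp
  have A: "\<forall>m\<in>Poly_Mapping.keys ?A. \<forall>j<Suc k. Poly_Mapping.lookup m j = 0"
    "card (Poly_Mapping.keys ?A) = ncount x"
    using 4(1)[of "\<lambda>i. f (Suc i)" "Suc k"] 4(3)[of "Suc _"] by simp_all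
  have B: "\<forall>m\<in>Poly_Mapping.keys ?B. \<forall>j<k. Poly_Mapping.lookup m j = 0"
    "card (Poly_Mapping.keys ?B) = lcount xs"
    using 4(2)[OF 4(3)] by blast+
  have K: "Poly_Mapping.keys (f 0 * ?B) = (\<lambda>m. Poly_Mapping.single k 1 + m) ` Poly_Mapping.keys ?B"
    unfolding f by (rule keys_Var_mult)
  have disj: "Poly_Mapping.keys ?A \<inter> Poly_Mapping.keys (f 0 * ?B) = {}"
    unfolding K using A(1) by (force simp: lookup_add)
  have U: "Poly_Mapping.keys (lsem f (x # xs)) = Poly_Mapping.keys ?A \<union> Poly_Mapping.keys (f 0 * ?B)"
    using keys_add_disjoint[OF disj] by simp
  have "card (Poly_Mapping.keys (f 0 * ?B)) = lcount xs"
    unfolding K using B(2) by (subst card_image) (auto simp: inj_on_def)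
  then have "card (Poly_Mapping.keys (lsem f (x # xs))) = lcount (x # xs)"
    unfolding U using disj A(2) by (subst card_Un_disjoint) auto
  moreover have "\<forall>m\<in>Poly_Mapping.keys (lsem f (x # xs)). \<forall>j<k. Poly_Mapping.lookup m j = 0"
    unfolding U K using A(1) B(1) by (auto simp: lookup_add lookup_single)
  ultimately show ?case by blast
qed auto

text \<open>The expansion of \<open>quad_U special\<close>, with the variables in the order fixed
  there; \<open>nsem_nest\<close> certifies it at arbitrary points.\<close>

definition nest_U :: npoly
  where "nest_U =
    NL [NL [NL [NL [NL [NL [NL [NL [], NL [], NL [], NC 1458], NL [NL [], NL [], NC 4374, NC (-
    2754)], NL [NL [], NC 4374, NC (- 5508), NC 324], NL [NC 1458, NC (- 2754), NC 324, NC 512]],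
    NL [NL [NL [], NL [], NC (- 8748)], NL [NL [], NC (- 17496), NC 11016], NL [NC (- 8748), NC
    11016, NC (- 648)]], NL [NL [NL [], NC 17496, NC 2754], NL [NC 17496, NC (- 5508), NC (- 648)],
    NL [NC 2754, NC (- 648), NC (- 1536)]], NL [NL [NC (- 11664), NC (- 11016)], NL [NC (- 11016),
    NC 1296]], NL [NL [NC 11016, NC 324], NL [NC 324, NC 1536]], NC (- 648), NC (- 512)], NL [NL
    [NL [NL [], NL [], NC (- 3240)], NL [NL [], NC 3240, NC 5670], NL [NC 6480, NC (- 7290), NC (-
    930)]], NL [NL [NL [], NC 3240], NL [NC (- 16200), NC (- 2430)], NL [NC (- 4050), NC 2790]], NL
    [NL [NC 6480, NC (- 1620)], NL [NC 19440, NC (- 930)]], NL [NC (- 9720), NC (- 2790)], NC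
    1860], NL [NL [NL [NC (- 4860), NC 2430], NL [NC 7290, NC (- 3360)], NL [NC 945, NC (- 570)]],
    NL [NC 4860, NC (- 9360)], NL [NC 570, NC 930]], NL [NL [NC (- 1000), NC 1500]]], NL [NL [NL
    [NL [NL [], NL [], NC 6480], NL [NL [], NC 3240, NC (- 7290)], NL [NC (- 3240), NC 5670, NC (-
    930)]], NL [NL [NL [], NC (- 16200), NC (- 4050)], NL [NC 3240, NC (- 2430), NC 2790]], NL [NL
    [NC 6480, NC 19440], NL [NC (- 1620), NC (- 930)]], NL [NL [NC (- 9720), NC (- 2790)]], NC
    1860], NL [NL [NL [NC 9720, NC (- 7290)], NL [NC (- 7290), NC 8040]], NL [NL [NC (- 14580), NC
    2790], NL [NC 2790, NC 210]], NC 8790, NC (- 930)], NL [NL [NC 1500, NC (- 750)], NC (-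
    1500)]], NL [NL [NL [NL [NC (- 4860), NC 7290, NC 945], NL [NC 2430, NC (- 3360), NC (- 570)]],
    NL [NL [NC 4860, NC (- 9360)]], NL [NL [NC 570, NC 930]]], NL [NL [NL [NC 1500, NC (- 750)]],
    NC (- 1500)], NC 375], NL [NL [NL [NL [NC (- 1000), NC 1500]]]]], NL [NL [NL [NL [NL [], NL [NL
    [], NC (- 3240)], NL [NC (- 3240), NC 5670], NL [NC 1350, NC (- 930)]], NL [NL [NL [], NC
    3240], NL [NC 9720, NC (- 5670)], NL [NC (- 4050), NC 930]], NL [NC (- 6480), NC (- 1620), NC
    930], NL [NC 4320, NC (- 930)]], NL [NL [NC 3240, NC (- 6480), NC 2490], NL [NC (- 3240), NC
    4980, NC (- 240)]]], NL [NL [NL [NL [NC (- 3240), NC (- 810)], NL [NC 2430, NC 870], NL [NC (-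
    2190), NC 690]], NL [NC 8100, NC (- 600)], NL [NC (- 5550), NC (- 450)]], NL [NL [NC 1500, NC
    (- 2250)]]], NL [NL [NL [NC (- 3000), NC 1500], NC 3000]], NC (- 500)], NL [NL [NL [NL [NC (-
    540), NC 1620, NC (- 1245), NC 40]]]]], NL [NL [NL [NL [NL [NL [NL [], NL [], NC (- 3240), NC
    1350], NL [NL [], NC (- 3240), NC 5670, NC (- 930)]], NL [NL [NL [], NC 9720, NC (- 4050)], NL
    [NC 3240, NC (- 5670), NC 930]], NL [NL [NC (- 6480), NC (- 1620), NC 930]], NL [NL [NC 4320,
    NC (- 930)]]], NL [NL [NL [NC (- 3240), NC 2430, NC (- 2190)], NL [NC (- 810), NC 870, NC
    690]], NL [NL [NC 8100, NC (- 600)]], NL [NL [NC (- 5550), NC (- 450)]]], NL [NL [NL [NC (-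
    3000), NC 1500]], NC 3000], NC (- 500)], NL [NL [NL [NL [NC 3240, NC (- 6480), NC 2490]], NL
    [NL [NC (- 3240), NC 4980, NC (- 240)]]], NL [NL [NL [NC 1500, NC (- 2250)]]]]], NL [NL [NL [NL
    [NL [NC 1080, NC 810], NL [NC 810, NC (- 3060)]], NL [NL [NC (- 4860), NC 2190], NL [NC 2190,
    NC (- 690)]], NC 1170, NC 610], NL [NL [NC 1500, NC (- 750)], NC (- 1500)]], NL [NL [NL [NL [NC
    1500, NC (- 750)]], NC (- 1500)], NC 750]], NL [NL [NL [NL [NC (- 500), NC 750]]]]], NL [NL [NL
    [NL [NL [NL [NC (- 540), NC 1620, NC (- 1245), NC 40]]]]], NL [NL [NL [NL [NL [NC (- 500), NC
    750]]]]], NC (- 125)]]"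

definition nest_V :: npoly
  where "nest_V =
    NL [NL [NL [NL [NL [NL [NL [NL [], NL [], NC 162], NL [NL [], NC 324, NC (- 324)], NL [NC 162,
    NC (- 324), NC 512]], NL [NL [NL [], NC (- 648)], NL [NC (- 648), NC 648]], NL [NL [NC 648, NC
    324], NL [NC 324, NC (- 1024)]], NC (- 648), NC 512], NL [NL [NL [], NL [NL [], NC (- 350)]],
    NL [NL [], NC 1050], NC (- 700)], NL [NL [NC 350, NC (- 350)]]], NL [NL [NL [NL [], NL [NL [],
    NC (- 350)]], NL [NL [NL [], NC 1050]], NC (- 700)], NL [NC (- 350), NC 350]], NL [NL [NL [NL
    [NC 350, NC (- 350)]]]]], NL [NL [NL [NL [NL [], NL [], NC (- 350)], NL [NL [], NC 350]]], NL
    [NL [NL [NC (- 350), NC 350]]]]], NL [NL [NL [NL [NL [NL [NL [], NL [], NC (- 350)]], NL [NL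
    [NL [], NC 350]]], NL [NL [NL [NC (- 350), NC 350]]]]], NL [NL [NL [NC 350, NC (- 350)]]]]]"

definition nest_S :: npoly
  where "nest_S =
    NL [NL [NL [NL [NL [NL [NL [], NL [], NL [NL [], NL [], NC 1]], NL [], NL [NL [], NL [NL [], NC
    (- 2)]], NL [], NC 1], NL [NL [NL [], NL [NL [], NC (- 1)]], NL [NL [], NC 3], NC (- 2)], NL
    [NL [NC 1, NC (- 1)]]], NL [NL [NL [NL [], NL [NL [], NC (- 1)]], NL [NL [NL [], NC 3]], NC (-
    2)], NL [NC (- 1), NC 1]], NL [NL [NL [NL [NC 1, NC (- 1)]]]]], NL [NL [NL [NL [NL [], NL [],
    NC (- 1)], NL [NL [], NC 1]]], NL [NL [NL [NC (- 1), NC 1]]]]], NL [NL [NL [NL [NL [NL [NL [],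
    NL [], NC (- 1)]], NL [NL [NL [], NC 1]]], NL [NL [NL [NC (- 1), NC 1]]]]], NL [NL [NL [NC 1,
    NC (- 1)]]]]]"

text \<open>On the normal form of quadrilaterals \<open>quad_U m = z * quad_V m\<close>, where z is
  a square root of \<open>inv_S m\<close>. As \<open>inv_T\<close> occurs linearly in
  \<open>quad_U\<close> and not in \<open>quad_V\<close>, the relation expresses t by h, g and
  z.\<close>

definition quad_U :: "(mvar \<Rightarrow> 'a::comm_ring_1) \<Rightarrow> 'a"
  where "quad_U m = 540 * m M00 * inv_G m - 125 * m M00^3 * inv_T m - 1458 * inv_H m^3
    - 1890 * m M00^2 * inv_H m * inv_S m"

definition quad_V :: "(mvar \<Rightarrow> 'a::comm_ring_1) \<Rightarrow> 'a"
  where "quad_V m = m M00 * (162 * inv_H m^2 + 350 * m M00^2 * inv_S m)"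

definition quad_poly :: moment_poly
  where "quad_poly = quad_equation (inv_S Var) (inv_T Var) (inv_H Var) (inv_G Var)"

lemma peval_quad_poly: "peval a quad_poly = quad_U a^2 - inv_S a * quad_V a^2"
  unfolding quad_poly_def quad_equation_def Let_def peval_add peval_diff peval_mult peval_power
    peval_numeral peval_Var peval_inv quad_U_def quad_V_def
  by algebra

lemma peval_quad_UV:
  fixes a :: "mvar \<Rightarrow> complex"
  shows "peval a (quad_U Var) = quad_U a" "peval a (quad_V Var) = quad_V a"
  by (simp_all add: quad_U_def quad_V_def peval_inv)

lemma quad_poly_eq: "quad_poly = quad_U Var^2 - inv_S Var * quad_V Var^2"
  by (rule peval_inject) (simp add: peval_quad_poly peval_quad_UV peval_inv)

text \<open>Setting \<open>m\<^sub>0\<^sub>0 = m\<^sub>1\<^sub>0 = m\<^sub>0\<^sub>1 = 1\<close> does not identify monomials of equal $\mathbb{Z}^3$-degree.\<close>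
definition special :: "mvar \<Rightarrow> (nat, complex) mpoly"
  where "special x = (case x of M00 \<Rightarrow> 1 | M10 \<Rightarrow> 1 | M01 \<Rightarrow> 1 | M30 \<Rightarrow> Var 0 | M03 \<Rightarrow> Var 1 | M21 \<Rightarrow> Var 2
    | M12 \<Rightarrow> Var 3 | M11 \<Rightarrow> Var 4 | M20 \<Rightarrow> Var 5 | M02 \<Rightarrow> Var 6)"

lemma special_simps:
  "special M00 = 1" "special M10 = 1" "special M01 = 1" "special M30 = Var 0" "special M03 = Var 1"
  "special M21 = Var 2" "special M12 = Var 3" "special M11 = Var 4" "special M20 = Var 5" "special M02 = Var 6"
  by (simp_all add: special_def)

lemma nsem_nest:
  "nsem Var nest_S = inv_S special" "nsem Var nest_U = quad_U special" "nsem Var nest_V = quad_V special"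
proof -
  have pe: "peval a (inv_S special) = inv_S (\<lambda>x. peval a (special x))"
    "peval a (quad_U special) = quad_U (\<lambda>x. peval a (special x))"
    "peval a (quad_V special) = quad_V (\<lambda>x. peval a (special x))" for a
    by (simp_all add: quad_U_def quad_V_def inv_S_def inv_T_def inv_G_defs)
  have sp: "peval a (special M00) = 1" "peval a (special M10) = 1" "peval a (special M01) = 1"
"peval a (special M30) = a (0)"
    "peval a (special M03) = a (Suc 0)"
    "peval a (special M21) = a (Suc (Suc 0))"
    "peval a (special M12) = a (Suc (Suc (Suc 0)))"
    "peval a (special M11) = a (Suc (Suc (Suc (Suc 0))))"
    "peval a (special M20) = a (Suc (Suc (Suc (Suc (Suc 0)))))"
    "peval a (special M02) = a (Suc (Suc (Suc (Suc (Suc (Suc 0))))))" for a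
    by (simp_all add: special_simps numeral_eq_Suc)
  have "peval a (nsem Var nest_S) = peval a (inv_S special)" for a
    unfolding pe peval_nsem peval_Var
    unfolding inv_S_def sp nest_S_def nsem.simps lsem.simps of_int_numeral of_int_minus of_int_1 power_one mult_1 mult_1_right
    by algebra
  moreover have "peval a (nsem Var nest_U) = peval a (quad_U special)" for a
    unfolding pe peval_nsem peval_Var
    unfolding quad_U_def inv_S_def inv_T_def inv_G_defs sp nest_U_def nsem.simps lsem.simps of_int_numeral of_int_minus of_int_1 power_one mult_1 mult_1_right
    by algebra
  moreover have "peval a (nsem Var nest_V) = peval a (quad_V special)" for a
    unfolding pe peval_nsem peval_Var
    unfolding quad_V_def inv_S_def inv_H_defs sp nest_V_def nsem.simps lsem.simps of_int_numeral of_int_minus of_int_1 power_one mult_1 mult_1_right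
    by algebra
  ultimately show "nsem Var nest_S = inv_S special" "nsem Var nest_U = quad_U special"
    "nsem Var nest_V = quad_V special"
    by (auto intro: peval_inject)
qed

lemma count_nest:
  "ncount (nadd (nmul nest_U nest_U) (nmul (NC (- 1)) (nmul nest_S (nmul nest_V nest_V)))) = 5100"
  by code_simp

lemma heval_special_quad_poly:
  "heval Const special quad_poly =
    nsem Var (nadd (nmul nest_U nest_U) (nmul (NC (- 1)) (nmul nest_S (nmul nest_V nest_V))))"
proof -
  interpret C: semiring_hom "Const :: complex \<Rightarrow> (nat, complex) mpoly" by (rule semiring_hom_Const)
  note simps = C.heval_add C.heval_mult C.heval_power heval_diff[OF semiring_hom_Const]
      heval_uminus[OF semiring_hom_Const] C.heval_Var C.heval_numeral
  show ?thesis
    unfolding nsem_nadd nsem_nmul nsem_nest quad_poly_eq quad_U_def quad_V_def simps heval_Const_inv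
    by (simp add: power2_eq_square)
qed

lemma whomogeneous_quad_poly:
  "whomogeneous (\<lambda>_. 1) 18 quad_poly" "whomogeneous (\<lambda>x. fst (expo x)) 12 quad_poly"
  "whomogeneous (\<lambda>x. snd (expo x)) 12 quad_poly"
proof -
  note w1 = whomogeneous_inv[of 1 0 0, simplified, THEN peval_weighted, unfolded peval_inv]
  note w2 = whomogeneous_inv[of 0 1 0, simplified, THEN peval_weighted, unfolded peval_inv]
  note w3 = whomogeneous_inv[of 0 0 1, simplified, THEN peval_weighted, unfolded peval_inv]
  show "whomogeneous (\<lambda>_. 1) 18 quad_poly"
    by (rule whomogeneousI_scaling, unfold peval_quad_poly quad_U_def quad_V_def)
      (simp add: w1[simplified], algebra)
  show "whomogeneous (\<lambda>x. fst (expo x)) 12 quad_poly"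
    by (rule whomogeneousI_scaling, unfold peval_quad_poly quad_U_def quad_V_def w2) (simp, algebra)
  show "whomogeneous (\<lambda>x. snd (expo x)) 12 quad_poly"
    by (rule whomogeneousI_scaling, unfold peval_quad_poly quad_U_def quad_V_def w3) (simp, algebra)
qed

lemma z3_degree_quad_poly: "m \<in> Poly_Mapping.keys quad_poly \<Longrightarrow> z3_degree m = (18, 12, 12)"
  using whomogeneous_quad_poly by (simp add: z3_degree_def whomogeneous_def)

lemma homogeneous_quad_poly: "homogeneous 18 quad_poly"
  using whomogeneous_quad_poly(1) by (simp add: homogeneous_iff_whomogeneous)

lemma card_keys_quad_poly: "card (Poly_Mapping.keys quad_poly) = 5100"
proof -
  \<comment> \<open>The substitution sends monomials to monomials, so the number of terms can only
    drop if two of them coincide.\<close>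
  have "\<exists>n. meval special m = Poly_Mapping.single n 1 \<and> Poly_Mapping.lookup n 0 = Poly_Mapping.lookup m M30
      \<and> Poly_Mapping.lookup n 1 = Poly_Mapping.lookup m M03 \<and> Poly_Mapping.lookup n 2 = Poly_Mapping.lookup m M21
      \<and> Poly_Mapping.lookup n 3 = Poly_Mapping.lookup m M12 \<and> Poly_Mapping.lookup n 4 = Poly_Mapping.lookup m M11
      \<and> Poly_Mapping.lookup n 5 = Poly_Mapping.lookup m M20 \<and> Poly_Mapping.lookup n 6 = Poly_Mapping.lookup m M02"
    (is "\<exists>n. ?P m n") for m
  proof (induction m rule: mpoly_induct_single)
    case (single x k)
    show ?case
    proof (cases x)
      case M00
      show ?thesis
        unfolding M00 by (rule exI[of _ "0"]) (simp add: special_simps Var_power lookup_single)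
    next
      case M10
      show ?thesis
        unfolding M10 by (rule exI[of _ "0"]) (simp add: special_simps Var_power lookup_single)
    next
      case M01
      show ?thesis
        unfolding M01 by (rule exI[of _ "0"]) (simp add: special_simps Var_power lookup_single)
    next
      case M20
      show ?thesis
        unfolding M20 by (rule exI[of _ "Poly_Mapping.single 5 k"]) (simp add: special_simps Var_power lookup_single)
    next
      case M11
      show ?thesis
        unfolding M11 by (rule exI[of _ "Poly_Mapping.single 4 k"]) (simp add: special_simps Var_power lookup_single)
    next
      case M02
      show ?thesis
        unfolding M02 by (rule exI[of _ "Poly_Mapping.single 6 k"]) (simp add: special_simps Var_power lookup_single)
    next
      case M30
      show ?thesis
        unfolding M30 by (rule exI[of _ "Poly_Mapping.single 0 k"]) (simp add: special_simps Var_power lookup_single)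
    next
      case M21
      show ?thesis
        unfolding M21 by (rule exI[of _ "Poly_Mapping.single 2 k"]) (simp add: special_simps Var_power lookup_single)
    next
      case M12
      show ?thesis
        unfolding M12 by (rule exI[of _ "Poly_Mapping.single 3 k"]) (simp add: special_simps Var_power lookup_single)
    next
      case M03
      show ?thesis
        unfolding M03 by (rule exI[of _ "Poly_Mapping.single 1 k"]) (simp add: special_simps Var_power lookup_single)
    qed
  next
    case (add m m')
    then obtain n n' where "?P m n" "?P m' n'" by blast
    then show ?case by (intro exI[of _ "n + n'"]) (simp add: meval_add mult_single lookup_add)
  qed
  then obtain \<tau> where \<tau>: "\<And>m. ?P m (\<tau> m)" by metis
  have inj: "inj_on \<tau> (Poly_Mapping.keys quad_poly)"
  proof
    fix m m' assume m: "m \<in> Poly_Mapping.keys quad_poly" "m' \<in> Poly_Mapping.keys quad_poly"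
      and eq: "\<tau> m = \<tau> m'"
    have seven: "Poly_Mapping.lookup m M30 = Poly_Mapping.lookup m' M30"
      "Poly_Mapping.lookup m M03 = Poly_Mapping.lookup m' M03"
      "Poly_Mapping.lookup m M21 = Poly_Mapping.lookup m' M21"
      "Poly_Mapping.lookup m M12 = Poly_Mapping.lookup m' M12"
      "Poly_Mapping.lookup m M11 = Poly_Mapping.lookup m' M11"
      "Poly_Mapping.lookup m M20 = Poly_Mapping.lookup m' M20"
      "Poly_Mapping.lookup m M02 = Poly_Mapping.lookup m' M02"
      using \<tau>[of m] \<tau>[of m'] eq by metis+
    have "z3_degree m = z3_degree m'" using m by (simp add: z3_degree_quad_poly)
    \<comment> \<open>The two weights recover the exponents of \<open>M10\<close> and
      \<open>M01\<close>, since \<open>M00\<close> has weight 0 in both; the total degree then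
      recovers that of \<open>M00\<close>.\<close>
    then have "Poly_Mapping.lookup m M10 = Poly_Mapping.lookup m' M10"
      "Poly_Mapping.lookup m M01 = Poly_Mapping.lookup m' M01"
      "Poly_Mapping.lookup m M00 = Poly_Mapping.lookup m' M00"
      using seven by (simp_all add: z3_degree_def wdeg_mvar)
    with seven show "m = m'"
      by (intro poly_mapping_eqI) (case_tac k; simp)
  qed
  have "heval Const special quad_poly =
      (\<Sum>m\<in>Poly_Mapping.keys quad_poly. Poly_Mapping.single (\<tau> m) (Poly_Mapping.lookup quad_poly m))"
    unfolding heval_def using \<tau> by (intro sum.cong) (simp_all add: Const_def mult_single)
  moreover have "Poly_Mapping.keys (\<Sum>m\<in>A. Poly_Mapping.single (\<tau> m) (Poly_Mapping.lookup quad_poly m)) = \<tau> ` A"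
    if "A \<subseteq> Poly_Mapping.keys quad_poly" "finite A" for A
    using that(2,1)
  proof (induction A rule: finite_induct)
    case (insert m A)
    have "\<tau> m \<notin> \<tau> ` A" using insert.hyps insert.prems inj by (auto simp: inj_on_def)
    moreover have "Poly_Mapping.lookup quad_poly m \<noteq> 0" using insert.prems by (simp add: in_keys_iff)
    ultimately show ?case
      using insert by (simp add: keys_add_disjoint)
  qed simp
  ultimately have "Poly_Mapping.keys (heval Const special quad_poly) = \<tau> ` Poly_Mapping.keys quad_poly"
    by simp
  then have "card (Poly_Mapping.keys (heval Const special quad_poly)) = card (Poly_Mapping.keys quad_poly)"
    by (simp add: card_image inj)
  moreover have "card (Poly_Mapping.keys (heval Const special quad_poly)) = 5100"
    unfolding heval_special_quad_poly using keys_nsem_Var(1)[of Var 0] count_nest by simp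
  ultimately show ?thesis by simp
qed

subsection \<open>Integrals over triangles\<close>

definition vec2 :: "'a \<Rightarrow> 'a \<Rightarrow> 'a^2"
  where "vec2 x y = (\<chi> i. if i = 1 then x else y)"

lemma vec2_simps [simp]: "vec2 x y $ 1 = x" "vec2 x y $ 2 = y"
  by (simp_all add: vec2_def)

lemma vec2_eta [simp]: "vec2 (w $ 1) (w $ 2) = w"
  by (simp add: vec_eq_iff forall_2)

lemma measurable_vec2 [measurable]: "(\<lambda>z. vec2 (fst z) (snd z)) \<in> borel_measurable (borel :: (real \<times> real) measure)"
proof (rule borel_measurable_continuous_onI)
  show "continuous_on UNIV (\<lambda>z :: real \<times> real. vec2 (fst z) (snd z))"
    unfolding vec2_def
    by (intro continuous_on_vec_lambda, case_tac "i = 1") (auto intro!: continuous_intros)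
qed

lemma lborel_vec2: "(lborel :: (real^2) measure) = distr (lborel :: (real \<times> real) measure) borel (\<lambda>z. vec2 (fst z) (snd z))"
proof (rule lborel_eqI)
  fix l u :: "real^2" assume le: "\<And>b. b \<in> Basis \<Longrightarrow> l \<bullet> b \<le> u \<bullet> b"
  have le': "l $ i \<le> u $ i" for i
    using le[of "axis i 1"] by (simp add: inner_axis axis_in_Basis_iff)
  have "(\<lambda>z. vec2 (fst z) (snd z)) -` box l u \<inter> space lborel = box (l $ 1, l $ 2) (u $ 1, u $ 2)"
    by (auto simp: mem_box_cart forall_2 mem_box Basis_prod_def)
  then have "emeasure (distr lborel borel (\<lambda>z. vec2 (fst z) (snd z))) (box l u) =
      emeasure lborel (box (l $ 1, l $ 2) (u $ 1, u $ 2))"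
    by (subst emeasure_distr) (auto simp: measurable_vec2)
  also have "\<dots> = ennreal (\<Prod>b\<in>Basis. ((u $ 1, u $ 2) - (l $ 1, l $ 2)) \<bullet> b)"
    using le' by (intro emeasure_lborel_box) (auto simp: Basis_prod_def)
  also have "(\<Prod>b\<in>Basis. ((u $ 1, u $ 2) - (l $ 1, l $ 2)) \<bullet> b) = (u $ 1 - l $ 1) * (u $ 2 - l $ 2)"
    by (simp add: Basis_prod_def prod.union_disjoint image_iff)
  also have "\<dots> = (\<Prod>b\<in>Basis. (u - l) \<bullet> b)"
  proof -
    have B: "(Basis :: (real^2) set) = {axis 1 1, axis 2 1}"
      by (auto simp: Basis_vec_def UNIV_2)
    have "axis 1 (1::real) \<noteq> (axis 2 1 :: real^2)"
      by (simp add: axis_eq_axis)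
    then show ?thesis by (simp add: B inner_axis)
  qed
  finally show "emeasure (distr lborel borel (\<lambda>z. vec2 (fst z) (snd z))) (box l u) = (\<Prod>b\<in>Basis. (u - l) \<bullet> b)" .
qed simp

definition std_triangle :: "(real^2) set"
  where "std_triangle = {w. 0 \<le> w $ 1 \<and> 0 \<le> w $ 2 \<and> w $ 1 + w $ 2 \<le> 1}"

lemma compact_std_triangle: "compact std_triangle"
proof (rule compact_eq_bounded_closed[THEN iffD2], intro conjI)
  have "norm w \<le> 2" if "w \<in> std_triangle" for w
  proof -
    have "norm w \<le> (\<Sum>i\<in>UNIV. \<bar>w $ i\<bar>)" by (rule norm_le_l1_cart)
    also have "\<dots> \<le> 2" using that by (auto simp: sum_2 std_triangle_def)
    finally show ?thesis .
  qed
  then show "bounded std_triangle" by (auto simp: bounded_iff)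
  show "closed std_triangle"
    unfolding std_triangle_def
    by (intro closed_Collect_conj closed_Collect_le continuous_intros)
qed

text \<open>The monomial x^i y^j integrates to i! j! / (i + j + 2)!; y is integrated first, over the
  interval from 0 to 1 - x.\<close>

lemma integral_std_triangle:
  fixes c :: "nat \<Rightarrow> nat \<Rightarrow> real"
  defines "P \<equiv> \<lambda>x y. c 0 0 + c 1 0 * x + c 2 0 * x^2 + c 3 0 * x^3 + (c 0 1 + c 1 1 * x + c 2 1 * x^2) * y
    + (c 0 2 + c 1 2 * x) * y^2 + c 0 3 * y^3"
  shows "(LINT w|lborel. indicator std_triangle w * P (w $ 1) (w $ 2)) =
    c 0 0 / 2 + (c 1 0 + c 0 1) / 6 + (c 2 0 + c 0 2) / 12 + c 1 1 / 24
    + (c 3 0 + c 0 3) / 20 + (c 2 1 + c 1 2) / 60"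
proof -
  let ?f = "\<lambda>z. indicator std_triangle (vec2 (fst z) (snd z)) * P (fst z) (snd z)"
  have std: "indicator std_triangle (vec2 x y) = (indicator {0..1} x * indicator {0..1 - x} y :: real)" for x y
    by (auto simp: std_triangle_def indicator_def)
  have meas: "(\<lambda>w :: real^2. indicator std_triangle w * P (w $ 1) (w $ 2)) \<in> borel_measurable borel"
    unfolding P_def
    by (intro borel_measurable_times borel_measurable_indicator borel_compact compact_std_triangle
        borel_measurable_continuous_onI continuous_intros)
  have "(LINT w|lborel. indicator std_triangle w * P (w $ 1) (w $ 2)) = (LINT z|lborel. ?f z)"
    by (subst lborel_vec2, subst integral_distr) (use meas in \<open>auto simp: measurable_vec2\<close>)
  also have "\<dots> = (LINT z|(lborel \<Otimes>\<^sub>M lborel). ?f z)" by (simp add: lborel_prod)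
  also have "\<dots> = (LINT x|lborel. (LINT y|lborel. ?f (x, y)))"
  proof (rule lborel_pair.integral_fst'[symmetric])
    let ?K = "{z :: real \<times> real. 0 \<le> fst z \<and> 0 \<le> snd z \<and> fst z + snd z \<le> 1}"
    have "?K \<subseteq> {0..1} \<times> {0..1}" by auto
    then have "bounded ?K" by (rule bounded_subset[rotated]) (intro bounded_Times bounded_closed_interval)
    moreover have "closed ?K"
      by (intro closed_Collect_conj closed_Collect_le continuous_intros)
    ultimately have "compact ?K" by (simp add: compact_eq_bounded_closed)
    then have "integrable lborel (\<lambda>z. indicator ?K z *\<^sub>R P (fst z) (snd z))"
      unfolding P_def by (intro borel_integrable_compact continuous_intros)
    moreover have "(\<lambda>z. indicator ?K z *\<^sub>R P (fst z) (snd z)) = ?f"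
      by (auto simp: std_triangle_def indicator_def)
    ultimately show "integrable (lborel \<Otimes>\<^sub>M lborel) ?f" by (simp only: lborel_prod)
  qed
  also have "\<dots> = (LINT x|lborel. (
      (c 0 0 + c 0 1 / 2 + c 0 2 / 3 + c 0 3 / 4)
      + (c 1 0 - c 0 0 + c 1 1 / 2 - c 0 1 + c 1 2 / 3 - c 0 2 - c 0 3) * x
      + (c 2 0 - c 1 0 + c 2 1 / 2 - c 1 1 + c 0 1 / 2 - c 1 2 + c 0 2 + 3 / 2 * c 0 3) * x^2
      + (c 3 0 - c 2 0 - c 2 1 + c 1 1 / 2 + c 1 2 - c 0 2 / 3 - c 0 3) * x^3
      + (c 2 1 / 2 - c 3 0 - c 1 2 / 3 + c 0 3 / 4) * x^4) * indicator {0..1} x)"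
  proof (rule Bochner_Integration.integral_cong[OF refl])
    fix x :: real
    show "(LINT y|lborel. ?f (x, y)) = (
      (c 0 0 + c 0 1 / 2 + c 0 2 / 3 + c 0 3 / 4)
      + (c 1 0 - c 0 0 + c 1 1 / 2 - c 0 1 + c 1 2 / 3 - c 0 2 - c 0 3) * x
      + (c 2 0 - c 1 0 + c 2 1 / 2 - c 1 1 + c 0 1 / 2 - c 1 2 + c 0 2 + 3 / 2 * c 0 3) * x^2
      + (c 3 0 - c 2 0 - c 2 1 + c 1 1 / 2 + c 1 2 - c 0 2 / 3 - c 0 3) * x^3
      + (c 2 1 / 2 - c 3 0 - c 1 2 / 3 + c 0 3 / 4) * x^4) * indicator {0..1} x"
    proof (cases "x \<in> {0..1}")
      case True
      let ?F = "\<lambda>y. (c 0 0 + c 1 0 * x + c 2 0 * x^2 + c 3 0 * x^3) * y + (c 0 1 + c 1 1 * x + c 2 1 * x^2) * y^2 / 2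
        + (c 0 2 + c 1 2 * x) * y^3 / 3 + c 0 3 * y^4 / 4"
      have "(LINT y|lborel. ?f (x, y)) = (LINT y|lborel. P x y * indicator {0..1 - x} y)"
        using True by (simp add: std mult.commute)
      also have "\<dots> = ?F (1 - x) - ?F 0"
      proof (rule integral_FTC_Icc_real)
        show "DERIV ?F y :> P x y" for y
          unfolding P_def by (auto intro!: derivative_eq_intros)
        show "isCont (P x) y" for y
          unfolding P_def by (intro continuous_intros)
      qed (use True in auto)
      also have "\<dots> = (c 0 0 + c 0 1 / 2 + c 0 2 / 3 + c 0 3 / 4)
        + (c 1 0 - c 0 0 + c 1 1 / 2 - c 0 1 + c 1 2 / 3 - c 0 2 - c 0 3) * x
        + (c 2 0 - c 1 0 + c 2 1 / 2 - c 1 1 + c 0 1 / 2 - c 1 2 + c 0 2 + 3 / 2 * c 0 3) * x^2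
        + (c 3 0 - c 2 0 - c 2 1 + c 1 1 / 2 + c 1 2 - c 0 2 / 3 - c 0 3) * x^3
        + (c 2 1 / 2 - c 3 0 - c 1 2 / 3 + c 0 3 / 4) * x^4"
        by (simp add: field_simps power2_eq_square power3_eq_cube power4_eq_xxxx)
      finally show ?thesis using True by simp
    qed (simp add: std)
  qed
  also have "\<dots> = c 0 0 / 2 + (c 1 0 + c 0 1) / 6 + (c 2 0 + c 0 2) / 12 + c 1 1 / 24
    + (c 3 0 + c 0 3) / 20 + (c 2 1 + c 1 2) / 60"
  proof -
    have *: "(LINT x|lborel. (a + b * x + d * x^2 + e * x^3 + f * x^4) * indicator {0..1} x) =
        a + b / 2 + d / 3 + e / 4 + f / 5" for a b d e f :: real
    proof -
      let ?F = "\<lambda>x. a * x + b * x^2 / 2 + d * x^3 / 3 + e * x^4 / 4 + f * x^5 / 5"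
      have "(LINT x|lborel. (a + b * x + d * x^2 + e * x^3 + f * x^4) * indicator {0..1} x) = ?F 1 - ?F 0"
        by (rule integral_FTC_Icc_real)
          (auto intro!: derivative_eq_intros continuous_intros simp: algebra_simps)
      then show ?thesis by simp
    qed
    show ?thesis unfolding * by (simp add: field_simps)
  qed
  finally show ?thesis .
qed

section \<open>Quadrature of cubic polynomials on arbitrary triangles\<close>

definition orient :: "'a::comm_ring_1^2 \<Rightarrow> 'a^2 \<Rightarrow> 'a^2 \<Rightarrow> 'a"
  where "orient p q r = (q$1 - p$1) * (r$2 - p$2) - (q$2 - p$2) * (r$1 - p$1)"

text \<open>A quadrature rule on the triangle that is exact for polynomials of degree at most three:
  weights $1/20$ at the vertices, $2/15$ at the midpoints of the sides, $9/20$ at the centroid.\<close>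
definition cubature :: "('a::field^2 \<Rightarrow> 'a) \<Rightarrow> 'a^2 \<Rightarrow> 'a^2 \<Rightarrow> 'a^2 \<Rightarrow> 'a"
  where "cubature f p q r = (f p + f q + f r) / 20
    + 2 / 15 * (f ((1 / 2) *s (p + q)) + f ((1 / 2) *s (q + r)) + f ((1 / 2) *s (p + r)))
    + 9 / 20 * f ((1 / 3) *s (p + q + r))"

text \<open>Products of three affine forms include all monomials of degree at most three and, unlike
  monomials, are stable under affine substitution; this lets the formula pass from the standard
  triangle to all others.\<close>

definition affine_form :: "'a::comm_ring_1^3 \<Rightarrow> 'a^2 \<Rightarrow> 'a"
  where "affine_form l w = l $ 1 * w $ 1 + l $ 2 * w $ 2 + l $ 3"

lemma std_triangle_image:
  "(\<lambda>w. p + w $ 1 *\<^sub>R (q - p) + w $ 2 *\<^sub>R (r - p)) ` std_triangle = convex hull {p, q, r}"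
  unfolding convex_hull_3_alt std_triangle_def
  by (auto simp: image_iff) (metis vec2_simps)+

lemma integral_std_triangle_forms:
  fixes a b c :: "real^3"
  shows "(LINT w|lborel. indicator std_triangle w * (affine_form a w * affine_form b w * affine_form c w)) =
    cubature (\<lambda>w. affine_form a w * affine_form b w * affine_form c w) 0 (vec2 1 0) (vec2 0 1) / 2"
proof -
  define C :: "nat \<Rightarrow> nat \<Rightarrow> real" where "C = (\<lambda>i j.
    if (i, j) = (0, 0) then a$3 * b$3 * c$3
    else if (i, j) = (1, 0) then a$1 * b$3 * c$3 + a$3 * b$1 * c$3 + a$3 * b$3 * c$1
    else if (i, j) = (0, 1) then a$2 * b$3 * c$3 + a$3 * b$2 * c$3 + a$3 * b$3 * c$2
    else if (i, j) = (2, 0) then a$1 * b$1 * c$3 + a$1 * b$3 * c$1 + a$3 * b$1 * c$1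
    else if (i, j) = (0, 2) then a$2 * b$2 * c$3 + a$2 * b$3 * c$2 + a$3 * b$2 * c$2
    else if (i, j) = (1, 1) then a$1 * b$2 * c$3 + a$1 * b$3 * c$2 + a$2 * b$1 * c$3 + a$2 * b$3 * c$1
      + a$3 * b$1 * c$2 + a$3 * b$2 * c$1
    else if (i, j) = (3, 0) then a$1 * b$1 * c$1
    else if (i, j) = (0, 3) then a$2 * b$2 * c$2
    else if (i, j) = (2, 1) then a$1 * b$1 * c$2 + a$1 * b$2 * c$1 + a$2 * b$1 * c$1
    else a$1 * b$2 * c$2 + a$2 * b$1 * c$2 + a$2 * b$2 * c$1)"
  have "affine_form a w * affine_form b w * affine_form c w =
      C 0 0 + C 1 0 * w$1 + C 2 0 * (w$1)^2 + C 3 0 * (w$1)^3 + (C 0 1 + C 1 1 * w$1 + C 2 1 * (w$1)^2) * w$2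
    + (C 0 2 + C 1 2 * w$1) * (w$2)^2 + C 0 3 * (w$2)^3" for w
    unfolding C_def affine_form_def by simp algebra
  then show ?thesis
    by (simp only: integral_std_triangle)
      (simp add: C_def cubature_def affine_form_def field_simps)
qed

lemma compact_absolutely_integrable:
  fixes f :: "real^2 \<Rightarrow> real"
  assumes "compact S" "continuous_on S f"
  shows "f absolutely_integrable_on S" "(LINT w|lborel. indicator S w * f w) = integral S f"
proof -
  have *: "set_integrable lborel S f"
    using borel_integrable_compact[OF assms] by (simp add: set_integrable_def)
  then have "(\<lambda>x. indicator S x *\<^sub>R f x) \<in> borel_measurable lborel"
    by (auto simp: set_integrable_def)
  with * show "f absolutely_integrable_on S"
    by (simp add: set_integrable_def integrable_completion)
  show "(LINT w|lborel. indicator S w * f w) = integral S f"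
    using set_borel_integral_eq_integral(2)[OF *] by (simp add: set_lebesgue_integral_def)
qed

lemma continuous_on_affine_form [continuous_intros]:
  "continuous_on S (affine_form (a :: real^3))"
  unfolding affine_form_def by (intro continuous_intros)

text \<open>Change of variables from the standard triangle: an affine map carries the vertices,
  midpoints and centroid of the quadrature rule along, and its Jacobian is twice the signed
  area.\<close>

lemma has_integral_triangle:
  fixes a b c :: "real^3"
  assumes D: "orient p q r \<noteq> 0"
  defines "f \<equiv> \<lambda>w. affine_form a w * affine_form b w * affine_form c w"
  shows "(f has_integral \<bar>orient p q r\<bar> / 2 * cubature f p q r) (convex hull {p, q, r})"
proof -
  define g where "g w = p + w $ 1 *\<^sub>R (q - p) + w $ 2 *\<^sub>R (r - p)" for w :: "real^2"
  define g' where "g' w = w $ 1 *\<^sub>R (q - p) + w $ 2 *\<^sub>R (r - p)" for w :: "real^2"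
  \<comment> \<open>The inverse of \<open>g\<close> by Cramer's rule: barycentric coordinates as
    quotients of signed areas.\<close>
  define h where "h v = vec2 (orient p v r / orient p q r) (orient p q v / orient p q r)" for v
  have img: "g ` std_triangle = convex hull {p, q, r}"
    unfolding g_def by (rule std_triangle_image)
  have "linear g'"
    unfolding g'_def by (intro linearI) (simp_all add: algebra_simps)
  have der: "(g has_derivative g') (at w within std_triangle)" for w
  proof -
    have "(g' has_derivative g') (at w within std_triangle)"
      using \<open>linear g'\<close> by (rule linear_imp_has_derivative)
    then have "((\<lambda>w. p + g' w) has_derivative g') (at w within std_triangle)"
      by (auto intro!: derivative_eq_intros)
    then show ?thesis by (simp add: g_def[abs_def] g'_def[abs_def] add.assoc)
  qed
  have hg: "h (g w) = w" for w
  proof -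
    have "orient p (g w) r = w $ 1 * orient p q r" "orient p q (g w) = w $ 2 * orient p q r"
      by (simp_all add: g_def orient_def algebra_simps)
    then show ?thesis using D by (simp add: h_def)
  qed
  have conth: "continuous_on (g ` std_triangle) h"
    unfolding h_def vec2_def orient_def divide_inverse
    by (intro continuous_on_vec_lambda, case_tac "i = 1") (simp_all, (intro continuous_intros)+)
  have det: "det (matrix (g' )) = orient p q r"
    by (simp add: det_2 matrix_def g'_def axis_def orient_def algebra_simps)
  have comp: "affine_form l (g w) = affine_form (vector [affine_form l q - affine_form l p,
      affine_form l r - affine_form l p, affine_form l p]) w" for l w
    by (simp add: affine_form_def g_def algebra_simps)
  have "g 0 = p" "g (vec2 1 0) = q" "g (vec2 0 1) = r" "g ((1 / 2) *s (0 + vec2 1 0)) = (1 / 2) *s (p + q)"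
    "g ((1 / 2) *s (vec2 1 0 + vec2 0 1)) = (1 / 2) *s (q + r)" "g ((1 / 2) *s (0 + vec2 0 1)) = (1 / 2) *s (p + r)"
    "g ((1 / 3) *s (0 + vec2 1 0 + vec2 0 1)) = (1 / 3) *s (p + q + r)"
    by (simp_all add: g_def vec_eq_iff field_simps)
  then have "cubature (\<lambda>w. f (g w)) 0 (vec2 1 0) (vec2 0 1) = cubature f p q r"
    by (simp only: cubature_def)
  then have fg: "(LINT w|lborel. indicator std_triangle w * f (g w)) = cubature f p q r / 2"
    unfolding f_def comp integral_std_triangle_forms by simp
  have cont: "continuous_on std_triangle (\<lambda>w. f (g w))"
    unfolding f_def comp by (intro continuous_intros)
  note I = compact_absolutely_integrable[OF compact_std_triangle cont]
  \<comment> \<open>The change of variables formula concerns vector-valued functions, hence the lift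
    to \<open>real^1\<close>.\<close>
  let ?F = "\<lambda>w. vec (f w) :: real^1"
  let ?b = "\<bar>orient p q r\<bar> / 2 * cubature f p q r"
  have "(\<lambda>x. \<bar>det (matrix g')\<bar> *\<^sub>R ?F (g x)) absolutely_integrable_on std_triangle \<and>
      integral std_triangle (\<lambda>x. \<bar>det (matrix g')\<bar> *\<^sub>R ?F (g x)) = vec ?b \<longleftrightarrow>
      ?F absolutely_integrable_on (g ` std_triangle) \<and> integral (g ` std_triangle) ?F = vec ?b"
    by (rule has_absolute_integral_change_of_variables_invertible[where h = h])
      (use der hg conth in auto)
  moreover have "(\<lambda>x. \<bar>det (matrix g')\<bar> *\<^sub>R ?F (g x)) = (\<lambda>x. vec (\<bar>orient p q r\<bar> * f (g x)))"
    by (simp add: det vec_eq_iff fun_eq_iff)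
  moreover have "(\<lambda>x. \<bar>orient p q r\<bar> * f (g x)) absolutely_integrable_on std_triangle"
    using I(1) by (intro set_integrable_mult_right)
  moreover have "integral std_triangle (\<lambda>x. \<bar>orient p q r\<bar> * f (g x)) = ?b"
    using I(2) fg by simp
  ultimately have "f absolutely_integrable_on (g ` std_triangle)" "integral (g ` std_triangle) f = ?b"
    by (simp_all add: absolutely_integrable_on_1_iff integral_on_1_eq)
  then show ?thesis
    unfolding img by (metis has_integral_integrable_integral set_lebesgue_integral_eq_integral(1))
qed

subsection \<open>Convex quadrilaterals\<close>

lemma orient_cyc: "orient p q r = orient q r p"
  by (simp add: orient_def algebra_simps)

text \<open>On the line through \<open>p\<close> and \<open>q\<close>, a point of \<open>S\<close>
  beyond one of them would put that extreme point strictly between two points of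
  \<open>S\<close>.\<close>

lemma extreme_points_collinear:
  fixes p q x :: "real^2"
  assumes p: "p extreme_point_of S" and q: "q extreme_point_of S" and "p \<noteq> q" "x \<in> S" and c: "orient p q x = 0"
  shows "x \<in> closed_segment p q"
proof -
  have pS: "p \<in> S" "q \<in> S" using p q by (auto simp: extreme_point_of_def)
  \<comment> \<open>The parameter of \<open>x\<close> on the line, computed in a coordinate in which
    \<open>p\<close> and \<open>q\<close> differ.\<close>
  define t where "t = (if q $ 1 \<noteq> p $ 1 then (x $ 1 - p $ 1) / (q $ 1 - p $ 1) else (x $ 2 - p $ 2) / (q $ 2 - p $ 2))"
  have "q $ 1 \<noteq> p $ 1 \<or> q $ 2 \<noteq> p $ 2" using \<open>p \<noteq> q\<close> by (auto simp: vec_eq_iff forall_2)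
  then have x: "x = (1 - t) *\<^sub>R p + t *\<^sub>R q"
    using c by (auto simp: t_def vec_eq_iff forall_2 orient_def field_simps)
  have "t \<ge> 0"
  proof (rule ccontr)
    assume "\<not> t \<ge> 0"
    then have t: "t < 0" by simp
    define u where "u = 1 / (1 - t)"
    have "u * (1 - t) = 1" using t by (simp add: u_def)
    then have "p $ i = (1 - u) * q $ i + u * ((1 - t) * p $ i + t * q $ i)" for i by algebra
    then have "p = (1 - u) *\<^sub>R q + u *\<^sub>R x" by (simp add: x vec_eq_iff)
    moreover have "q \<noteq> x"
    proof
      assume "q = x"
      then have "(1 - t) *\<^sub>R (q - p) = 0" unfolding x by (simp add: algebra_simps)
      then show False using t \<open>p \<noteq> q\<close> by simp
    qed
    ultimately have "p \<in> open_segment q x"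
      using t by (auto simp: in_segment u_def intro!: exI[of _ u])
    then show False using p pS \<open>x \<in> S\<close> by (auto simp: extreme_point_of_def)
  qed
  moreover have "t \<le> 1"
  proof (rule ccontr)
    assume "\<not> t \<le> 1"
    then have t: "t > 1" by simp
    have "q = (1 - 1 / t) *\<^sub>R p + (1 / t) *\<^sub>R x"
      using t by (simp add: x vec_eq_iff forall_2 field_simps)
    moreover have "p \<noteq> x"
    proof
      assume "p = x"
      then have "t *\<^sub>R (q - p) = 0" unfolding x by (auto simp: algebra_simps)
      then show False using t \<open>p \<noteq> q\<close> by simp
    qed
    ultimately have "q \<in> open_segment p x"
      using t by (auto simp: in_segment intro!: exI[of _ "1 / t"])
    then show False using q pS \<open>x \<in> S\<close> by (auto simp: extreme_point_of_def)
  qed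
  ultimately show ?thesis using x by (auto simp: in_segment)
qed

lemma orient_segment: "w \<in> closed_segment p q \<Longrightarrow> orient p q (w :: real^2) = 0"
  by (auto simp only: in_segment orient_def vector_add_component vector_scaleR_component real_scaleR_def)
    (simp add: algebra_simps)

text \<open>If \<open>r\<close> and \<open>s\<close> were on opposite sides, the segment between
  them would meet the line through \<open>p\<close> and \<open>q\<close> in a point of
  \<open>S\<close>, hence of the edge; the face property would then put \<open>r\<close> on the
  edge.\<close>

lemma edge_same_side:
  fixes p q r s :: "real^2"
  assumes S: "convex S" and ext: "p extreme_point_of S" "q extreme_point_of S" "r extreme_point_of S" "s extreme_point_of S"
    and neq: "p \<noteq> q" "r \<noteq> p" "r \<noteq> q" "s \<noteq> p" "s \<noteq> q"
    and face: "closed_segment p q face_of S"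
  shows "orient p q r * orient p q s > 0"
proof (rule ccontr)
  have in_S: "p \<in> S" "q \<in> S" "r \<in> S" "s \<in> S"
    using ext by (auto simp: extreme_point_of_def)
  have nz: "orient p q x \<noteq> 0" if x: "x extreme_point_of S" "x \<noteq> p" "x \<noteq> q" for x
  proof
    assume "orient p q x = 0"
    moreover have "x \<in> S" using x by (simp add: extreme_point_of_def)
    ultimately have "x \<in> closed_segment p q"
      using extreme_points_collinear ext(1,2) neq(1) by blast
    with x(2,3) have "x \<in> open_segment p q" by (simp add: open_segment_def)
    with x(1) in_S show False by (auto simp: extreme_point_of_def)
  qed
  assume "\<not> orient p q r * orient p q s > 0"
  then have neg: "orient p q r * orient p q s < 0"
    using nz[of r] nz[of s] ext neq by (simp add: not_less less_le)
  define d where "d = orient p q r - orient p q s"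
  have "d \<noteq> 0" using neg by (auto simp: d_def mult_less_0_iff)
  define u where "u = orient p q r / d"
  have u: "0 < u" "u < 1"
    using neg \<open>d \<noteq> 0\<close> by (auto simp: u_def d_def mult_less_0_iff divide_simps)
  define x where "x = (1 - u) *\<^sub>R r + u *\<^sub>R s"
  have "r \<noteq> s" using neg by (auto simp: mult_less_0_iff)
  then have x: "x \<in> open_segment r s" using u by (auto simp: x_def in_segment)
  have "x \<in> S" unfolding x_def using S in_S u by (intro convexD_alt) auto
  have "orient p q x = (1 - u) * orient p q r + u * orient p q s"
    unfolding x_def orient_def by (simp add: algebra_simps)
  also have "\<dots> = 0" using \<open>d \<noteq> 0\<close> by (simp add: u_def d_def field_simps)
  finally have "x \<in> closed_segment p q"
    using extreme_points_collinear ext(1,2) neq(1) \<open>x \<in> S\<close> by blast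
  then have "r \<in> closed_segment p q"
    using face x in_S unfolding face_of_def by blast
  then have "orient p q r = 0" by (rule orient_segment)
  then show False using neg by simp
qed

lemma range_4: "range (\<lambda>k::4. f k) = {f 1, f 2, f 3, f 4}"
  by (auto simp: UNIV_4)

text \<open>The vertices are in convex position and in cyclic order, with orientation \<open>\<epsilon>\<close>.\<close>
definition positively_oriented :: "real \<Rightarrow> real^2^4 \<Rightarrow> bool"
  where "positively_oriented \<epsilon> X \<longleftrightarrow> \<epsilon> * orient (X$1) (X$2) (X$3) > 0 \<and> \<epsilon> * orient (X$2) (X$3) (X$4) > 0 \<and>
    \<epsilon> * orient (X$3) (X$4) (X$1) > 0 \<and> \<epsilon> * orient (X$4) (X$1) (X$2) > 0"

lemma quadrilateral_oriented:
  assumes "quadrilateral X"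
  obtains \<epsilon> where "\<epsilon> = 1 \<or> \<epsilon> = -1" "positively_oriented \<epsilon> X"
proof -
  let ?P = "polygon X"
  have inj: "X $ i \<noteq> X $ j" if "i \<noteq> j" for i j
    using assms that by (auto simp: quadrilateral_def inj_def)
  have ext: "X $ k extreme_point_of ?P" for k
    using assms by (simp add: quadrilateral_def)
  have face: "closed_segment (X $ k) (X $ (k + 1)) face_of ?P" for k
    using assms by (simp add: quadrilateral_def edge_of_def)
  have P: "convex ?P" by (simp add: polygon_def)
  have e: "orient (X$k) (X$(k+1)) (X$i) * orient (X$k) (X$(k+1)) (X$j) > 0"
    if "k \<noteq> k + 1" "i \<noteq> k" "i \<noteq> k + 1" "j \<noteq> k" "j \<noteq> k + 1" for k i j
    by (rule edge_same_side[OF P]) (use that inj ext face in auto)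
  define a b c d where "a = orient (X$1) (X$2) (X$3)" and "b = orient (X$2) (X$3) (X$4)"
    and "c = orient (X$3) (X$4) (X$1)" and "d = orient (X$4) (X$1) (X$2)"
  have "a * d > 0" using e[of 1 3 4] by (simp add: a_def d_def orient_cyc[of "X$4"])
  moreover have "b * a > 0" using e[of 2 4 1] by (simp add: a_def b_def orient_cyc[of "X$1"])
  moreover have "c * b > 0" using e[of 3 1 2] by (simp add: b_def c_def orient_cyc[of "X$2"])
  ultimately have "(a > 0 \<and> b > 0 \<and> c > 0 \<and> d > 0) \<or> (a < 0 \<and> b < 0 \<and> c < 0 \<and> d < 0)"
    by (auto simp: zero_less_mult_iff)
  then show thesis
  proof
    assume "a > 0 \<and> b > 0 \<and> c > 0 \<and> d > 0"
    then show thesis by (intro that[of 1]) (simp_all add: positively_oriented_def a_def b_def c_def d_def)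
  next
    assume "a < 0 \<and> b < 0 \<and> c < 0 \<and> d < 0"
    then show thesis by (intro that[of "-1"]) (simp_all add: positively_oriented_def a_def b_def c_def d_def)
  qed
qed

lemma in_hull_4:
  fixes p q r s :: "real^2"
  assumes "distinct [p, q, r, s]" "w \<in> convex hull {p, q, r, s}"
  obtains a b c d where "0 \<le> a" "0 \<le> b" "0 \<le> c" "0 \<le> d" "a = 1 - b - c - d"
    "w = a *\<^sub>R p + b *\<^sub>R q + c *\<^sub>R r + d *\<^sub>R s"
proof -
  from assms(2) obtain u where u: "\<forall>x\<in>{p, q, r, s}. 0 \<le> u x" "sum u {p, q, r, s} = 1"
    "(\<Sum>x\<in>{p, q, r, s}. u x *\<^sub>R x) = w"
    by (auto simp: convex_hull_finite)
  show thesis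
    by (rule that[of "u p" "u q" "u r" "u s"]) (use u assms(1) in auto)
qed

lemma orient_combination:
  fixes p q x1 x2 x3 x4 :: "real^2"
  assumes "a = 1 - b - c - d"
  shows "orient p q (a *\<^sub>R x1 + b *\<^sub>R x2 + c *\<^sub>R x3 + d *\<^sub>R x4) =
    a * orient p q x1 + b * orient p q x2 + c * orient p q x3 + d * orient p q x4"
  unfolding orient_def assms by (simp add: algebra_simps)

lemma orient_same [simp]: "orient p q p = 0" "orient p q q = 0" "orient p p q = 0"
  by (simp_all add: orient_def algebra_simps)

text \<open>The barycentric coordinates of \<open>w\<close> are the signed areas of the three
  subtriangles divided by the total area, and the hypotheses make them nonnegative.\<close>

lemma in_triangleI:
  fixes p q r w :: "real^2"
  assumes "\<epsilon> * orient p q r > 0" "\<epsilon> * orient p q w \<ge> 0" "\<epsilon> * orient q r w \<ge> 0" "\<epsilon> * orient r p w \<ge> 0"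
  shows "w \<in> convex hull {p, q, r}"
proof -
  define D where "D = orient p q r"
  have D: "D \<noteq> 0" using assms(1) by (auto simp: D_def)
  define u v t where "u = orient q r w / D" and "v = orient r p w / D" and "t = orient p q w / D"
  have nn: "0 \<le> x / D" if "\<epsilon> * x \<ge> 0" for x
    using that assms(1) by (auto simp: D_def[symmetric] zero_less_mult_iff zero_le_mult_iff zero_le_divide_iff)
  have "u \<ge> 0" "v \<ge> 0" "t \<ge> 0"
    unfolding u_def v_def t_def using assms nn by auto
  moreover have "u + v + t = 1"
    using D unfolding u_def v_def t_def add_divide_distrib[symmetric]
    by (simp add: D_def orient_def field_simps)
  moreover have "w = u *\<^sub>R p + v *\<^sub>R q + t *\<^sub>R r"
  proof -
    have "D * w $ i = orient q r w * p $ i + orient r p w * q $ i + orient p q w * r $ i" for i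
    proof -
      have "\<forall>i. D * w $ i = orient q r w * p $ i + orient r p w * q $ i + orient p q w * r $ i"
        unfolding forall_2 D_def orient_def by (intro conjI; algebra)
      then show ?thesis ..
    qed
    then have "w $ i = (orient q r w * p $ i + orient r p w * q $ i + orient p q w * r $ i) / D" for i
      using D by (metis nonzero_mult_div_cancel_left)
    then show ?thesis by (simp add: vec_eq_iff u_def v_def t_def add_divide_distrib)
  qed
  ultimately show ?thesis unfolding convex_hull_3 by blast
qed

lemma distinct_oriented: "positively_oriented \<epsilon> X \<Longrightarrow> distinct [X$1, X$2, X$3, X$4]"
  unfolding positively_oriented_def by (auto simp: orient_def)

text \<open>Cut along the diagonal from \<open>X$1\<close> to \<open>X$3\<close>: the side of
  \<open>w\<close> decides in which triangle it lies, and the triangles overlap only inside the line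
  of the diagonal, a null set.\<close>

lemma polygon_split:
  assumes X: "positively_oriented \<epsilon> X"
  shows "polygon X = convex hull {X$1, X$2, X$3} \<union> convex hull {X$1, X$3, X$4}"
    and "negligible (convex hull {X$1, X$2, X$3} \<inter> convex hull {X$1, X$3, X$4})"
proof -
  let ?p = "X$1" and ?q = "X$2" and ?r = "X$3" and ?s = "X$4"
  have o: "\<epsilon> * orient ?p ?q ?r > 0" "\<epsilon> * orient ?q ?r ?s > 0" "\<epsilon> * orient ?r ?s ?p > 0" "\<epsilon> * orient ?s ?p ?q > 0"
    using X by (auto simp: positively_oriented_def)
  have o2: "\<epsilon> * orient ?q ?r ?p > 0" "\<epsilon> * orient ?p ?q ?s > 0" "\<epsilon> * orient ?r ?s ?q > 0"
    "\<epsilon> * orient ?s ?p ?r > 0" "\<epsilon> * orient ?p ?r ?s > 0" "\<epsilon> * orient ?r ?p ?q > 0"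
    using o by (simp_all add: orient_def algebra_simps)
  have sub: "polygon X \<subseteq> convex hull {?p, ?q, ?r} \<union> convex hull {?p, ?r, ?s}"
  proof
    fix w assume "w \<in> polygon X"
    then have "w \<in> convex hull {?p, ?q, ?r, ?s}" by (simp add: polygon_def range_4)
    with distinct_oriented[OF X] obtain a b c d where nn: "0 \<le> a" "0 \<le> b" "0 \<le> c" "0 \<le> d" and a: "a = 1 - b - c - d"
      and w: "w = a *\<^sub>R ?p + b *\<^sub>R ?q + c *\<^sub>R ?r + d *\<^sub>R ?s"
      by (rule in_hull_4)
    have oc: "\<epsilon> * orient x y w = a * (\<epsilon> * orient x y ?p) + b * (\<epsilon> * orient x y ?q)
        + c * (\<epsilon> * orient x y ?r) + d * (\<epsilon> * orient x y ?s)" for x y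
      unfolding w orient_combination[OF a] by (simp add: algebra_simps)
    have side: "\<epsilon> * orient ?p ?q w \<ge> 0" "\<epsilon> * orient ?q ?r w \<ge> 0" "\<epsilon> * orient ?r ?s w \<ge> 0" "\<epsilon> * orient ?s ?p w \<ge> 0"
      unfolding oc using nn o o2 by (auto intro!: add_nonneg_nonneg mult_nonneg_nonneg less_imp_le)
    have flip: "orient ?r ?p w = - orient ?p ?r w"
      by (simp add: orient_def algebra_simps)
    show "w \<in> convex hull {?p, ?q, ?r} \<union> convex hull {?p, ?r, ?s}"
    proof (cases "\<epsilon> * orient ?p ?r w \<ge> 0")
      case True
      then show ?thesis using side o2(5) by (intro UnI2 in_triangleI[of \<epsilon>]) auto
    next
      case False
      then show ?thesis using side o(1) flip by (intro UnI1 in_triangleI[of \<epsilon>]) auto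
    qed
  qed
  have "convex hull {?p, ?q, ?r} \<subseteq> polygon X" "convex hull {?p, ?r, ?s} \<subseteq> polygon X"
    unfolding polygon_def range_4 by (auto intro!: hull_mono)
  with sub show "polygon X = convex hull {?p, ?q, ?r} \<union> convex hull {?p, ?r, ?s}" by blast
  \<comment> \<open>A normal vector of the diagonal, which turns orientations into half-plane
    conditions.\<close>
  define n where "n = vec2 (- (?r $ 2 - ?p $ 2)) (?r $ 1 - ?p $ 1)"
  have on: "orient ?p ?r w = n \<bullet> w - n \<bullet> ?p" for w
    by (simp add: n_def orient_def inner_vec_def sum_2 algebra_simps)
  have "n \<noteq> 0"
  proof
    assume "n = 0"
    then have "orient ?p ?r ?s = 0" by (simp add: on)
    with o2(5) show False by simp
  qed
  have "convex hull {?p, ?q, ?r} \<subseteq> {w. (\<epsilon> *\<^sub>R n) \<bullet> w \<le> \<epsilon> * (n \<bullet> ?p)}"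
  proof (intro hull_minimal convex_halfspace_le)
    have "\<epsilon> * orient ?p ?r ?q \<le> 0" using o2(6) by (simp add: orient_def algebra_simps)
    moreover have "\<epsilon> * orient ?p ?r ?r \<le> 0" by simp
    ultimately show "{?p, ?q, ?r} \<subseteq> {w. (\<epsilon> *\<^sub>R n) \<bullet> w \<le> \<epsilon> * (n \<bullet> ?p)}"
      unfolding on by (auto simp: algebra_simps)
  qed
  moreover have "convex hull {?p, ?r, ?s} \<subseteq> {w. (\<epsilon> *\<^sub>R n) \<bullet> w \<ge> \<epsilon> * (n \<bullet> ?p)}"
  proof (intro hull_minimal convex_halfspace_ge)
    have "\<epsilon> * orient ?p ?r ?s \<ge> 0" using o2(5) by simp
    moreover have "\<epsilon> * orient ?p ?r ?r \<ge> 0" by simp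
    ultimately show "{?p, ?r, ?s} \<subseteq> {w. (\<epsilon> *\<^sub>R n) \<bullet> w \<ge> \<epsilon> * (n \<bullet> ?p)}"
      unfolding on by (auto simp: algebra_simps)
  qed
  ultimately have "convex hull {?p, ?q, ?r} \<inter> convex hull {?p, ?r, ?s} \<subseteq> {w. (\<epsilon> *\<^sub>R n) \<bullet> w = \<epsilon> * (n \<bullet> ?p)}"
    by force
  moreover have "\<epsilon> *\<^sub>R n \<noteq> 0" using o \<open>n \<noteq> 0\<close> by auto
  ultimately show "negligible (convex hull {?p, ?q, ?r} \<inter> convex hull {?p, ?r, ?s})"
    by (metis negligible_hyperplane negligible_subset)
qed

text \<open>Signed areas make this a polynomial in the vertices for polynomial \<open>f\<close>,
  meaningful over the complex numbers. For the monomials in question it is the integral over a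
  convex quadrilateral up to the sign of the orientation.\<close>

definition quad_sum :: "('a::field^2 \<Rightarrow> 'a) \<Rightarrow> 'a^2^4 \<Rightarrow> 'a"
  where "quad_sum f X = orient (X$1) (X$2) (X$3) / 2 * cubature f (X$1) (X$2) (X$3)
    + orient (X$1) (X$3) (X$4) / 2 * cubature f (X$1) (X$3) (X$4)"

definition coord_monom :: "mvar \<Rightarrow> 'a::comm_ring_1^2 \<Rightarrow> 'a"
  where "coord_monom x w = w $ 1 ^ fst (expo x) * w $ 2 ^ snd (expo x)"

lemma coord_monom_M00: "coord_monom M00 = (\<lambda>_. 1)"
  by (simp add: coord_monom_def fun_eq_iff)

lemma coord_monom_eq_affine_forms:
  "\<exists>a b c. \<forall>w :: real^2. coord_monom x w = affine_form a w * affine_form b w * affine_form c w"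
proof -
  let ?x = "vector [1, 0, 0] :: real^3" and ?y = "vector [0, 1, 0] :: real^3" and ?z = "vector [0, 0, 1] :: real^3"
  have e: "affine_form ?x w = w $ 1" "affine_form ?y w = w $ 2" "affine_form ?z w = 1" for w
    by (simp_all add: affine_form_def)
  show ?thesis
  proof (cases x)
    case M00 then show ?thesis by (intro exI[of _ ?z]) (simp add: e coord_monom_def)
  next case M10 then show ?thesis by (intro exI[of _ ?x] exI[of _ ?z]) (simp add: e coord_monom_def)
  next case M01 then show ?thesis by (intro exI[of _ ?y] exI[of _ ?z]) (simp add: e coord_monom_def)
  next case M20 then show ?thesis by (intro exI[of _ ?x] exI[of _ ?x] exI[of _ ?z]) (simp add: e coord_monom_def power2_eq_square)
  next case M11 then show ?thesis by (rule_tac exI[of _ ?x], rule_tac exI[of _ ?y], rule_tac exI[of _ ?z]) (simp add: e coord_monom_def)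
  next case M02 then show ?thesis by (rule_tac exI[of _ ?y], rule_tac exI[of _ ?y], rule_tac exI[of _ ?z]) (simp add: e coord_monom_def power2_eq_square)
  next case M30 then show ?thesis by (rule_tac exI[of _ ?x], rule_tac exI[of _ ?x], rule_tac exI[of _ ?x]) (simp add: e coord_monom_def power3_eq_cube)
  next case M21 then show ?thesis by (rule_tac exI[of _ ?x], rule_tac exI[of _ ?x], rule_tac exI[of _ ?y]) (simp add: e coord_monom_def power2_eq_square)
  next case M12 then show ?thesis by (rule_tac exI[of _ ?x], rule_tac exI[of _ ?y], rule_tac exI[of _ ?y]) (simp add: e coord_monom_def power2_eq_square)
  next case M03 then show ?thesis by (rule_tac exI[of _ ?y], rule_tac exI[of _ ?y], rule_tac exI[of _ ?y]) (simp add: e coord_monom_def power3_eq_cube)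
  qed
qed

lemma quad_sum_one: "quad_sum (\<lambda>_. 1) X = (orient (X$1) (X$2) (X$3) + orient (X$1) (X$3) (X$4)) / (2 :: 'a::field_char_0)"
  by (simp add: quad_sum_def cubature_def add_divide_distrib)

lemma has_integral_polygon:
  assumes X: "positively_oriented \<epsilon> X" "\<epsilon> = 1 \<or> \<epsilon> = -1"
  shows "(coord_monom x has_integral \<epsilon> * quad_sum (coord_monom x) X) (polygon X)"
proof -
  obtain a b c where "coord_monom x = (\<lambda>w :: real^2. affine_form a w * affine_form b w * affine_form c w)"
    using coord_monom_eq_affine_forms[of x] by blast
  note tri = has_integral_triangle[where a = a and b = b and c = c, folded this]
  have o: "\<epsilon> * orient (X$1) (X$2) (X$3) > 0" "\<epsilon> * orient (X$1) (X$3) (X$4) > 0"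
    using X(1) by (simp_all add: positively_oriented_def orient_def algebra_simps)
  have abs: "\<bar>y\<bar> = \<epsilon> * y" if "\<epsilon> * y > 0" for y
    using that X(2) by auto
  have "(coord_monom x has_integral (\<epsilon> * orient (X$1) (X$2) (X$3) / 2 * cubature (coord_monom x) (X$1) (X$2) (X$3)))
      (convex hull {X$1, X$2, X$3})"
    using tri[of "X$1" "X$2" "X$3"] o(1) abs[OF o(1)] by auto
  moreover have "(coord_monom x has_integral (\<epsilon> * orient (X$1) (X$3) (X$4) / 2 * cubature (coord_monom x) (X$1) (X$3) (X$4)))
      (convex hull {X$1, X$3, X$4})"
    using tri[of "X$1" "X$3" "X$4"] o(2) abs[OF o(2)] by auto
  ultimately have "(coord_monom x has_integral (\<epsilon> * orient (X$1) (X$2) (X$3) / 2 * cubature (coord_monom x) (X$1) (X$2) (X$3)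
      + \<epsilon> * orient (X$1) (X$3) (X$4) / 2 * cubature (coord_monom x) (X$1) (X$3) (X$4))) (polygon X)"
    unfolding polygon_split(1)[OF X(1)] by (rule has_integral_Un) (rule polygon_split(2)[OF X(1)])
  then show ?thesis by (simp add: quad_sum_def algebra_simps)
qed

text \<open>The orientation sign occurs in numerator and denominator and cancels, so one rational
  function serves both orientations.\<close>

lemma moment_eq:
  assumes X: "quadrilateral X"
  shows "moment (expo x) X = quad_sum (coord_monom x) X / quad_sum (\<lambda>_. 1) X" "quad_sum (\<lambda>_. 1) X \<noteq> (0 :: real)"
proof -
  let ?P = "polygon X"
  obtain \<epsilon> where e: "\<epsilon> = 1 \<or> \<epsilon> = -1" and X': "positively_oriented \<epsilon> X"
    using quadrilateral_oriented[OF X] by blast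
  have "\<epsilon> * orient (X$1) (X$2) (X$3) > 0" "\<epsilon> * orient (X$1) (X$3) (X$4) > 0"
    using X' by (simp_all add: positively_oriented_def orient_def algebra_simps)
  then have pos: "\<epsilon> * quad_sum (\<lambda>_. 1) X > 0"
    by (simp add: quad_sum_one algebra_simps)
  then show "quad_sum (\<lambda>_. 1) X \<noteq> 0" by auto
  have cP: "compact ?P" by (simp add: polygon_def compact_convex_hull finite_imp_compact)
  have int: "(LINT w|lborel. indicator ?P w * coord_monom x w) = \<epsilon> * quad_sum (coord_monom x) X" for x
  proof -
    have "continuous_on ?P (coord_monom x)" unfolding coord_monom_def[abs_def] by (intro continuous_intros)
    then show ?thesis
      using compact_absolutely_integrable(2)[OF cP] has_integral_polygon[OF X' e] by (simp add: integral_unique)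
  qed
  have meas: "measure lborel ?P = \<epsilon> * quad_sum (\<lambda>_. 1) X"
    using int[of M00] cP by (simp add: coord_monom_M00 borel_compact)
  have [measurable]: "?P \<in> sets borel" using cP by (rule borel_compact)
  have fin: "emeasure lborel ?P \<noteq> \<infinity>" using emeasure_compact_finite[OF cP] by auto
  have dens: "uniform_measure lborel ?P = density lborel (\<lambda>w. ennreal (indicator ?P w / measure lborel ?P))"
    unfolding uniform_measure_def
  proof (rule density_cong)
    show "AE w in lborel. indicator ?P w / emeasure lborel ?P = ennreal (indicator ?P w / measure lborel ?P)"
      using pos meas fin by (auto simp: emeasure_eq_ennreal_measure indicator_def divide_ennreal[symmetric] simp flip: ennreal_1)
  qed measurable
  have "coord_monom x \<in> borel_measurable (borel :: (real^2) measure)"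
    unfolding coord_monom_def[abs_def] by (intro borel_measurable_continuous_onI continuous_intros)
  then have cm: "coord_monom x \<in> borel_measurable (lborel :: (real^2) measure)" by simp
  have "moment (expo x) X = (LINT w|uniform_measure lborel ?P. coord_monom x w)"
    by (simp add: moment_def coord_monom_def)
  also have "\<dots> = (LINT w|lborel. (indicator ?P w / measure lborel ?P) *\<^sub>R coord_monom x w)"
    unfolding dens
    by (rule integral_density) (use cP cm pos meas in \<open>auto intro!: borel_measurable_divide borel_measurable_indicator borel_compact\<close>)
  also have "\<dots> = (LINT w|lborel. indicator ?P w * coord_monom x w / measure lborel ?P)"
    by (simp add: algebra_simps)
  also have "\<dots> = \<epsilon> * quad_sum (coord_monom x) X / measure lborel ?P"
    by (simp add: int)
  also have "\<dots> = quad_sum (coord_monom x) X / quad_sum (\<lambda>_. 1) X"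
    using e by (auto simp: meas)
  finally show "moment (expo x) X = quad_sum (coord_monom x) X / quad_sum (\<lambda>_. 1) X" .
qed

text \<open>Each side is cut out by a supporting half-plane and so is a face; each vertex is the
  intersection of two adjacent sides and so is an extreme point.\<close>

lemma positively_oriented_quadrilateral:
  assumes X: "positively_oriented 1 X"
  shows "quadrilateral X"
proof -
  let ?P = "polygon X"
  have dist: "distinct [X$1, X$2, X$3, X$4]" by (rule distinct_oriented[OF X])
  have o: "orient (X$1) (X$2) (X$3) > 0" "orient (X$2) (X$3) (X$4) > 0" "orient (X$3) (X$4) (X$1) > 0" "orient (X$4) (X$1) (X$2) > 0"
    using X by (auto simp: positively_oriented_def)
  have face: "closed_segment p q face_of convex hull {p, q, r, s}"
    if d: "distinct [p, q, r, s]" and or: "orient p q r > 0" "orient p q s > 0" for p q r s :: "real^2"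
  proof -
    define n where "n = vec2 (- (q $ 2 - p $ 2)) (q $ 1 - p $ 1)"
    have on: "orient p q w = n \<bullet> w - n \<bullet> p" for w
      by (simp add: n_def orient_def inner_vec_def sum_2 algebra_simps)
    let ?S = "convex hull {p, q, r, s}"
    have nq: "n \<bullet> q = n \<bullet> p" using on[of q] by simp
    have "n \<bullet> w \<ge> n \<bullet> p" if "w \<in> ?S" for w
    proof -
      have "?S \<subseteq> {w. n \<bullet> w \<ge> n \<bullet> p}"
        by (intro hull_minimal convex_halfspace_ge) (use or on nq in auto)
      with that show ?thesis by blast
    qed
    then have "(?S \<inter> {w. n \<bullet> w = n \<bullet> p}) face_of ?S"
      by (intro face_of_Int_supporting_hyperplane_ge) auto
    moreover have "?S \<inter> {w. n \<bullet> w = n \<bullet> p} = closed_segment p q"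
    proof (intro equalityI subsetI)
      fix w assume w: "w \<in> ?S \<inter> {w. n \<bullet> w = n \<bullet> p}"
      then obtain a b c d' where nn: "0 \<le> a" "0 \<le> b" "0 \<le> c" "0 \<le> d'" and a: "a = 1 - b - c - d'"
        and we: "w = a *\<^sub>R p + b *\<^sub>R q + c *\<^sub>R r + d' *\<^sub>R s"
        using in_hull_4[OF d] by blast
      have "orient p q w = 0" using w by (simp add: on)
      then have "c * orient p q r + d' * orient p q s = 0"
        unfolding we orient_combination[OF a] by simp
      then have "c * orient p q r = 0" "d' * orient p q s = 0"
        using nn or by (smt (verit) mult_nonneg_nonneg)+
      then have "c = 0" "d' = 0" using or by auto
      then show "w \<in> closed_segment p q"
        using nn a we by (auto simp: in_segment intro!: exI[of _ b])
    next
      fix w assume "w \<in> closed_segment p q"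
      then have "w \<in> convex hull {p, q}" by (simp add: segment_convex_hull)
      then have "w \<in> ?S" using hull_mono[of "{p, q}" "{p, q, r, s}" convex] by blast
      moreover have "orient p q w = 0"
        using \<open>w \<in> closed_segment p q\<close> by (rule orient_segment)
      ultimately show "w \<in> ?S \<inter> {w. n \<bullet> w = n \<bullet> p}" by (simp add: on)
    qed
    ultimately show ?thesis by simp
  qed
  have P: "?P = convex hull {X$1, X$2, X$3, X$4}" by (simp add: polygon_def range_4)
  have rot: "{X$2, X$3, X$4, X$1} = {X$1, X$2, X$3, X$4}" "{X$3, X$4, X$1, X$2} = {X$1, X$2, X$3, X$4}"
    "{X$4, X$1, X$2, X$3} = {X$1, X$2, X$3, X$4}" by auto
  have o2: "orient (X$1) (X$2) (X$4) > 0" "orient (X$2) (X$3) (X$1) > 0" "orient (X$3) (X$4) (X$2) > 0"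
    "orient (X$4) (X$1) (X$3) > 0"
    using o by (simp_all add: orient_def algebra_simps)
  have f: "closed_segment (X$1) (X$2) face_of ?P" "closed_segment (X$2) (X$3) face_of ?P"
    "closed_segment (X$3) (X$4) face_of ?P" "closed_segment (X$4) (X$1) face_of ?P"
    using face[of "X$1" "X$2" "X$3" "X$4"] face[of "X$2" "X$3" "X$4" "X$1"] face[of "X$3" "X$4" "X$1" "X$2"]
      face[of "X$4" "X$1" "X$2" "X$3"] dist o o2
    unfolding P rot by auto
  have int: "closed_segment p q \<inter> closed_segment q r = {q}" if nz: "orient p q r \<noteq> 0" for p q r :: "real^2"
  proof -
    have "w = q" if w: "w \<in> closed_segment p q" "w \<in> closed_segment q r" for w
    proof -
      obtain u where u: "w = (1 - u) *\<^sub>R p + u *\<^sub>R q" using w(1) unfolding in_segment by blast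
      obtain v where v: "w = (1 - v) *\<^sub>R q + v *\<^sub>R r" using w(2) unfolding in_segment by blast
      have "orient p q w = v * orient p q r" unfolding v orient_def by (simp add: algebra_simps)
      moreover have "orient p q w = 0" using w(1) by (rule orient_segment)
      ultimately have "v = 0" using nz by simp
      then show ?thesis using v by simp
    qed
    then show ?thesis by auto
  qed
  have e: "X $ k extreme_point_of ?P" for k
  proof -
    have "(closed_segment (X$4) (X$1) \<inter> closed_segment (X$1) (X$2)) face_of ?P"
      "(closed_segment (X$1) (X$2) \<inter> closed_segment (X$2) (X$3)) face_of ?P"
      "(closed_segment (X$2) (X$3) \<inter> closed_segment (X$3) (X$4)) face_of ?P"
      "(closed_segment (X$3) (X$4) \<inter> closed_segment (X$4) (X$1)) face_of ?P"
      using f by (auto intro: face_of_Int)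
    then have "\<forall>k. X $ k extreme_point_of ?P"
      using o by (simp add: int face_of_singleton forall_4)
    then show ?thesis ..
  qed
  have i: "inj (\<lambda>k. X $ k)"
  proof -
    have "\<forall>i j. X $ i = X $ j \<longrightarrow> i = j" using dist by (auto simp: forall_4)
    then show ?thesis by (auto simp: inj_def)
  qed
  have "(4::4) + 1 = 1" by simp
  then have "\<forall>k. closed_segment (X $ k) (X $ (k + 1)) edge_of ?P"
    using f dist by (simp only: forall_4) (auto simp: edge_of_def segment_convex_hull aff_dim_convex_hull aff_dim_2)
  with e i show ?thesis by (simp add: quadrilateral_def)
qed

subsection \<open>Affine covariance\<close>

text \<open>The substitutions fixing the point (0,0,1), dual to the affine maps of the plane.
  Covariants of the cubic evaluated at that point are therefore affine invariants up to powers of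
  the determinant.\<close>

definition affm :: "complex \<Rightarrow> complex \<Rightarrow> complex \<Rightarrow> complex \<Rightarrow> complex \<Rightarrow> complex \<Rightarrow> complex^3^3"
  where "affm a b c d e f = vector [vector [a, b, 0], vector [c, d, 0], vector [e, f, 1]]"

lemma affm_simps [simp]:
  "affm a b c d e f $ 1 $ 1 = a" "affm a b c d e f $ 1 $ 2 = b" "affm a b c d e f $ 1 $ 3 = 0"
  "affm a b c d e f $ 2 $ 1 = c" "affm a b c d e f $ 2 $ 2 = d" "affm a b c d e f $ 2 $ 3 = 0"
  "affm a b c d e f $ 3 $ 1 = e" "affm a b c d e f $ 3 $ 2 = f" "affm a b c d e f $ 3 $ 3 = 1"
  by (simp_all add: affm_def)

lemma det_affm: "det (affm a b c d e f) = a * d - b * c"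
  by (simp add: det_3)

lemma act_affm:
  "act (affm a b c d e f) m M00 = m M00"
  "act (affm a b c d e f) m M10 = a * m M10 + c * m M01 + e * m M00"
  "act (affm a b c d e f) m M01 = b * m M10 + d * m M01 + f * m M00"
  "act (affm a b c d e f) m M20 = a^2 * m M20 + c^2 * m M02 + e^2 * m M00 + 2 * a * c * m M11 + 2 * a * e * m M10 + 2 * c * e * m M01"
  "act (affm a b c d e f) m M11 = a * b * m M20 + c * d * m M02 + e * f * m M00 + (a * d + b * c) * m M11
    + (a * f + b * e) * m M10 + (c * f + d * e) * m M01"
  "act (affm a b c d e f) m M02 = b^2 * m M20 + d^2 * m M02 + f^2 * m M00 + 2 * b * d * m M11 + 2 * b * f * m M10 + 2 * d * f * m M01"
  unfolding act_def idx.simps prod.case sum_3 mv_simps affm_simps by ((simp; fail) | algebra)+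

text \<open>The covariance of \<open>inv_G\<close> is reached in stages, by way of the cofactors and
  of the gradient of the Hessian, so that every stage is a manageable polynomial identity.\<close>

lemma adj_affm:
  fixes a b c d e f m
  defines "m' \<equiv> act (affm a b c d e f) m"
  shows "adj_11 m' = d^2 * adj_11 m + b^2 * adj_22 m - 2 * b * d * adj_12 m"
    "adj_12 m' = (a * d + b * c) * adj_12 m - c * d * adj_11 m - a * b * adj_22 m"
    "adj_22 m' = c^2 * adj_11 m + a^2 * adj_22 m - 2 * a * c * adj_12 m"
    "adj_13 m' = (a * d - b * c) * (d * adj_13 m - b * adj_23 m)
      + (c * f - d * e) * (d * adj_11 m - b * adj_12 m) - (a * f - b * e) * (d * adj_12 m - b * adj_22 m)"
    "adj_23 m' = (a * d - b * c) * (a * adj_23 m - c * adj_13 m)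
      + (c * f - d * e) * (a * adj_12 m - c * adj_11 m) - (a * f - b * e) * (a * adj_22 m - c * adj_12 m)"
    "adj_33 m' = (a * d - b * c)^2 * adj_33 m + (c * f - d * e)^2 * adj_11 m + (a * f - b * e)^2 * adj_22 m
      + 2 * (a * d - b * c) * (c * f - d * e) * adj_13 m - 2 * (a * d - b * c) * (a * f - b * e) * adj_23 m
      - 2 * (c * f - d * e) * (a * f - b * e) * adj_12 m"
  unfolding m'_def adj_defs act_affm by algebra+

lemma inv_H_affm: "inv_H (act (affm a b c d e f) m) = (a * d - b * c)^2 * inv_H m"
  unfolding inv_H_defs act_affm by algebra

text \<open>Euler's relation puts \<open>3 * inv_H m\<close> into the same shape as
  \<open>hess_1\<close> and \<open>hess_2\<close>; the three form a gradient that transforms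
  linearly.\<close>

lemma hess_3: "3 * inv_H m = adj_11 m * m M20 + 2 * adj_12 m * m M11 + 2 * adj_13 m * m M10
    + adj_22 m * m M02 + 2 * adj_23 m * m M01 + adj_33 m * m M00" for m :: "mvar \<Rightarrow> complex"
  unfolding inv_H_defs by algebra

lemma hess_affm:
  "hess_1 (act (affm a b c d e f) m) = (a * d - b * c)^2 * (a * hess_1 m + c * hess_2 m + 3 * e * inv_H m)"
  "hess_2 (act (affm a b c d e f) m) = (a * d - b * c)^2 * (b * hess_1 m + d * hess_2 m + 3 * f * inv_H m)"
proof -
  have 3: "3 * e * inv_H m = e * (3 * inv_H m)" "3 * f * inv_H m = f * (3 * inv_H m)" by simp_all
  show "hess_1 (act (affm a b c d e f) m) = (a * d - b * c)^2 * (a * hess_1 m + c * hess_2 m + 3 * e * inv_H m)"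
    "hess_2 (act (affm a b c d e f) m) = (a * d - b * c)^2 * (b * hess_1 m + d * hess_2 m + 3 * f * inv_H m)"
    unfolding 3 hess_3 hess_1_def hess_2_def adj_affm
    unfolding act_def idx.simps prod.case sum_3 mv_simps affm_simps by algebra+
qed

lemma inv_G_affm: "inv_G (act (affm a b c d e f) m) = (a * d - b * c)^6 * inv_G m"
  unfolding inv_G_def hess_affm inv_H_affm adj_affm by algebra

lemma inv_affm:
  assumes "a * d - b * c \<noteq> 0"
  shows "inv_S (act (affm a b c d e f) m) = (a * d - b * c)^4 * inv_S m"
    and "inv_T (act (affm a b c d e f) m) = (a * d - b * c)^6 * inv_T m"
    and "quad_U (act (affm a b c d e f) m) = (a * d - b * c)^6 * quad_U m"
    and "quad_V (act (affm a b c d e f) m) = (a * d - b * c)^4 * quad_V m"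
proof -
  show S: "inv_S (act (affm a b c d e f) m) = (a * d - b * c)^4 * inv_S m"
    and T: "inv_T (act (affm a b c d e f) m) = (a * d - b * c)^6 * inv_T m"
    using assms by (simp_all add: inv_S_act inv_T_act det_affm)
  show "quad_U (act (affm a b c d e f) m) = (a * d - b * c)^6 * quad_U m"
    "quad_V (act (affm a b c d e f) m) = (a * d - b * c)^4 * quad_V m"
    unfolding quad_U_def quad_V_def S T inv_H_affm inv_G_affm act_affm by algebra+
qed

lemma act_affm_inverse:
  assumes "a * d - b * c \<noteq> 0"
  obtains a' b' c' d' e' f' where "a' * d' - b' * c' \<noteq> 0"
    "\<And>m. act (affm a' b' c' d' e' f') (act (affm a b c d e f) m) = m"
proof -
  define i where "i = 1 / (a * d - b * c)"
  have i: "i * (a * d - b * c) = 1" using assms by (simp add: i_def)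
  let ?B = "affm (d * i) (- b * i) (- c * i) (a * i) ((c * f - d * e) * i) ((b * e - a * f) * i)"
  have "a * (d * i) + b * (- c * i) = 1" "a * (- b * i) + b * (a * i) = 0"
    "c * (d * i) + d * (- c * i) = 0" "c * (- b * i) + d * (a * i) = 1"
    "e * (d * i) + f * (- c * i) + (c * f - d * e) * i = 0" "e * (- b * i) + f * (a * i) + (b * e - a * f) * i = 0"
    using i by algebra+
  then have "affm a b c d e f ** ?B = mat 1"
    by (simp add: vec_eq_iff forall_3 matrix_matrix_mult_def sum_3 mat_def three_neq)
  then have "act ?B (act (affm a b c d e f) m) = m" for m
    by (metis act_mult act_mat_1)
  moreover have "(d * i) * (a * i) - (- b * i) * (- c * i) = i" using i by algebra
  moreover have "i \<noteq> 0" using i by auto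
  ultimately show thesis by (intro that) auto
qed

section \<open>Moments under affine maps of the vertices\<close>

definition affine_image :: "complex^2^2 \<Rightarrow> complex^2 \<Rightarrow> complex^2^4 \<Rightarrow> complex^2^4"
  where "affine_image A t X = (\<chi> k. A *v X $ k + t)"

lemma cubic_coord_monom: "cubic (\<lambda>x. coord_monom x w) u = (w $ 1 * u $ 1 + w $ 2 * u $ 2 + u $ 3) ^ 3" for w :: "complex^2"
  unfolding cubic_def coord_monom_def by simp algebra

text \<open>The cubic whose coefficients are the monomials of a point \<open>w\<close> is the cube
  of the linear form with coefficients \<open>w\<close> and 1, so moving the point amounts to a
  linear substitution.\<close>

lemma coord_monom_affine:
  "coord_monom x (A *v w + t) = act (affm (A$1$1) (A$2$1) (A$1$2) (A$2$2) (t$1) (t$2)) (\<lambda>y. coord_monom y w) x"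
proof -
  have "(\<lambda>x. coord_monom x (A *v w + t)) = act (affm (A$1$1) (A$2$1) (A$1$2) (A$2$2) (t$1) (t$2)) (\<lambda>y. coord_monom y w)"
    by (rule act_unique)
      (simp add: cubic_coord_monom matrix_vector_mult_def sum_2 sum_3 algebra_simps)
  then show ?thesis by metis
qed

lemma act_linear:
  "act B (\<lambda>y. m y + m' y) x = act B m x + act B m' x" "act B (\<lambda>y. k * m y) x = k * act B m x"
  "act B (\<lambda>y. m y / k) x = act B m x / k"
  by (cases "idx x"; simp add: act_def sum_distrib_left sum_divide_distrib sum.distrib[symmetric] algebra_simps)+

lemma cubature_act: "cubature (\<lambda>w. act B (\<lambda>y. g y w) x) p q r = act B (\<lambda>y. cubature (g y) p q r) x"
  unfolding cubature_def act_linear ..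

lemma orient_affine: "orient (A *v p + t) (A *v q + t) (A *v r + t) = (A$1$1 * A$2$2 - A$1$2 * A$2$1) * orient p q r"
  for A :: "complex^2^2"
  unfolding orient_def matrix_vector_mult_def by (simp add: sum_2 algebra_simps)

lemma cubature_affine:
  "cubature f (A *v p + t) (A *v q + t) (A *v r + t) = cubature (\<lambda>w. f (A *v w + t)) p q r" for A :: "complex^2^2"
proof -
  have *: "(1 / 2) *s ((A *v x + t) + (A *v y + t)) = A *v ((1 / 2) *s (x + y)) + t"
    "(1 / 3) *s ((A *v x + t) + (A *v y + t) + (A *v z + t)) = A *v ((1 / 3) *s (x + y + z)) + t" for x y z
    by (simp_all add: vec_eq_iff forall_2 matrix_vector_mult_def sum_2 field_simps)
  show ?thesis by (simp only: cubature_def *)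
qed

definition qmoment :: "complex^2^4 \<Rightarrow> mvar \<Rightarrow> complex"
  where "qmoment X x = quad_sum (coord_monom x) X / quad_sum (\<lambda>_. 1) X"

lemma quad_sum_affine:
  "quad_sum (coord_monom x) (affine_image A t X) = (A$1$1 * A$2$2 - A$1$2 * A$2$1) *
    act (affm (A$1$1) (A$2$1) (A$1$2) (A$2$2) (t$1) (t$2)) (\<lambda>y. quad_sum (coord_monom y) X) x"
  unfolding quad_sum_def act_linear affine_image_def vec_lambda_beta orient_affine cubature_affine
    coord_monom_affine cubature_act
  by (simp add: algebra_simps)

lemma quad_sum_one_affine:
  "quad_sum (\<lambda>_. 1) (affine_image A t X) = (A$1$1 * A$2$2 - A$1$2 * A$2$1) * quad_sum (\<lambda>_. 1) X"
  unfolding quad_sum_one affine_image_def vec_lambda_beta orient_affine by (simp add: field_simps)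

lemma qmoment_affine:
  assumes "A$1$1 * A$2$2 - A$1$2 * A$2$1 \<noteq> 0"
  shows "qmoment (affine_image A t X) = act (affm (A$1$1) (A$2$1) (A$1$2) (A$2$2) (t$1) (t$2)) (qmoment X)"
proof
  fix x
  have "act B (qmoment X) x = act B (\<lambda>y. quad_sum (coord_monom y) X) x / quad_sum (\<lambda>_. 1) X" for B
    unfolding qmoment_def[abs_def] act_linear ..
  then show "qmoment (affine_image A t X) x = act (affm (A$1$1) (A$2$1) (A$1$2) (A$2$2) (t$1) (t$2)) (qmoment X) x"
    using assms by (simp add: qmoment_def quad_sum_affine quad_sum_one_affine)
qed

text \<open>The image points at which the explicit fraction of \<open>quad_sum\<close> terms is
  defined, a set stable under affine substitutions. It lies in \<open>moment_image\<close> and is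
  what the divisibility argument works with.\<close>

definition moment_vectors :: "(mvar \<Rightarrow> complex) set"
  where "moment_vectors = {qmoment X |X. quad_sum (\<lambda>_. 1) X \<noteq> 0}"

lemma moment_vectors_act:
  assumes "m \<in> moment_vectors" "a * d - b * c \<noteq> 0"
  shows "act (affm a b c d e f) m \<in> moment_vectors"
proof -
  obtain X where X: "m = qmoment X" "quad_sum (\<lambda>_. 1) X \<noteq> 0"
    using assms(1) by (auto simp: moment_vectors_def)
  define A where "A = vec2 (vec2 a c) (vec2 b d)"
  have A: "A$1$1 = a" "A$1$2 = c" "A$2$1 = b" "A$2$2 = d" by (simp_all add: A_def)
  have "act (affm a b c d e f) m = qmoment (affine_image A (vec2 e f) X)"
    using assms(2) by (simp add: X qmoment_affine A algebra_simps)
  moreover have "quad_sum (\<lambda>_. 1) (affine_image A (vec2 e f) X) \<noteq> 0"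
    using assms(2) X(2) by (simp add: quad_sum_one_affine A algebra_simps)
  ultimately show ?thesis unfolding moment_vectors_def by blast
qed

lemma moment_vectors_act_iff:
  assumes "a * d - b * c \<noteq> 0"
  shows "act (affm a b c d e f) m \<in> moment_vectors \<longleftrightarrow> m \<in> moment_vectors"
proof
  assume "act (affm a b c d e f) m \<in> moment_vectors"
  moreover obtain a' b' c' d' e' f' where "a' * d' - b' * c' \<noteq> 0"
    "\<And>m. act (affm a' b' c' d' e' f') (act (affm a b c d e f) m) = m"
    by (rule act_affm_inverse[OF assms, of e f]) blast
  ultimately show "m \<in> moment_vectors"
    using moment_vectors_act[of "act (affm a b c d e f) m" a' d' b' c' e' f'] by simp
qed (rule moment_vectors_act[OF _ assms])

subsection \<open>A normal form of quadrilaterals\<close>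

lemma cubature_eq: "cubature f p q r = (3 * (f p + f q + f r)
    + 8 * (f ((1 / 2) *s (p + q)) + f ((1 / 2) *s (q + r)) + f ((1 / 2) *s (p + r)))
    + 27 * f ((1 / 3) *s (p + q + r))) / (60 :: 'a::field_char_0)"
  by (simp add: cubature_def add_divide_distrib distrib_left)

text \<open>The quadrilateral with vertices $(1,0)$, $(0,1)$, $(-\lambda,0)$, $(0,-\mu)$, whose diagonals meet at the
  origin, translated so that its centroid becomes the origin, and scaled by 30 to avoid fractions.\<close>
definition kite :: "complex \<Rightarrow> complex \<Rightarrow> complex^2^4"
  where "kite l m = vector [vec2 (20 + 10 * l) (10 * m - 10), vec2 (10 * l - 10) (20 + 10 * m),
    vec2 (- 10 - 20 * l) (10 * m - 10), vec2 (10 * l - 10) (- 10 - 20 * m)]"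

lemma kite_simps: "kite l m $ 1 = vec2 (20 + 10 * l) (10 * m - 10)" "kite l m $ 2 = vec2 (10 * l - 10) (20 + 10 * m)"
  "kite l m $ 3 = vec2 (- 10 - 20 * l) (10 * m - 10)" "kite l m $ 4 = vec2 (10 * l - 10) (- 10 - 20 * m)"
  by (simp_all add: kite_def vector_4)

lemma quad_sum_kite_eq:
  "2 * quad_sum f (kite l m) = 15 * (1 + l) * (3 * (f (vec2 (20 + 10 * l) (10 * m - 10)) + f (vec2 (10 * l - 10) (20 + 10 * m))
      + f (vec2 (- 10 - 20 * l) (10 * m - 10)))
    + 8 * (f (vec2 (10 * l + 5) (10 * m + 5)) + f (vec2 (- 5 * l - 10) (10 * m + 5)) + f (vec2 (5 - 5 * l) (10 * m - 10)))
    + 27 * f (vec2 0 (10 * m))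
    + m * (3 * (f (vec2 (20 + 10 * l) (10 * m - 10)) + f (vec2 (- 10 - 20 * l) (10 * m - 10)) + f (vec2 (10 * l - 10) (- 10 - 20 * m)))
    + 8 * (f (vec2 (5 - 5 * l) (10 * m - 10)) + f (vec2 (- 5 * l - 10) (- 5 * m - 10)) + f (vec2 (10 * l + 5) (- 5 * m - 10)))
    + 27 * f (vec2 0 (- 10))))"
proof -
  let ?a = "vec2 (20 + 10 * l) (10 * m - 10)" and ?b = "vec2 (10 * l - 10) (20 + 10 * m)"
    and ?c = "vec2 (- 10 - 20 * l) (10 * m - 10)" and ?d = "vec2 (10 * l - 10) (- 10 - 20 * m)"
  have p: "(1 / 2) *s (?a + ?b) = vec2 (10 * l + 5) (10 * m + 5)" "(1 / 2) *s (?b + ?c) = vec2 (- 5 * l - 10) (10 * m + 5)"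
    "(1 / 2) *s (?a + ?c) = vec2 (5 - 5 * l) (10 * m - 10)" "(1 / 2) *s (?c + ?d) = vec2 (- 5 * l - 10) (- 5 * m - 10)"
    "(1 / 2) *s (?a + ?d) = vec2 (10 * l + 5) (- 5 * m - 10)" "(1 / 3) *s (?a + ?b + ?c) = vec2 0 (10 * m)"
    "(1 / 3) *s (?a + ?c + ?d) = vec2 0 (- 10)"
    by (simp_all add: vec_eq_iff forall_2 field_simps)
  have o: "orient ?a ?b ?c = 900 * (1 + l)" "orient ?a ?c ?d = 900 * (1 + l) * m"
    by (simp_all add: orient_def algebra_simps)
  have *: "2 * (900 * (1 + l) / 2 * (x / 60) + 900 * (1 + l) * m / 2 * (y / 60)) = 15 * (1 + l) * (x + m * y)" for x y
    by (simp add: field_simps)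
  show ?thesis
    unfolding quad_sum_def cubature_eq kite_simps p o * ..
qed

lemma quad_sum_kite:
  "quad_sum (\<lambda>_. 1) (kite l m) = 450 * (1 + l) * (1 + m)"
  "quad_sum (coord_monom M00) (kite l m) = 450 * (1 + l) * (1 + m)"
  "quad_sum (coord_monom M10) (kite l m) = 0" "quad_sum (coord_monom M01) (kite l m) = 0"
  "quad_sum (coord_monom M20) (kite l m) = 450 * (1 + l) * (1 + m) * (50 * (1 + l + l^2))"
  "quad_sum (coord_monom M11) (kite l m) = 450 * (1 + l) * (1 + m) * (- 25 * (1 - l) * (1 - m))"
  "quad_sum (coord_monom M02) (kite l m) = 450 * (1 + l) * (1 + m) * (50 * (1 + m + m^2))"
  "quad_sum (coord_monom M30) (kite l m) = 450 * (1 + l) * (1 + m) * (100 * ((1 - l) * (2 + l) * (1 + 2 * l)))"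
  "quad_sum (coord_monom M21) (kite l m) = 450 * (1 + l) * (1 + m) * (- 100 * ((1 - m) * (1 + 4 * l + l^2)))"
  "quad_sum (coord_monom M12) (kite l m) = 450 * (1 + l) * (1 + m) * (- 100 * ((1 - l) * (1 + 4 * m + m^2)))"
  "quad_sum (coord_monom M03) (kite l m) = 450 * (1 + l) * (1 + m) * (100 * ((1 - m) * (2 + m) * (1 + 2 * m)))"
proof -
  have two: "2 * x = 2 * y \<Longrightarrow> x = y" for x y :: complex by simp
  show
  "quad_sum (\<lambda>_. 1) (kite l m) = 450 * (1 + l) * (1 + m)"
  "quad_sum (coord_monom M00) (kite l m) = 450 * (1 + l) * (1 + m)"
  "quad_sum (coord_monom M10) (kite l m) = 0" "quad_sum (coord_monom M01) (kite l m) = 0"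
  "quad_sum (coord_monom M20) (kite l m) = 450 * (1 + l) * (1 + m) * (50 * (1 + l + l^2))"
  "quad_sum (coord_monom M11) (kite l m) = 450 * (1 + l) * (1 + m) * (- 25 * (1 - l) * (1 - m))"
  "quad_sum (coord_monom M02) (kite l m) = 450 * (1 + l) * (1 + m) * (50 * (1 + m + m^2))"
  "quad_sum (coord_monom M30) (kite l m) = 450 * (1 + l) * (1 + m) * (100 * ((1 - l) * (2 + l) * (1 + 2 * l)))"
  "quad_sum (coord_monom M21) (kite l m) = 450 * (1 + l) * (1 + m) * (- 100 * ((1 - m) * (1 + 4 * l + l^2)))"
  "quad_sum (coord_monom M12) (kite l m) = 450 * (1 + l) * (1 + m) * (- 100 * ((1 - l) * (1 + 4 * m + m^2)))"
  "quad_sum (coord_monom M03) (kite l m) = 450 * (1 + l) * (1 + m) * (100 * ((1 - m) * (2 + m) * (1 + 2 * m)))"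
    by (rule two, unfold quad_sum_kite_eq coord_monom_def expo.simps fst_conv snd_conv vec2_simps power_0 power_one_right
      mult_1 mult_1_right power_zero_numeral mult_zero_left mult_zero_right, algebra)+
qed

lemma qmoment_kite:
  assumes "1 + l \<noteq> 0" "1 + m \<noteq> 0"
  shows "qmoment (kite l m) M00 = 1" "qmoment (kite l m) M10 = 0" "qmoment (kite l m) M01 = 0"
    "qmoment (kite l m) M20 = 50 * (1 + l + l^2)" "qmoment (kite l m) M11 = - 25 * (1 - l) * (1 - m)"
    "qmoment (kite l m) M02 = 50 * (1 + m + m^2)"
    "qmoment (kite l m) M30 = 100 * ((1 - l) * (2 + l) * (1 + 2 * l))"
    "qmoment (kite l m) M21 = - 100 * ((1 - m) * (1 + 4 * l + l^2))"
    "qmoment (kite l m) M12 = - 100 * ((1 - l) * (1 + 4 * m + m^2))"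
    "qmoment (kite l m) M03 = 100 * ((1 - m) * (2 + m) * (1 + 2 * m))"
proof -
  define D where "D = 450 * (1 + l) * (1 + m)"
  have "D \<noteq> 0" unfolding D_def using assms by (metis mult_eq_0_iff zero_neq_numeral)
  then show "qmoment (kite l m) M00 = 1" "qmoment (kite l m) M10 = 0" "qmoment (kite l m) M01 = 0"
    "qmoment (kite l m) M20 = 50 * (1 + l + l^2)" "qmoment (kite l m) M11 = - 25 * (1 - l) * (1 - m)"
    "qmoment (kite l m) M02 = 50 * (1 + m + m^2)"
    "qmoment (kite l m) M30 = 100 * ((1 - l) * (2 + l) * (1 + 2 * l))"
    "qmoment (kite l m) M21 = - 100 * ((1 - m) * (1 + 4 * l + l^2))"
    "qmoment (kite l m) M12 = - 100 * ((1 - l) * (1 + 4 * m + m^2))"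
    "qmoment (kite l m) M03 = 100 * ((1 - m) * (2 + m) * (1 + 2 * m))"
    unfolding qmoment_def quad_sum_kite[of l m, folded D_def] by simp_all
qed

text \<open>\<open>E\<close> is $\lambda\mu\,(\lambda + 1/\lambda + 2)(\mu + 1/\mu + 2) - 4\lambda\mu$. On quadrilaterals the invariant \<open>s\<close> becomes
  the square of \<open>z = 1125 (E + 8 \<lambda> \<mu>)\<close>.\<close>
definition kite_E :: "complex \<Rightarrow> complex \<Rightarrow> complex"
  where "kite_E l m = (l^2 + 1) * (m^2 + 1) + 2 * (l^2 + 1) * m + 2 * (m^2 + 1) * l"

lemma inv_centered:
  fixes w :: "mvar \<Rightarrow> complex"
  assumes "w M00 = 1" "w M10 = 0" "w M01 = 0"
  shows "inv_H w = w M20 * w M02 - w M11^2"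
    "inv_S w = inv_H w^2 - w M02 * (w M21^2 - w M30 * w M12) + w M11 * (w M21 * w M12 - w M30 * w M03)
      - w M20 * (w M12^2 - w M21 * w M03)"
    "inv_G w = 9 * inv_H w^3 + w M02 * (w M02 * w M30 - 2 * w M11 * w M21 + w M20 * w M12)^2
      - 2 * w M11 * (w M02 * w M30 - 2 * w M11 * w M21 + w M20 * w M12) * (w M02 * w M21 - 2 * w M11 * w M12 + w M20 * w M03)
      + w M20 * (w M02 * w M21 - 2 * w M11 * w M12 + w M20 * w M03)^2"
  unfolding inv_S_def inv_G_defs assms mult_zero_left mult_zero_right mult_1 mult_1_right power_one
    power_zero_numeral add_0 add_0_right diff_zero
  by ((simp; fail) | algebra)+

lemma inv_T_centered:
  fixes w :: "mvar \<Rightarrow> complex"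
  assumes "w M00 = 1" "w M10 = 0" "w M01 = 0"
  shows "inv_T w = (let q = w M20; r = w M11; p = w M02; a = w M30; b = w M21; c = w M12; d = w M03 in
    8 * inv_H w^3 + a^2 * d^2 - 6 * a * b * c * d - 3 * b^2 * c^2 + 4 * b^3 * d + 4 * a * c^3
    + 4 * p^3 * a^2 - 24 * r * p^2 * a * b + 12 * r^2 * p * b^2 + 36 * r^2 * p * a * c - 12 * r^3 * b * c - 20 * r^3 * a * d
    + 24 * q * p^2 * b^2 - 12 * q * p^2 * a * c - 60 * q * r * p * b * c + 12 * q * r * p * a * d + 12 * q * r^2 * c^2
    + 36 * q * r^2 * b * d + 24 * q^2 * p * c^2 - 12 * q^2 * p * b * d - 24 * q^2 * r * c * d + 4 * q^3 * d^2)"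
  unfolding inv_T_def inv_H_defs assms Let_def mult_zero_left mult_zero_right mult_1 mult_1_right power_one
    power_zero_numeral add_0 add_0_right diff_zero
  by algebra

text \<open>With A = l + 1/l and B = m + 1/m, \<open>kite_E l m\<close> is l m (A B + 2 (A + B)),
  and (l m)^2 (l^2 + 1) (m^2 + 1) is (l m)^3 A B. So up to powers of l m only A B and A + B occur,
  in accordance with the relabellings that invert or exchange the two ratios.\<close>

lemma kite_invariants:
  assumes "1 + l \<noteq> 0" "1 + m \<noteq> 0"
  defines "w \<equiv> qmoment (kite l m)" and "z \<equiv> 1125 * (kite_E l m + 8 * l * m)"
  shows "inv_H w = 1875 * kite_E l m" "inv_S w = z^2"
    "inv_G w = 9 * inv_H w^3 + 263671875 * (1728 * (l * m)^2 * (l^2 + 1) * (m^2 + 1) - 576 * kite_E l m * (l * m)^2)"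
    "quad_U w = z * quad_V w"
proof -
  note q = qmoment_kite[OF assms(1,2), folded w_def]
  show H: "inv_H w = 1875 * kite_E l m"
    unfolding inv_centered(1)[OF q(1-3)] q kite_E_def by algebra
  show S: "inv_S w = z^2"
    unfolding inv_centered(2)[OF q(1-3)] H q unfolding z_def kite_E_def by algebra
  show G: "inv_G w = 9 * inv_H w^3 + 263671875 * (1728 * (l * m)^2 * (l^2 + 1) * (m^2 + 1) - 576 * kite_E l m * (l * m)^2)"
    unfolding inv_centered(3)[OF q(1-3)] H q unfolding kite_E_def by algebra
  show "quad_U w = z * quad_V w"
    unfolding quad_U_def quad_V_def S G H inv_T_centered[OF q(1-3)] Let_def q mult_1 mult_1_right power_one
    unfolding z_def kite_E_def by algebra
qed

lemma peval_quad_poly_affm: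
  assumes "a * d - b * c \<noteq> 0"
  shows "peval (act (affm a b c d e f) m) quad_poly = (a * d - b * c)^12 * peval m quad_poly"
  unfolding peval_quad_poly inv_affm[OF assms] by algebra

lemma peval_quad_poly_kite:
  assumes "1 + l \<noteq> 0" "1 + m \<noteq> 0"
  shows "peval (qmoment (kite l m)) quad_poly = 0"
  unfolding peval_quad_poly kite_invariants[OF assms] by algebra

text \<open>The parameters of the normal form are the ratios in which the diagonals cut each other.\<close>
lemma quadrilateral_normal_form:
  fixes X :: "complex^2^4"
  assumes o: "orient (X$1) (X$2) (X$3) \<noteq> 0" "orient (X$1) (X$2) (X$4) \<noteq> 0" and q: "quad_sum (\<lambda>_. 1) X \<noteq> 0"
  obtains A t l m where "X = affine_image A t (kite l m)" "A$1$1 * A$2$2 - A$1$2 * A$2$1 \<noteq> 0" "1 + l \<noteq> 0" "1 + m \<noteq> 0"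
proof -
  define p r s u where "p = X$1" and "r = X$2" and "s = X$3" and "u = X$4"
  \<comment> \<open>Twice the signed areas of the four triangles spanned by three of the
    vertices.\<close>
  define \<alpha> \<beta> \<gamma> \<delta> where "\<alpha> = orient p r s" and "\<beta> = orient p r u" and "\<gamma> = orient r s u" and "\<delta> = orient p s u"
  define i where "i = 1 / (\<alpha> + \<delta>)"
  have D: "\<alpha> + \<delta> \<noteq> 0" using q by (simp add: quad_sum_one \<alpha>_def \<delta>_def p_def r_def s_def u_def)
  have sum: "\<beta> + \<gamma> = \<alpha> + \<delta>" by (simp add: \<alpha>_def \<beta>_def \<gamma>_def \<delta>_def orient_def algebra_simps)
  have i: "i * (\<alpha> + \<delta>) = 1" "i \<noteq> 0" using D by (simp_all add: i_def)
  have nz: "\<alpha> \<noteq> 0" "\<beta> \<noteq> 0" using o by (simp_all add: \<alpha>_def \<beta>_def p_def r_def s_def u_def)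
  define l m where "l = \<gamma> / \<beta>" and "m = \<delta> / \<alpha>"
  have l: "l * \<beta> = \<gamma>" and m: "m * \<alpha> = \<delta>" using nz by (simp_all add: l_def m_def)
  \<comment> \<open>The vectors from the intersection \<open>w\<close> of the diagonals to
    \<open>p\<close> and \<open>r\<close>; then \<open>s\<close> and \<open>u\<close> are
    \<open>w - l f\<close> and \<open>w - m g\<close>.\<close>
  define f g where "f = (\<chi> k. \<beta> * (p$k - s$k) * i)" and "g = (\<chi> k. \<alpha> * (r$k - u$k) * i)"
  define w where "w = (\<chi> k. (\<gamma> * p$k + \<beta> * s$k) * i)"
  have w': "w$k = (\<delta> * r$k + \<alpha> * u$k) * i" for k
  proof -
    have "\<forall>k. \<gamma> * p$k + \<beta> * s$k = \<delta> * r$k + \<alpha> * u$k"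
      unfolding forall_2 \<alpha>_def \<beta>_def \<gamma>_def \<delta>_def orient_def by (intro conjI; algebra)
    then show ?thesis by (simp add: w_def)
  qed
  have wk: "w$k = (\<gamma> * p$k + \<beta> * s$k) * i" and fk: "f$k = \<beta> * (p$k - s$k) * i" and gk: "g$k = \<alpha> * (r$k - u$k) * i" for k
    by (simp_all add: w_def f_def g_def)
  have pts: "p$k = f$k + w$k" "s$k = w$k - l * f$k" "r$k = g$k + w$k" "u$k = w$k - m * g$k" for k
  proof -
    show "p$k = f$k + w$k" unfolding wk fk using i(1) sum by algebra
    show "s$k = w$k - l * f$k" unfolding wk fk using i(1) sum l by algebra
    show "r$k = g$k + w$k" unfolding w' gk using i(1) by algebra
    show "u$k = w$k - m * g$k" unfolding w' gk using i(1) m by algebra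
  qed
  define A where "A = vec2 (vec2 (f$1 / 30) (g$1 / 30)) (vec2 (f$2 / 30) (g$2 / 30))"
  define t where "t = (\<chi> k. w$k + (1 - l) / 3 * f$k + (1 - m) / 3 * g$k)"
  have "(A *v vec2 x y + t)$k = x / 30 * f$k + y / 30 * g$k + w$k + (1 - l) / 3 * f$k + (1 - m) / 3 * g$k" for x y k
  proof -
    have "\<forall>k. (A *v vec2 x y + t)$k = x / 30 * f$k + y / 30 * g$k + w$k + (1 - l) / 3 * f$k + (1 - m) / 3 * g$k"
      unfolding forall_2 by (simp add: A_def t_def matrix_vector_mult_def sum_2 mult.commute)
    then show ?thesis ..
  qed
  note comp = this
  have "X = affine_image A t (kite l m)"
  proof -
    have "X$1$k = (A *v kite l m $ 1 + t)$k" "X$2$k = (A *v kite l m $ 2 + t)$k"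
      "X$3$k = (A *v kite l m $ 3 + t)$k" "X$4$k = (A *v kite l m $ 4 + t)$k" for k
    proof -
      have "(20 + 10 * l) / 30 * x + (10 * m - 10) / 30 * y + z + (1 - l) / 3 * x + (1 - m) / 3 * y = x + z"
        "(- 10 - 20 * l) / 30 * x + (10 * m - 10) / 30 * y + z + (1 - l) / 3 * x + (1 - m) / 3 * y = z - l * x"
        "(10 * l - 10) / 30 * x + (20 + 10 * m) / 30 * y + z + (1 - l) / 3 * x + (1 - m) / 3 * y = y + z"
        "(10 * l - 10) / 30 * x + (- 10 - 20 * m) / 30 * y + z + (1 - l) / 3 * x + (1 - m) / 3 * y = z - m * y" for x y z
        by (simp_all add: field_simps)
      then show "X$1$k = (A *v kite l m $ 1 + t)$k" "X$2$k = (A *v kite l m $ 2 + t)$k"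
        "X$3$k = (A *v kite l m $ 3 + t)$k" "X$4$k = (A *v kite l m $ 4 + t)$k"
        unfolding kite_simps comp using pts[of k] unfolding p_def r_def s_def u_def by simp_all
    qed
    then show ?thesis by (simp add: affine_image_def vec_eq_iff forall_4)
  qed
  moreover have "A$1$1 * A$2$2 - A$1$2 * A$2$1 \<noteq> 0"
  proof -
    have "A$1$1 * A$2$2 - A$1$2 * A$2$1 = (f$1 * g$2 - g$1 * f$2) / 900"
      by (simp add: A_def field_simps)
    also have "f$1 * g$2 - g$1 * f$2 = \<alpha> * \<beta> * i^2 * ((p$1 - s$1) * (r$2 - u$2) - (r$1 - u$1) * (p$2 - s$2))"
      unfolding fk gk by algebra
    also have "(p$1 - s$1) * (r$2 - u$2) - (r$1 - u$1) * (p$2 - s$2) = \<alpha> + \<delta>"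
      unfolding \<alpha>_def \<delta>_def orient_def by algebra
    finally have det: "A$1$1 * A$2$2 - A$1$2 * A$2$1 = \<alpha> * \<beta> * i^2 * (\<alpha> + \<delta>) / 900" .
    show ?thesis unfolding det using nz i D by simp
  qed
  moreover have "1 + l \<noteq> 0" "1 + m \<noteq> 0"
    using D nz l m sum by (metis add.commute add_cancel_left_right add_eq_0_iff minus_mult_left mult_1)+
  ultimately show thesis by (rule that)
qed

section \<open>The equation holds at real quadrilaterals\<close>

definition cvec :: "real^2^4 \<Rightarrow> complex^2^4"
  where "cvec X = (\<chi> k l. complex_of_real (X$k$l))"

lemma quad_sum_cvec: "quad_sum (coord_monom x) (cvec X) = complex_of_real (quad_sum (coord_monom x) X)"
  by (simp add: quad_sum_def cubature_def orient_def coord_monom_def cvec_def)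

lemma moment_qmoment:
  assumes "quadrilateral X"
  shows "complex_of_real (moment (expo x) X) = qmoment (cvec X) x" "quad_sum (\<lambda>_. 1) (cvec X) \<noteq> 0"
  using moment_eq(1)[OF assms, of x] moment_eq(2)[OF assms] quad_sum_cvec[of x X] quad_sum_cvec[of M00 X]
  by (simp_all add: qmoment_def coord_monom_M00)

lemma peval_quad_poly_quadrilateral:
  assumes X: "quadrilateral X"
  shows "peval (qmoment (cvec X)) quad_poly = 0"
proof -
  obtain \<epsilon> where "positively_oriented \<epsilon> X" using quadrilateral_oriented[OF X] by blast
  then have "orient (X$1) (X$2) (X$3) \<noteq> 0" "orient (X$1) (X$2) (X$4) \<noteq> 0"
    by (auto simp: positively_oriented_def orient_cyc[of "X$4" "X$1" "X$2"])
  moreover have "orient (cvec X $ i) (cvec X $ j) (cvec X $ k) = of_real (orient (X$i) (X$j) (X$k))" for i j k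
    by (simp add: orient_def cvec_def)
  ultimately have "orient (cvec X$1) (cvec X$2) (cvec X$3) \<noteq> 0" "orient (cvec X$1) (cvec X$2) (cvec X$4) \<noteq> 0"
    by simp_all
  then obtain A t l m where *: "cvec X = affine_image A t (kite l m)" "A$1$1 * A$2$2 - A$1$2 * A$2$1 \<noteq> 0"
    "1 + l \<noteq> 0" "1 + m \<noteq> 0"
    using moment_qmoment(2)[OF X] by (rule quadrilateral_normal_form)
  have "A$1$1 * A$2$2 - A$2$1 * A$1$2 \<noteq> 0" using *(2) by (simp add: mult.commute)
  then show ?thesis
    unfolding *(1) qmoment_affine[OF *(2)] by (simp add: peval_quad_poly_affm peval_quad_poly_kite * mult.commute)
qed

subsection \<open>Generic points of the hypersurface are moment vectors\<close>

text \<open>After centring, the second moments form a binary quadratic form of determinant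
  \<open>inv_H\<close>. Being nondegenerate, it has an isotropic basis over the complex numbers, in
  which it becomes 2 x y.\<close>

lemma to_slice:
  assumes m: "m M00 = 1" and H: "inv_H m \<noteq> 0"
  obtains a b c d e f where "a * d - b * c \<noteq> 0"
    "act (affm a b c d e f) m M00 = 1" "act (affm a b c d e f) m M10 = 0" "act (affm a b c d e f) m M01 = 0"
    "act (affm a b c d e f) m M20 = 0" "act (affm a b c d e f) m M11 = 1" "act (affm a b c d e f) m M02 = 0"
proof -
  define m' where "m' = act (affm 1 0 0 1 (- m M10) (- m M01)) m"
  have m': "m' M00 = 1" "m' M10 = 0" "m' M01 = 0" by (simp_all add: m'_def act_affm m)
  have H': "inv_H m' \<noteq> 0" using H by (simp add: m'_def inv_H_affm)
  define q r p where "q = m' M20" and "r = m' M11" and "p = m' M02"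
  have Hq: "inv_H m' = q * p - r^2" by (simp add: inv_centered(1)[OF m'] q_def r_def p_def)
  have "\<exists>a b c d. a * d - b * c \<noteq> 0 \<and> a^2 * q + 2 * a * c * r + c^2 * p = 0 \<and> b^2 * q + 2 * b * d * r + d^2 * p = 0
    \<and> a * b * q + c * d * p + (a * d + b * c) * r = 1"
  proof (cases "q = 0")
    case True
    then have r: "r \<noteq> 0" using H' by (auto simp: Hq)
    define i where "i = 1 / r"
    have i: "i * r = 1" using r by (simp add: i_def)
    then have "i \<noteq> 0" by auto
    have "2 * (- p * i / 2) * r + p = 0" using i by (simp add: algebra_simps)
    then show ?thesis
      using True i \<open>i \<noteq> 0\<close> by (intro exI[of _ i] exI[of _ "- p * i / 2"] exI[of _ 0] exI[of _ 1]) simp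
  next
    case False
    define \<delta> where "\<delta> = csqrt (- inv_H m')"
    have \<delta>: "\<delta>^2 = r^2 - q * p" by (simp add: \<delta>_def Hq)
    define i h where "i = 1 / q" and "h = 1 / (2 * inv_H m')"
    have i: "i * q = 1" using False by (simp add: i_def)
    have h: "h * (2 * (q * p - r^2)) = 1" using H' Hq by (simp add: h_def)
    \<comment> \<open>The isotropic directions are the roots of q x^2 + 2 r x + p; the factor
      \<open>?k\<close> below normalizes their mutual product to 1.\<close>
    let ?x = "(- r + \<delta>) * i" and ?y = "(- r - \<delta>) * i"
    have x: "?x^2 * q + 2 * ?x * r + p = 0" and y: "?y^2 * q + 2 * ?y * r + p = 0"
      using i \<delta> by algebra+
    have xy: "?x * ?y * q + p + (?x + ?y) * r = 2 * (q * p - r^2) * i"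
      using i \<delta> by algebra
    let ?k = "h * q"
    have "?k * ?x * 1 - ?y * ?k = 2 * h * \<delta>" using i by algebra
    moreover have "h \<noteq> 0" using h by auto
    moreover have "\<delta> \<noteq> 0" using H' by (simp add: \<delta>_def)
    ultimately have "?k * ?x * 1 - ?y * ?k \<noteq> 0" by simp
    moreover have "(?k * ?x)^2 * q + 2 * (?k * ?x) * ?k * r + ?k^2 * p = 0" using x by algebra
    moreover have "?y^2 * q + 2 * ?y * 1 * r + 1^2 * p = 0" using y by simp
    moreover have "?k * ?x * ?y * q + ?k * 1 * p + (?k * ?x * 1 + ?y * ?k) * r = 1" using xy h i by algebra
    ultimately show ?thesis by blast
  qed
  then obtain a b c d where abcd: "a * d - b * c \<noteq> 0" "a^2 * q + 2 * a * c * r + c^2 * p = 0"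
    "b^2 * q + 2 * b * d * r + d^2 * p = 0" "a * b * q + c * d * p + (a * d + b * c) * r = 1" by blast
  have prod: "affm 1 0 0 1 (- m M10) (- m M01) ** affm a b c d 0 0 =
      affm a b c d (- m M10 * a - m M01 * c) (- m M10 * b - m M01 * d)"
    by (simp add: vec_eq_iff forall_3 matrix_matrix_mult_def sum_3)
  have "act (affm a b c d (- m M10 * a - m M01 * c) (- m M10 * b - m M01 * d)) m = act (affm a b c d 0 0) m'"
    unfolding prod[symmetric] act_mult m'_def ..
  moreover have "act (affm a b c d 0 0) m' M00 = 1" "act (affm a b c d 0 0) m' M10 = 0"
    "act (affm a b c d 0 0) m' M01 = 0" "act (affm a b c d 0 0) m' M20 = 0"
    "act (affm a b c d 0 0) m' M11 = 1" "act (affm a b c d 0 0) m' M02 = 0"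
    using abcd by (simp_all add: act_affm m' q_def r_def p_def algebra_simps)
  ultimately show thesis using that abcd(1) by metis
qed

definition on_slice :: "(mvar \<Rightarrow> complex) \<Rightarrow> bool"
  where "on_slice m \<longleftrightarrow> m M00 = 1 \<and> m M10 = 0 \<and> m M01 = 0 \<and> m M20 = 0 \<and> m M11 = 1 \<and> m M02 = 0"

text \<open>With a, b, c, d for the third moments \<open>M30\<close>, \<open>M21\<close>,
  \<open>M12\<close>, \<open>M03\<close>, the invariants g, s and t determine successively b c, a d
  and a c^3 + b^3 d.\<close>

lemma slice_invariants:
  assumes "on_slice m"
  shows "inv_H m = -1" "inv_S m = 1 + m M21 * m M12 - m M30 * m M03" "inv_G m = - 9 - 8 * m M21 * m M12"
    "inv_T m = - 8 + (m M30 * m M03)^2 - 6 * (m M30 * m M03) * (m M21 * m M12) - 3 * (m M21 * m M12)^2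
      + 4 * (m M21^3 * m M03 + m M30 * m M12^3) - 12 * (m M21 * m M12) - 20 * (m M30 * m M03)"
proof -
  have m: "m M00 = 1" "m M10 = 0" "m M01 = 0" "m M20 = 0" "m M11 = 1" "m M02 = 0"
    using assms by (auto simp: on_slice_def)
  show H: "inv_H m = -1" by (simp add: inv_centered(1)[OF m(1-3)] m)
  show "inv_S m = 1 + m M21 * m M12 - m M30 * m M03" by (simp add: inv_centered(2)[OF m(1-3)] H m)
  show "inv_G m = - 9 - 8 * m M21 * m M12" by (simp add: inv_centered(3)[OF m(1-3)] H m)
  show "inv_T m = - 8 + (m M30 * m M03)^2 - 6 * (m M30 * m M03) * (m M21 * m M12) - 3 * (m M21 * m M12)^2
      + 4 * (m M21^3 * m M03 + m M30 * m M12^3) - 12 * (m M21 * m M12) - 20 * (m M30 * m M03)"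
    unfolding inv_T_centered[OF m(1-3)] H Let_def m by (simp add: power_mult_distrib algebra_simps)
qed

text \<open>Scaling the two coordinates by k and 1/k preserves the slice and aligns
  \<open>M21\<close> and \<open>M12\<close>. Then a c^3 and b^3 d have the same sum and product for
  both cubics, so they agree up to order, and an exchange of the coordinates corrects the
  order.\<close>

lemma slice_orbit:
  assumes s: "on_slice m" "on_slice m'" and v: "m M21 * m M12 = m' M21 * m' M12" "m' M21 * m' M12 \<noteq> 0"
    and u: "m M30 * m M03 = m' M30 * m' M03"
    and w: "m M30 * m M12^3 + m M21^3 * m M03 = m' M30 * m' M12^3 + m' M21^3 * m' M03"
    and G: "m \<in> moment_vectors"
  shows "m' \<in> moment_vectors"
proof -
  have z: "m M00 = 1" "m M10 = 0" "m M01 = 0" "m M20 = 0" "m M11 = 1" "m M02 = 0"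
    "m' M00 = 1" "m' M10 = 0" "m' M01 = 0" "m' M20 = 0" "m' M11 = 1" "m' M02 = 0"
    using s by (auto simp: on_slice_def)
  define k where "k = m' M21 / m M21"
  have nz: "m M21 \<noteq> 0" "m M12 \<noteq> 0" "m' M21 \<noteq> 0" "m' M12 \<noteq> 0" using v by auto
  then have "k \<noteq> 0" by (simp add: k_def)
  define j where "j = 1 / k"
  have kj: "k * j = 1" using \<open>k \<noteq> 0\<close> by (simp add: j_def)
  define n where "n = act (affm k 0 0 j 0 0) m"
  have nG: "n \<in> moment_vectors" unfolding n_def using kj by (intro moment_vectors_act G) simp
  have kb: "k * m M21 = m' M21" using nz by (simp add: k_def)
  have jc: "j * m M12 = m' M12"
  proof -
    have "m' M21 * (j * m M12) = (k * j) * (m M21 * m M12)" unfolding kb[symmetric] by algebra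
    then have "m' M21 * (j * m M12) = m' M21 * m' M12" using kj v(1) by simp
    with nz show ?thesis by simp
  qed
  have n: "n M00 = 1" "n M10 = 0" "n M01 = 0" "n M20 = 0" "n M11 = 1" "n M02 = 0"
    "n M30 = k^3 * m M30" "n M21 = m' M21" "n M12 = m' M12" "n M03 = j^3 * m M03"
  proof -
    show "n M00 = 1" "n M10 = 0" "n M01 = 0" "n M20 = 0" "n M11 = 1" "n M02 = 0"
      using kj by (simp_all add: n_def act_affm z)
    show "n M30 = k^3 * m M30" "n M03 = j^3 * m M03"
      by (simp_all add: n_def act_def sum_3 power3_eq_cube)
    have "n M21 = k * m M21 * (k * j)" "n M12 = j * m M12 * (k * j)"
      by (simp_all add: n_def act_def sum_3)
    then show "n M21 = m' M21" "n M12 = m' M12" using kj kb jc by simp_all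
  qed
  have u': "n M30 * n M03 = m' M30 * m' M03"
  proof -
    have "n M30 * n M03 = (k * j)^3 * (m M30 * m M03)" unfolding n by algebra
    then show ?thesis using u kj by simp
  qed
  have w': "n M30 * m' M12^3 + m' M21^3 * n M03 = m' M30 * m' M12^3 + m' M21^3 * m' M03"
  proof -
    have "n M30 * m' M12^3 + m' M21^3 * n M03 = (k * j)^3 * (m M30 * m M12^3 + m M21^3 * m M03)"
      unfolding n kb[symmetric] jc[symmetric] by algebra
    then show ?thesis using w kj by simp
  qed
  have "(n M30 * m' M12^3 - m' M30 * m' M12^3) * (n M30 * m' M12^3 - m' M21^3 * m' M03) = 0"
    using u' w' by algebra
  then consider "n M30 * m' M12^3 = m' M30 * m' M12^3" | "n M30 * m' M12^3 = m' M21^3 * m' M03" by auto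
  then show ?thesis
  proof cases
    case 1
    then have a: "n M30 = m' M30" using nz by simp
    then have "n M03 = m' M03" using w' nz by simp
    have "n x = m' x" for x
      by (cases x) (use n z a \<open>n M03 = m' M03\<close> in simp_all)
    then have "n = m'" by blast
    with nG show ?thesis by simp
  next
    case 2
    then have 3: "m' M21^3 * n M03 = m' M30 * m' M12^3" using w' by algebra
    \<comment> \<open>The substitution below exchanges u_1 and u_2, rescaled so that
      \<open>M21\<close> and \<open>M12\<close> keep their values.\<close>
    define l g where "l = m' M21 / m' M12" and "g = m' M12 / m' M21"
    have lg: "l * g = 1" "l * m' M12 = m' M21" "g * m' M21 = m' M12" using nz by (simp_all add: l_def g_def)
    define p where "p = act (affm 0 g l 0 0 0) n"
    have pG: "p \<in> moment_vectors" unfolding p_def using lg nz by (intro moment_vectors_act nG) (auto simp: mult.commute)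
    have p1: "p M00 = 1" "p M10 = 0" "p M01 = 0" "p M20 = 0" "p M11 = 1" "p M02 = 0"
      using lg by (simp_all add: p_def act_affm n mult.commute)
    have "p M30 = l^3 * n M03" "p M03 = g^3 * n M30" "p M21 = (l * g) * (l * n M12)" "p M12 = (l * g) * (g * n M21)"
      by (simp_all add: p_def act_def sum_3 power3_eq_cube)
    then have p2: "p M30 = l^3 * n M03" "p M03 = g^3 * n M30" "p M21 = m' M21" "p M12 = m' M12"
      using lg n by simp_all
    have "m' M12^3 * (l^3 * n M03) = m' M12^3 * m' M30" using 3 lg(2) by algebra
    then have "p M30 = m' M30" using nz p2 by simp
    moreover have "m' M21^3 * (g^3 * n M30) = m' M21^3 * m' M03" using 2 lg(3) by algebra
    then have "p M03 = m' M03" using nz p2 by simp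
    ultimately have "p x = m' x" for x
      by (cases x) (use p1 p2 z in simp_all)
    then have "p = m'" by blast
    with pG show ?thesis by simp
  qed
qed

text \<open>Unknowns are A = l + 1/l and B = m + 1/m: the ratio of z to h gives E = A B + 2 (A + B),
  then g gives P = A B, so A and B solve a quadratic equation, and so do l and m. The first
  hypothesis makes E finite and different from -4, which keeps l and m away from -1 because (A + 2)
  (B + 2) = E + 4.\<close>

lemma exists_kite:
  assumes "25 * z^2 \<noteq> 9 * h^2" "h \<noteq> 0"
  obtains l m k where "1 + l \<noteq> 0" "1 + m \<noteq> 0" "kite_E l m \<noteq> 0" "k \<noteq> 0"
    "1875 * kite_E l m = k * h" "1125 * (kite_E l m + 8 * l * m) = k * z"
    "9 * (1875 * kite_E l m)^3 + 263671875 * (1728 * (l * m)^2 * (l^2 + 1) * (m^2 + 1) - 576 * kite_E l m * (l * m)^2) = k^3 * g"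
proof -
  have zh: "5 * z - 3 * h \<noteq> 0" "5 * z + 3 * h \<noteq> 0"
    using assms(1) by algebra+
  \<comment> \<open>Dividing the first two target equations gives 5 z E = 3 h (E + 8).\<close>
  define E where "E = 24 * h / (5 * z - 3 * h)"
  have E: "E * (5 * z - 3 * h) = 24 * h" "E \<noteq> 0" using zh assms(2) by (simp_all add: E_def)
  have E4: "E + 4 \<noteq> 0"
  proof
    assume "E + 4 = 0"
    then have "4 * (5 * z + 3 * h) = 0" using E(1) by algebra
    then show False using zh unfolding mult_eq_0_iff by simp
  qed
  define i where "i = 1 / h"
  have i: "i * h = 1" using assms(2) by (simp add: i_def)
  \<comment> \<open>The third target equation divided by 263671875 (l m)^3, where 1875^3 = 25 *
    263671875.\<close>
  define P where "P = (25 * (g * i^3 - 9) * E^3 + 576 * E) / 1728"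
  have P: "1728 * P = 25 * (g * i^3 - 9) * E^3 + 576 * E" by (simp add: P_def)
  define \<sigma> where "\<sigma> = (E - P) / 2"
  have \<sigma>: "2 * \<sigma> = E - P" by (simp add: \<sigma>_def)
  define r where "r = csqrt (\<sigma>^2 - 4 * P)"
  have r: "r^2 = \<sigma>^2 - 4 * P" by (simp add: r_def)
  define A B where "A = (\<sigma> + r) / 2" and "B = (\<sigma> - r) / 2"
  have "2 * A = \<sigma> + r" "2 * B = \<sigma> - r" by (simp_all add: A_def B_def)
  then have AB: "A + B = \<sigma>" "A * B = P" using r by algebra+
  have root: "\<exists>l. l^2 + 1 = C * l" for C :: complex
  proof -
    define y where "y = csqrt (C^2 - 4)"
    have "y^2 = C^2 - 4" by (simp add: y_def)
    moreover define x where "x = (C + y) / 2"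
    then have "x * 2 = C + y" by simp
    ultimately have "4 * (x^2 + 1) = 4 * (C * x)" by algebra
    then have "x^2 + 1 = C * x" by (metis mult_left_cancel zero_neq_numeral)
    then show ?thesis by blast
  qed
  obtain l m where l: "l^2 + 1 = A * l" and m: "m^2 + 1 = B * m" using root by metis
  have lm: "l \<noteq> 0" "m \<noteq> 0" using l m by auto
  have ABE: "A * B + 2 * (A + B) = E" unfolding AB \<sigma> by simp
  have "(A + 2) * (B + 2) = A * B + 2 * (A + B) + 4" by algebra
  then have "(A + 2) * (B + 2) = E + 4" unfolding ABE .
  then have AB2: "A + 2 \<noteq> 0" "B + 2 \<noteq> 0" using E4 by auto
  have "(1 + l)^2 = (A + 2) * l" "(1 + m)^2 = (B + 2) * m" using l m by algebra+
  then have 1: "1 + l \<noteq> 0" "1 + m \<noteq> 0" using AB2 lm by auto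
  have K: "kite_E l m = l * m * E"
    unfolding kite_E_def l m ABE[symmetric] by algebra
  define k where "k = 1875 * l * m * E * i"
  show thesis
  proof (rule that[of l m k])
    show "kite_E l m \<noteq> 0" using K lm E by simp
    show "k \<noteq> 0" using lm E i unfolding k_def by auto
    show "1875 * kite_E l m = k * h" unfolding K k_def using i by algebra
    show "1125 * (kite_E l m + 8 * l * m) = k * z" unfolding K k_def using i E(1) by algebra
    have 2: "(l * m)^2 * (l^2 + 1) * (m^2 + 1) = (l * m)^3 * P"
      unfolding l m AB(2)[symmetric] by algebra
    have "9 * (1875 * kite_E l m)^3 + 263671875 * (1728 * (l * m)^2 * (l^2 + 1) * (m^2 + 1) - 576 * kite_E l m * (l * m)^2)
      = 9 * 1875^3 * (l * m * E)^3 + 263671875 * ((l * m)^3 * (1728 * P) - 576 * (l * m)^3 * E)"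
      unfolding K using 2 by algebra
    also have "\<dots> = k^3 * g" unfolding P k_def by algebra
    finally show "9 * (1875 * kite_E l m)^3 + 263671875 * (1728 * (l * m)^2 * (l^2 + 1) * (m^2 + 1) - 576 * kite_E l m * (l * m)^2) = k^3 * g" .
  qed (use 1 in auto)
qed

text \<open>As \<open>quad_V m\<close> is nonzero, \<open>quad_U m / quad_V m\<close> is a square
  root z of s. A kite shares h, z and g with \<open>m\<close> up to scaling; the relation between
  \<open>quad_U\<close> and \<open>quad_V\<close> then matches t too. On the slice these invariants
  decide the orbit.\<close>

lemma hypersurface_point_is_moment_vector:
  assumes m: "m M00 = 1" and F: "peval m quad_poly = 0" and H: "inv_H m \<noteq> 0" and V: "quad_V m \<noteq> 0"
    and Z: "25 * inv_S m \<noteq> 9 * inv_H m^2" and G: "inv_G m \<noteq> 9 * inv_H m^3"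
  shows "m \<in> moment_vectors"
proof -
  define z where "z = quad_U m / quad_V m"
  have U: "quad_U m = z * quad_V m" using V by (simp add: z_def)
  have "quad_V m^2 * (z^2 - inv_S m) = 0"
    using F unfolding peval_quad_poly U by algebra
  then have S: "inv_S m = z^2" using V by simp
  have "25 * z^2 \<noteq> 9 * inv_H m^2" using Z S by simp
  then obtain l n k where ln: "1 + l \<noteq> 0" "1 + n \<noteq> 0" "kite_E l n \<noteq> 0" "k \<noteq> 0"
    and k: "1875 * kite_E l n = k * inv_H m" "1125 * (kite_E l n + 8 * l * n) = k * z"
    "9 * (1875 * kite_E l n)^3 + 263671875 * (1728 * (l * n)^2 * (l^2 + 1) * (n^2 + 1) - 576 * kite_E l n * (l * n)^2) = k^3 * inv_G m"
    using H by (rule exists_kite)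
  define w where "w = qmoment (kite l n)"
  have w: "inv_H w = k * inv_H m" "inv_S w = (k * z)^2" "inv_G w = k^3 * inv_G m" "quad_U w = (k * z) * quad_V w" "w M00 = 1"
    using kite_invariants[OF ln(1,2)] k qmoment_kite(1)[OF ln(1,2)] unfolding w_def[symmetric] by simp_all
  have "quad_sum (\<lambda>_. 1) (kite l n) \<noteq> 0"
    unfolding quad_sum_kite(1) using ln by (metis mult_eq_0_iff zero_neq_numeral)
  then have wG: "w \<in> moment_vectors"
    unfolding moment_vectors_def w_def by blast
  obtain a b c d e f where B: "a * d - b * c \<noteq> 0" and sl: "on_slice (act (affm a b c d e f) m)"
    using to_slice[OF m H] unfolding on_slice_def by metis
  have "inv_H w \<noteq> 0" using w H ln by simp
  then obtain a' b' c' d' e' f' where B': "a' * d' - b' * c' \<noteq> 0" and sl': "on_slice (act (affm a' b' c' d' e' f') w)"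
    using to_slice[of w, OF w(5)] unfolding on_slice_def by metis
  define p q where "p = act (affm a b c d e f) m" and "q = act (affm a' b' c' d' e' f') w"
  define D D' where "D = (a * d - b * c)^2" and "D' = (a' * d' - b' * c')^2"
  have p: "inv_H p = D * inv_H m" "inv_S p = (D * z)^2" "inv_G p = D^3 * inv_G m" "quad_U p = (D * z) * quad_V p"
    unfolding p_def D_def inv_H_affm inv_G_affm inv_affm[OF B] S U by algebra+
  have q: "inv_H q = D' * k * inv_H m" "inv_S q = (D' * k * z)^2" "inv_G q = (D' * k)^3 * inv_G m" "quad_U q = (D' * k * z) * quad_V q"
    unfolding q_def D'_def inv_H_affm inv_G_affm inv_affm[OF B'] w by algebra+
  note P = slice_invariants[OF sl, folded p_def] and Q = slice_invariants[OF sl', folded q_def]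
  \<comment> \<open>On the slice h is always -1, which forces the two determinants to compensate for
    \<open>k\<close>.\<close>
  have "D * inv_H m = D' * k * inv_H m" using p(1) q(1) P(1) Q(1) by metis
  then have DD: "D = D' * k" using H by simp
  have D0: "D \<noteq> 0" using B by (simp add: D_def)
  have S': "inv_S p = inv_S q" and G': "inv_G p = inv_G q" using p q DD by simp_all
  have v: "p M21 * p M12 = q M21 * q M12" using G' unfolding P Q by simp
  have u: "p M30 * p M03 = q M30 * q M03" using S' v unfolding P Q by simp
  have "p M00 = 1" "q M00 = 1" using sl sl' by (simp_all add: on_slice_def p_def q_def)
  then have "quad_V p = quad_V q" using S' P(1) Q(1) by (simp add: quad_V_def)
  then have "quad_U p = quad_U q" using p(4) q(4) DD by simp
  \<comment> \<open>\<open>quad_U\<close> is linear in \<open>inv_T\<close>, and its other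
    ingredients already agree.\<close>
  then have "inv_T p = inv_T q"
    using S' G' P(1) Q(1) \<open>p M00 = 1\<close> \<open>q M00 = 1\<close> by (simp add: quad_U_def)
  then have "4 * (q M30 * q M12^3 + q M21^3 * q M03) = 4 * (p M30 * p M12^3 + p M21^3 * p M03)"
    unfolding P(4) Q(4) u v by (simp add: algebra_simps)
  then have t: "q M30 * q M12^3 + q M21^3 * q M03 = p M30 * p M12^3 + p M21^3 * p M03"
    by (metis mult_left_cancel zero_neq_numeral)
  \<comment> \<open>The hypothesis on \<open>inv_G\<close> enters here: on the slice the excluded
    equality says that this product is 0, and \<open>slice_orbit\<close> divides by both
    factors.\<close>
  have "p M21 * p M12 \<noteq> 0"
  proof
    assume 0: "p M21 * p M12 = 0"
    then have "inv_G p = - 9" unfolding P(3) by (simp add: mult.assoc)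
    then have "inv_G p = 9 * inv_H p^3" by (simp add: P(1))
    then have "D^3 * inv_G m = D^3 * (9 * inv_H m^3)" unfolding p by algebra
    with D0 G show False by simp
  qed
  moreover have "q \<in> moment_vectors" unfolding q_def using wG B' by (rule moment_vectors_act)
  ultimately have "p \<in> moment_vectors"
    using slice_orbit[OF sl'[folded q_def] sl[folded p_def]] u v t by simp
  then show ?thesis unfolding p_def moment_vectors_act_iff[OF B] .
qed

subsection \<open>The moment image\<close>

definition coords :: "'a^2^4 \<Rightarrow> 4 \<times> 2 \<Rightarrow> 'a"
  where "coords X = (\<lambda>(k, l). X $ k $ l)"

text \<open>A closure property that yields numerators and denominators of the moments as polynomials
  without writing them out.\<close>

definition polyfun :: "(complex^2^4 \<Rightarrow> complex) \<Rightarrow> bool"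
  where "polyfun f \<longleftrightarrow> (\<exists>N. \<forall>X. f X = peval (coords X) N)"

lemma polyfun_const: "polyfun (\<lambda>_. c)"
  unfolding polyfun_def by (intro exI[of _ "Const c"]) simp

lemma polyfun_coord: "polyfun (\<lambda>X. X $ k $ l)"
  unfolding polyfun_def by (intro exI[of _ "Var (k, l)"]) (simp add: coords_def)

lemma polyfun_add: "polyfun f \<Longrightarrow> polyfun g \<Longrightarrow> polyfun (\<lambda>X. f X + g X)"
  unfolding polyfun_def by (metis peval_add)

lemma polyfun_diff: "polyfun f \<Longrightarrow> polyfun g \<Longrightarrow> polyfun (\<lambda>X. f X - g X)"
  unfolding polyfun_def by (metis peval_diff)

lemma polyfun_mult: "polyfun f \<Longrightarrow> polyfun g \<Longrightarrow> polyfun (\<lambda>X. f X * g X)"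
  unfolding polyfun_def by (metis peval_mult)

lemma polyfun_power: "polyfun f \<Longrightarrow> polyfun (\<lambda>X. f X ^ n)"
  unfolding polyfun_def by (metis peval_power)

lemma polyfun_divide: "polyfun f \<Longrightarrow> polyfun (\<lambda>X. f X / c)"
  using polyfun_mult[OF _ polyfun_const[of "1 / c"], of f] by simp

lemma polyfun_quad_sum: "polyfun (quad_sum (coord_monom x))"
  unfolding quad_sum_def[abs_def] cubature_def orient_def coord_monom_def vector_smult_component vector_add_component
  by (intro polyfun_add polyfun_diff polyfun_mult polyfun_divide polyfun_power polyfun_const polyfun_coord)

text \<open>Near the unit square every matrix is a quadrilateral.\<close>
lemma quadrilateral_polynomial_vanishes:
  fixes N :: "(4 \<times> 2, complex) mpoly"
  assumes "\<And>X. quadrilateral X \<Longrightarrow> peval (coords (cvec X)) N = 0"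
  shows "N = 0"
proof -
  define c :: "4 \<times> 2 \<Rightarrow> real" where
    "c = (\<lambda>(k, l). if l = 1 then (if k = 2 \<or> k = 3 then 1 else 0) else (if k = 3 \<or> k = 4 then 1 else 0))"
  define S where "S kl = complex_of_real ` {c kl - 1 / 10 .. c kl + 1 / 10}" for kl
  show ?thesis
  proof (rule peval_box_vanishes[where S = S])
    show "infinite (S kl)" for kl
      unfolding S_def by (subst finite_image_iff) (auto simp: inj_on_def infinite_Icc)
  next
    fix a assume "\<And>kl. a kl \<in> S kl"
    have "\<forall>kl. \<exists>r. a kl = complex_of_real r \<and> \<bar>r - c kl\<bar> \<le> 1 / 10"
    proof
      fix kl
      from \<open>a kl \<in> S kl\<close> obtain r where r: "a kl = complex_of_real r" "c kl - 1 / 10 \<le> r" "r \<le> c kl + 1 / 10"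
        by (auto simp: S_def)
      from r(2,3) have "\<bar>r - c kl\<bar> \<le> 1 / 10" by (simp only: abs_le_iff) linarith
      with r(1) show "\<exists>r. a kl = complex_of_real r \<and> \<bar>r - c kl\<bar> \<le> 1 / 10" by blast
    qed
    then obtain r where r: "\<And>kl. a kl = complex_of_real (r kl)" "\<And>kl. \<bar>r kl - c kl\<bar> \<le> 1 / 10" by metis
    define X :: "real^2^4" where "X = (\<chi> k l. r (k, l))"
    have a: "a = coords (cvec X)" by (auto simp: coords_def cvec_def X_def r(1))
    have X: "\<bar>X$1$1\<bar> \<le> 1 / 10" "\<bar>X$1$2\<bar> \<le> 1 / 10" "\<bar>X$2$1 - 1\<bar> \<le> 1 / 10" "\<bar>X$2$2\<bar> \<le> 1 / 10"
      "\<bar>X$3$1 - 1\<bar> \<le> 1 / 10" "\<bar>X$3$2 - 1\<bar> \<le> 1 / 10" "\<bar>X$4$1\<bar> \<le> 1 / 10" "\<bar>X$4$2 - 1\<bar> \<le> 1 / 10"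
      using r(2)[of "(1, 1)"] r(2)[of "(1, 2)"] r(2)[of "(2, 1)"] r(2)[of "(2, 2)"]
        r(2)[of "(3, 1)"] r(2)[of "(3, 2)"] r(2)[of "(4, 1)"] r(2)[of "(4, 2)"]
      by (simp_all add: X_def c_def)
    \<comment> \<open>Near the unit square each orientation has the form x y - u v, with x y at
      least 16/25 and u v at most 6/25 in absolute value.\<close>
    have pos: "x * y - u * v > 0" if "x \<ge> 4 / 5" "y \<ge> 4 / 5" "\<bar>u\<bar> \<le> 1 / 5" "\<bar>v\<bar> \<le> 6 / 5" for x y u v :: real
    proof -
      have "4 / 5 * (4 / 5) \<le> x * y" using that by (intro mult_mono) auto
      moreover have "\<bar>u * v\<bar> \<le> 1 / 5 * (6 / 5)" unfolding abs_mult using that by (intro mult_mono) auto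
      ultimately show ?thesis by linarith
    qed
    have "orient (X$1) (X$2) (X$3) > 0" "orient (X$3) (X$4) (X$1) > 0" "orient (X$2) (X$3) (X$4) > 0" "orient (X$4) (X$1) (X$2) > 0"
    proof -
      have "(X$2$1 - X$1$1) * (X$3$2 - X$1$2) - (X$2$2 - X$1$2) * (X$3$1 - X$1$1) > 0"
        "(X$3$1 - X$4$1) * (X$3$2 - X$1$2) - (X$4$2 - X$3$2) * (X$1$1 - X$3$1) > 0"
        "(X$3$2 - X$2$2) * (X$2$1 - X$4$1) - (X$2$1 - X$3$1) * (X$4$2 - X$2$2) > 0"
        "(X$4$2 - X$1$2) * (X$2$1 - X$4$1) - (X$4$1 - X$1$1) * (X$2$2 - X$4$2) > 0"
        by (rule pos; insert X, simp only: abs_le_iff, linarith)+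
      then show "orient (X$1) (X$2) (X$3) > 0" "orient (X$3) (X$4) (X$1) > 0" "orient (X$2) (X$3) (X$4) > 0" "orient (X$4) (X$1) (X$2) > 0"
        by (simp_all add: orient_def algebra_simps)
    qed
    then have "positively_oriented 1 X" by (simp add: positively_oriented_def)
    then show "peval a N = 0"
      unfolding a by (intro assms positively_oriented_quadrilateral)
  qed
qed

lemma extends_moment_iff:
  "extends_moment e N D \<longleftrightarrow> D \<noteq> 0 \<and> (\<forall>X. quadrilateral X \<longrightarrow> peval (coords (cvec X)) D \<noteq> 0 \<longrightarrow>
    complex_of_real (moment e X) = peval (coords (cvec X)) N / peval (coords (cvec X)) D)"
proof -
  have "(\<lambda>(k, l). complex_of_real (X $ k $ l)) = coords (cvec X)" for X :: "real^2^4"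
    by (auto simp: coords_def cvec_def)
  then show ?thesis unfolding extends_moment_def Let_def by simp
qed

lemma moment_value_iff:
  "moment_value e X v \<longleftrightarrow> (\<exists>N D. extends_moment e N D \<and> peval (coords X) D \<noteq> 0 \<and> v = peval (coords X) N / peval (coords X) D)"
  by (simp add: moment_value_def coords_def Let_def)

lemma moment_vectors_subset_image: "moment_vectors \<subseteq> moment_image"
proof
  fix v assume "v \<in> moment_vectors"
  then obtain X where X: "v = qmoment X" "quad_sum (\<lambda>_. 1) X \<noteq> 0" by (auto simp: moment_vectors_def)
  obtain N where N: "\<And>x (X :: complex^2^4). quad_sum (coord_monom x) X = peval (coords X) (N x)"
  proof -
    have "\<exists>N. \<forall>x (X :: complex^2^4). quad_sum (coord_monom x) X = peval (coords X) (N x)"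
      by (rule choice) (use polyfun_quad_sum in \<open>auto simp: polyfun_def\<close>)
    then show ?thesis using that by blast
  qed
  have D: "quad_sum (\<lambda>_. 1) X = peval (coords X) (N M00)" for X :: "complex^2^4"
    using N[of M00] by (simp add: coord_monom_M00)
  have "N M00 \<noteq> 0" using X(2) D[of X] by auto
  then have "extends_moment (expo x) (N x) (N M00)" for x
    unfolding extends_moment_iff by (auto simp: moment_qmoment qmoment_def D N)
  then have "moment_value (expo x) X (v x)" for x
    unfolding moment_value_iff using X by (intro exI[of _ "N x"] exI[of _ "N M00"]) (auto simp: qmoment_def D N)
  then show "v \<in> moment_image" by (auto simp: moment_image_def)
qed

lemma peval_heval_Const: "peval a (heval Const W p) = peval (\<lambda>x. peval a (W x)) p"
proof -
  interpret C: semiring_hom Const by (rule semiring_hom_Const)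
  show ?thesis
    by (induction p rule: mpoly_induct) (simp_all add: C.heval_add C.heval_mult)
qed

text \<open>Clearing denominators turns the value of the polynomial at a point of the image into a polynomial
  in the vertices, which vanishes because it does so on the Zariski dense set of quadrilaterals.\<close>
lemma quad_poly_vanishes_on_image:
  assumes "v \<in> moment_image"
  shows "peval v quad_poly = 0"
proof -
  from assms obtain X where "\<forall>x. moment_value (expo x) X (v x)" by (auto simp: moment_image_def)
  then obtain N D where ND: "\<And>x. extends_moment (expo x) (N x) (D x)"
    and v: "\<And>x. peval (coords X) (D x) \<noteq> 0" "\<And>x. v x = peval (coords X) (N x) / peval (coords X) (D x)"
    unfolding moment_value_iff by metis
  define DD where "DD = (\<Prod>x\<in>UNIV. D x)"
  define W where "W x = N x * (\<Prod>y\<in>UNIV - {x}. D y)" for x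
  have pprod: "peval a (\<Prod>x\<in>A. D x) = (\<Prod>x\<in>A. peval a (D x))" if "finite A" for a A
    using that by (induction A rule: finite_induct) auto
  have W: "peval a (W x) = peval a DD * (peval a (N x) / peval a (D x))" if "peval a (D x) \<noteq> 0" for a x
  proof -
    have "peval a DD = peval a (D x) * (\<Prod>y\<in>UNIV - {x}. peval a (D y))"
      unfolding DD_def by (simp add: pprod prod.remove[of UNIV x])
    then show ?thesis using that by (simp add: W_def pprod)
  qed
  have hom: "peval (\<lambda>x. c * f x) quad_poly = c^18 * peval f quad_poly" for c f
    using peval_weighted[OF whomogeneous_quad_poly(1), of c f] by simp
  have "heval Const W quad_poly * DD = 0"
  proof (rule quadrilateral_polynomial_vanishes)
    fix Y :: "real^2^4" assume Y: "quadrilateral Y"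
    let ?a = "coords (cvec Y)"
    show "peval ?a (heval Const W quad_poly * DD) = 0"
    proof (cases "peval ?a DD = 0")
      case False
      then have nz: "peval ?a (D x) \<noteq> 0" for x
        by (auto simp: DD_def pprod)
      then have "peval ?a (N x) / peval ?a (D x) = qmoment (cvec Y) x" for x
        using ND[of x] Y by (simp add: extends_moment_iff moment_qmoment)
      then have "peval ?a (W x) = peval ?a DD * qmoment (cvec Y) x" for x
        by (simp only: W[OF nz])
      then have "peval ?a (heval Const W quad_poly) = (peval ?a DD)^18 * peval (qmoment (cvec Y)) quad_poly"
        by (simp add: peval_heval_Const hom)
      then show ?thesis by (simp add: peval_quad_poly_quadrilateral[OF Y])
    qed simp
  qed
  then have "peval (coords X) (heval Const W quad_poly) * peval (coords X) DD = 0"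
    by (metis peval_mult peval_zero)
  moreover have DD: "peval (coords X) DD \<noteq> 0" using v(1) by (simp add: DD_def pprod)
  moreover have "peval (coords X) (heval Const W quad_poly) = peval (coords X) DD^18 * peval v quad_poly"
  proof -
    have "(\<lambda>x. peval (coords X) (W x)) = (\<lambda>x. peval (coords X) DD * v x)"
      using W v by auto
    then show ?thesis by (simp add: peval_heval_Const hom)
  qed
  ultimately show ?thesis by simp
qed

subsection \<open>A line with eighteen good points\<close>

text \<open>A degree bound together with the coefficient there, which may be 0; in contrast to
  \<open>degree\<close>, it is exactly additive under products over any commutative
  semiring.\<close>

definition bounded_coeffs :: "nat \<Rightarrow> 'a::comm_semiring_1 \<Rightarrow> 'a poly \<Rightarrow> bool"
  where "bounded_coeffs n c p \<longleftrightarrow> (\<forall>i>n. coeff p i = 0) \<and> coeff p n = c"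

lemma bounded_coeffs_add:
  "bounded_coeffs n a p \<Longrightarrow> bounded_coeffs n b q \<Longrightarrow> bounded_coeffs n (a + b) (p + q)"
  by (simp add: bounded_coeffs_def)

lemma bounded_coeffs_mult:
  assumes "bounded_coeffs n a p" "bounded_coeffs k b q"
  shows "bounded_coeffs (n + k) (a * b) (p * q)"
proof -
  have "coeff (p * q) i = 0" if "i > n + k" for i
    unfolding coeff_mult
  proof (intro sum.neutral ballI)
    fix j assume "j \<in> {..i}"
    then have "j > n \<or> i - j > k" using that by auto
    then show "coeff p j * coeff q (i - j) = 0" using assms by (auto simp: bounded_coeffs_def)
  qed
  moreover have "coeff (p * q) (n + k) = (\<Sum>j\<in>{n}. coeff p j * coeff q (n + k - j))"
    unfolding coeff_mult
  proof (intro sum.mono_neutral_right ballI)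
    fix j assume "j \<in> {..n + k} - {n}"
    then have "j > n \<or> n + k - j > k" by auto
    then show "coeff p j * coeff q (n + k - j) = 0" using assms by (auto simp: bounded_coeffs_def)
  qed auto
  ultimately show ?thesis using assms by (simp add: bounded_coeffs_def)
qed

lemma bounded_coeffs_power: "bounded_coeffs n a p \<Longrightarrow> bounded_coeffs (n * k) (a ^ k) (p ^ k)"
  by (induction k) (auto simp: bounded_coeffs_def[of 0 1] intro: bounded_coeffs_mult)

lemma bounded_coeffs_prod:
  "finite A \<Longrightarrow> (\<And>x. x \<in> A \<Longrightarrow> bounded_coeffs (n x) (a x) (p x)) \<Longrightarrow>
    bounded_coeffs (sum n A) (prod a A) (prod p A)"
  by (induction A rule: finite_induct) (auto simp: bounded_coeffs_def[of 0 1] intro: bounded_coeffs_mult)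

lemma bounded_coeffs_sum:
  "finite A \<Longrightarrow> (\<And>x. x \<in> A \<Longrightarrow> bounded_coeffs n (a x) (p x)) \<Longrightarrow> bounded_coeffs n (sum a A) (sum p A)"
  by (induction A rule: finite_induct) (auto simp: bounded_coeffs_def[of _ 0] intro: bounded_coeffs_add)

text \<open>Long division uses only the inverse \<open>u\<close> of the leading coefficient, so it
  works over a polynomial ring.\<close>

lemma division_by_unit_lead:
  fixes f :: "'a::comm_ring_1 poly"
  assumes f: "bounded_coeffs n a f" and u: "u * a = 1" and n: "n > 0"
  shows "\<exists>q r. p = q * f + r \<and> degree r < n"
proof -
  have "\<exists>q r. p = q * f + r \<and> degree r < n" if "\<forall>i\<ge>k. coeff p i = 0" for k p
    using that
  proof (induction k arbitrary: p)
    case 0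
    then have "p = 0" by (auto simp: poly_eq_iff)
    then show ?case using n by (intro exI[of _ 0]) auto
  next
    case (Suc k)
    show ?case
    proof (cases "k < n")
      case True
      then have "degree p \<le> k" using Suc.prems by (intro degree_le) auto
      then show ?thesis using True by (intro exI[of _ 0] exI[of _ p]) auto
    next
      case False
      define g where "g = monom (coeff p k * u) (k - n)"
      have "bounded_coeffs (k - n) (coeff p k * u) g" by (simp add: g_def bounded_coeffs_def)
      from bounded_coeffs_mult[OF this f] have "bounded_coeffs k (coeff p k) (g * f)"
        using False u by (simp add: mult.assoc)
      then have "coeff (p - g * f) i = 0" if "i \<ge> k" for i
        using Suc.prems that by (cases "i = k") (auto simp: bounded_coeffs_def)
      then have "\<forall>i\<ge>k. coeff (p - g * f) i = 0" by blast
      from Suc.IH[OF this] obtain q r where "p - g * f = q * f + r" "degree r < n" by blast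
      then show ?thesis by (intro exI[of _ "q + g"] exI[of _ r]) (auto simp: algebra_simps)
    qed
  qed
  from this[of "Suc (degree p)" p] show ?thesis by (simp add: coeff_eq_0)
qed

text \<open>The cubic - u_1^3 + u_2^3 + u_3^3, at which s, h and g vanish and t is 1. Hence the
  equation has the value 125^2 there, which is its leading coefficient along every line in this
  direction.\<close>

definition dir :: "mvar \<Rightarrow> complex"
  where "dir x = (case x of M00 \<Rightarrow> 1 | M30 \<Rightarrow> -1 | M03 \<Rightarrow> 1 | _ \<Rightarrow> 0)"

text \<open>The cubic 3 (u_1^2 u_3 - u_1 u_2^2 + u_2 u_3^2). Multiplying u_2 by a cube root of unity
  and u_3 by its square fixes \<open>dir\<close> and multiplies this cubic by a cube root of unity;
  this is why the equation on the base line depends on y^3 only.\<close>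

definition bpt :: "mvar \<Rightarrow> complex"
  where "bpt x = (case x of M01 \<Rightarrow> 1 | M20 \<Rightarrow> 1 | M12 \<Rightarrow> -1 | _ \<Rightarrow> 0)"

text \<open>The base point stays generic: the coefficients are polynomials in its coordinates, and
  the variable is the parameter along \<open>dir\<close>.\<close>

definition along :: "moment_poly \<Rightarrow> moment_poly poly"
  where "along p = heval (\<lambda>c. [:Const c:]) (\<lambda>x. [:Var x, Const (dir x):]) p"

interpretation along: semiring_hom "\<lambda>c. [:Const c:] :: moment_poly poly"
  by unfold_locales (simp_all add: semiring_hom.hom_zero[OF semiring_hom_Const] semiring_hom.hom_one[OF semiring_hom_Const]
      semiring_hom.hom_add[OF semiring_hom_Const] semiring_hom.hom_mult[OF semiring_hom_Const] one_pCons)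

lemma peval_along: "peval a (poly (along p) (Const y)) = peval (\<lambda>x. a x + y * dir x) p"
  unfolding along_def
  by (induction p rule: mpoly_induct) (simp_all add: along.heval_add along.heval_mult)

lemma bounded_coeffs_along:
  assumes "homogeneous d p"
  shows "bounded_coeffs d (Const (peval dir p)) (along p)"
proof -
  interpret C: semiring_hom "Const :: complex \<Rightarrow> moment_poly" by (rule semiring_hom_Const)
  have m: "bounded_coeffs (wdeg (\<lambda>_. 1) m) (meval (\<lambda>x. Const (dir x)) m) (meval (\<lambda>x. [:Var x, Const (dir x):] :: moment_poly poly) m)" for m
    unfolding meval_def wdeg_def
  proof (intro bounded_coeffs_prod)
    fix x show "bounded_coeffs (1 * Poly_Mapping.lookup m x) (Const (dir x) ^ Poly_Mapping.lookup m x)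
        ([:Var x, Const (dir x):] ^ Poly_Mapping.lookup m x)"
      by (intro bounded_coeffs_power) (auto simp: bounded_coeffs_def coeff_pCons split: nat.split)
  qed simp
  have "bounded_coeffs d (Const c * meval (\<lambda>x. Const (dir x)) m) ([:Const c:] * meval (\<lambda>x. [:Var x, Const (dir x):]) m)"
    if "m \<in> Poly_Mapping.keys p" for c m
  proof -
    have "bounded_coeffs 0 (Const c) [:Const c:]" by (simp add: bounded_coeffs_def coeff_pCons split: nat.split)
    from bounded_coeffs_mult[OF this m[of m]] show ?thesis
      using assms that by (simp add: homogeneous_def)
  qed
  then have "bounded_coeffs d (heval Const (\<lambda>x. Const (dir x)) p) (along p)"
    unfolding along_def heval_def by (intro bounded_coeffs_sum) auto
  moreover have "heval Const (\<lambda>x. Const (dir x)) p = (Const (peval dir p) :: moment_poly)"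
    by (induction p rule: mpoly_induct) (simp_all add: C.heval_add C.heval_mult C.hom_add C.hom_mult)
  ultimately show ?thesis by simp
qed

definition specialize :: "(mvar \<Rightarrow> complex) \<Rightarrow> moment_poly poly \<Rightarrow> complex poly"
  where "specialize a q = map_poly (peval a) q"

lemma coeff_specialize: "coeff (specialize a q) i = peval a (coeff q i)"
  by (simp add: specialize_def coeff_map_poly)

lemma poly_specialize: "poly (specialize a q) y = peval a (poly q (Const y))"
  unfolding specialize_def by (induction q) (simp_all add: map_poly_pCons)

lemma continuous_on_peval [continuous_intros]:
  fixes p :: "('v, complex) mpoly" and a :: "'t::topological_space \<Rightarrow> 'v \<Rightarrow> complex"
  assumes "\<And>x. continuous_on A (\<lambda>z. a z x)"
  shows "continuous_on A (\<lambda>z. peval (a z) p)"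
  by (induction p rule: mpoly_induct) (simp_all add: assms continuous_on_add continuous_on_mult)

text \<open>At the points of the hypersurface where this polynomial does not vanish, the description of the
  moment vectors applies.\<close>
definition excl :: "(mvar \<Rightarrow> 'a::comm_ring_1) \<Rightarrow> 'a"
  where "excl m = m M00 * inv_H m * quad_V m * (25 * m M00^2 * inv_S m - 9 * inv_H m^2)
    * (m M00 * inv_G m - 9 * inv_H m^3)"

lemma peval_excl: "peval a (excl Var) = excl a" for a :: "mvar \<Rightarrow> complex"
  by (simp add: excl_def peval_inv peval_quad_UV)

text \<open>The equation, \<open>p\<close> and all factors of \<open>excl\<close> are homogeneous,
  so the point can be scaled to have first coordinate 1.\<close>

lemma vanishes_at_good_point:
  assumes p: "homogeneous d p" "\<And>v. v \<in> moment_vectors \<Longrightarrow> peval v p = 0"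
    and m: "peval m quad_poly = 0" "excl m \<noteq> 0"
  shows "peval m p = 0"
proof -
  define c where "c = m M00"
  define n where "n x = m x / c" for x
  have c: "c \<noteq> 0" using m(2) by (auto simp: excl_def c_def)
  have mn: "m = (\<lambda>x. c ^ 1 * n x)" using c by (auto simp: n_def)
  note w = whomogeneous_inv[of 1 0 0, simplified, THEN peval_weighted, of c n, unfolded peval_inv]
  have inv: "inv_S m = c^4 * inv_S n" "inv_H m = c^3 * inv_H n" "inv_G m = c^8 * inv_G n"
    using w by (simp_all add: mn)
  have n1: "n M00 = 1" using c by (simp add: n_def c_def)
  have V: "quad_V m = c^7 * quad_V n"
    unfolding quad_V_def inv n1 c_def[symmetric] power_one mult_1_left mult_1_right by algebra
  have "n \<in> moment_vectors"
  proof (rule hypersurface_point_is_moment_vector)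
    show "n M00 = 1" by (rule n1)
    have "peval m quad_poly = c ^ 18 * peval n quad_poly"
      using peval_weighted[OF whomogeneous_quad_poly(1), of c n] by (simp add: mn)
    then show "peval n quad_poly = 0" using m(1) c by simp
    show "inv_H n \<noteq> 0" "quad_V n \<noteq> 0" using m(2) by (auto simp: excl_def inv V)
    show "25 * inv_S n \<noteq> 9 * inv_H n^2"
    proof
      assume "25 * inv_S n = 9 * inv_H n^2"
      then have "25 * m M00^2 * inv_S m - 9 * inv_H m^2 = 0"
        unfolding inv c_def[symmetric] by algebra
      then show False using m(2) by (simp add: excl_def)
    qed
    show "inv_G n \<noteq> 9 * inv_H n^3"
    proof
      assume "inv_G n = 9 * inv_H n^3"
      then have "m M00 * inv_G m - 9 * inv_H m^3 = 0"
        unfolding inv c_def[symmetric] by algebra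
      then show False using m(2) by (simp add: excl_def)
    qed
  qed
  then have "peval n p = 0" by (rule p(2))
  then show ?thesis
    using peval_weighted[OF p(1)[unfolded homogeneous_iff_whomogeneous], of c n] by (simp add: mn)
qed

section \<open>The equation and the open conditions on the base line\<close>

lemma peval_dir_quad_poly: "peval dir quad_poly = 15625"
  by (simp add: peval_quad_poly quad_U_def quad_V_def inv_S_def inv_T_def inv_G_defs dir_def)

lemma quad_poly_base_line:
  "peval (\<lambda>x. bpt x + y * dir x) quad_poly = 2125764 + 2834352 * y^3 - 5113935 * (y^3)^2 - 288900 * (y^3)^3
    + 2687850 * (y^3)^4 + 427500 * (y^3)^5 + 15625 * (y^3)^6"
  by (simp add: peval_quad_poly quad_U_def quad_V_def inv_S_def inv_T_def inv_G_defs dir_def bpt_def) algebra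

lemma excl_base_line:
  "excl (\<lambda>x. bpt x + y * dir x) = - (y^2) * (162 - 1050 * y^3) * (- 9 - 75 * y^3) * (9 + 6 * y^3 + (y^3)^2)"
  by (simp add: excl_def quad_V_def inv_S_def inv_T_def inv_G_defs dir_def bpt_def) algebra

text \<open>With Y = y^3, each claim says that a polynomial has no common zero with the equation,
  because some combination of the two is a nonzero constant. The last polynomial is the derivative
  by Y, so the six zeros in Y are simple and nonzero and give eighteen in y.\<close>

lemma base_line_good:
  fixes Y :: complex
  assumes F: "2125764 + 2834352 * Y - 5113935 * Y^2 - 288900 * Y^3 + 2687850 * Y^4 + 427500 * Y^5 + 15625 * Y^6 = 0"
  shows "Y \<noteq> 0" "162 - 1050 * Y \<noteq> 0" "- 9 - 75 * Y \<noteq> 0" "9 + 6 * Y + Y^2 \<noteq> 0"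
    "2834352 - 10227870 * Y - 866700 * Y^2 + 10751400 * Y^3 + 2137500 * Y^4 + 93750 * Y^5 \<noteq> 0"
proof -
  show "Y \<noteq> 0" using F by auto
  show "162 - 1050 * Y \<noteq> 0"
  proof
    assume "162 - 1050 * Y = 0"
    then have "(26932404887617536 :: complex) = 0" using F by algebra
    then show False by simp
  qed
  show "- 9 - 75 * Y \<noteq> 0"
  proof
    assume "- 9 - 75 * Y = 0"
    then have "(80299081728 :: complex) = 0" using F by algebra
    then show False by simp
  qed
  show "9 + 6 * Y + Y^2 \<noteq> 0"
  proof
    assume "9 + 6 * Y + Y^2 = 0"
    then have "(967458816 :: complex) = 0" using F by algebra
    then show False by simp
  qed
  show "2834352 - 10227870 * Y - 866700 * Y^2 + 10751400 * Y^3 + 2137500 * Y^4 + 93750 * Y^5 \<noteq> 0"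
    (is "?D \<noteq> 0")
  proof
    assume D: "?D = 0"
    \<comment> \<open>Cofactors of a Bezout identity between the polynomial and its derivative, with
      integer coefficients.\<close>
    let ?A = "26153135039124988560 + 29897932414152730950 * Y - 14784372325481358150 * Y^2
      - 3790215151482543750 * Y^3 - 176749822937906250 * Y^4"
    let ?B = "10456033114941904404 - 10845580079514506220 * Y - 7561758268786058775 * Y^2
      + 3971067345358569225 * Y^3 + 766032390679899375 * Y^4 + 29458303822984375 * Y^5"
    let ?F = "2125764 + 2834352 * Y - 5113935 * Y^2 - 288900 * Y^3 + 2687850 * Y^4 + 427500 * Y^5 + 15625 * Y^6"
    have "?A * ?F + ?B * ?D = 85231471324712308812546048"
      by (simp add: algebra_simps eval_nat_numeral)
    then show False unfolding F D by simp
  qed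
qed

section \<open>Deformation of the base line\<close>

definition pencil :: "(mvar \<Rightarrow> complex) \<Rightarrow> complex \<Rightarrow> mvar \<Rightarrow> complex"
  where "pencil a t x = bpt x + t * (a x - bpt x)"

definition restriction :: "(mvar \<Rightarrow> complex) \<Rightarrow> complex poly"
  where "restriction a = specialize a (along quad_poly)"

lemma poly_restriction: "poly (restriction a) y = peval (\<lambda>x. a x + y * dir x) quad_poly"
  by (simp add: restriction_def poly_specialize peval_along)

lemma coeff_restriction: "i > 18 \<Longrightarrow> coeff (restriction a) i = 0" "coeff (restriction a) 18 = 15625"
  using bounded_coeffs_along[OF homogeneous_quad_poly]
  by (simp_all add: bounded_coeffs_def restriction_def coeff_specialize peval_dir_quad_poly)

lemma degree_restriction: "degree (restriction a) = 18"
  using coeff_restriction by (intro antisym degree_le le_degree) auto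

text \<open>The rule \<open>peval_dir_quad_poly\<close> makes the leading coefficient constant, so that the roots stay bounded.\<close>
lemma restriction_root_bound:
  assumes M: "\<And>i. i < 18 \<Longrightarrow> norm (coeff (restriction a) i) \<le> M" and y: "poly (restriction a) y = 0"
  shows "norm y \<le> max 1 (18 * M)"
proof (rule ccontr)
  assume "\<not> ?thesis"
  then have y1: "norm y > 1" "norm y > 18 * M" by auto
  have M0: "M \<ge> 0" using M[of 0] norm_ge_zero order_trans by (metis zero_less_numeral)
  have "poly (restriction a) y = (\<Sum>i<18. coeff (restriction a) i * y ^ i) + 15625 * y ^ 18"
  proof -
    have "{..18::nat} = insert 18 {..<18}" by auto
    then show ?thesis unfolding poly_altdef degree_restriction by (simp add: coeff_restriction)
  qed
  then have "15625 * y ^ 18 = - (\<Sum>i<18. coeff (restriction a) i * y ^ i)"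
    using y by (metis add.commute eq_neg_iff_add_eq_0)
  then have "15625 * norm y ^ 18 = norm (\<Sum>i<18. coeff (restriction a) i * y ^ i)"
    by (metis norm_minus_cancel norm_mult norm_numeral norm_power)
  also have "\<dots> \<le> (\<Sum>i<18::nat. M * norm y ^ 17)"
  proof (rule sum_norm_le)
    fix i :: nat assume "i \<in> {..<18}"
    then show "norm (coeff (restriction a) i * y ^ i) \<le> M * norm y ^ 17"
      unfolding norm_mult norm_power using y1 M0 by (intro mult_mono M power_increasing) auto
  qed
  also have "\<dots> = 18 * M * norm y ^ 17" by simp
  also have "\<dots> < norm y * norm y ^ 17" using y1 by (intro mult_strict_right_mono) auto
  also have "\<dots> = norm y ^ 18" by (simp flip: power_Suc)
  finally have "15625 * norm y ^ 18 < norm y ^ 18" .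
  moreover have "norm y ^ 18 \<ge> 0" by simp
  ultimately show False by linarith
qed

lemma poly_pderiv_restriction:
  "poly (pderiv (restriction a)) y = (\<Sum>i\<le>17. of_nat (Suc i) * coeff (restriction a) (Suc i) * y ^ i)"
  by (simp add: poly_altdef degree_pderiv degree_restriction coeff_pderiv)

text \<open>Zeros on the deformed lines that are multiple or violate the open conditions. The bound
  on the parameter serves compactness.\<close>

definition bad_pairs :: "(mvar \<Rightarrow> complex) \<Rightarrow> (complex \<times> complex) set"
  where "bad_pairs a = {z. norm (fst z) \<le> 1 \<and> poly (restriction (pencil a (fst z))) (snd z) = 0 \<and>
    poly (pderiv (restriction (pencil a (fst z)))) (snd z) * excl (\<lambda>x. pencil a (fst z) x + snd z * dir x) = 0}"

lemma continuous_on_coeff_restriction [continuous_intros]: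
  fixes f :: "'t::topological_space \<Rightarrow> complex"
  assumes "continuous_on A f"
  shows "continuous_on A (\<lambda>z. coeff (restriction (pencil a (f z))) i)"
  unfolding restriction_def coeff_specialize pencil_def by (intro continuous_intros assms)

lemma closed_bad_pairs: "closed (bad_pairs a)"
proof -
  have c: "continuous_on UNIV (\<lambda>z :: complex \<times> complex. peval (\<lambda>x. pencil a (fst z) x + snd z * dir x) p)" for p
    unfolding pencil_def by (intro continuous_intros)
  have d: "continuous_on UNIV (\<lambda>z :: complex \<times> complex. poly (pderiv (restriction (pencil a (fst z)))) (snd z))"
    unfolding poly_pderiv_restriction by (intro continuous_intros)
  show ?thesis
    unfolding bad_pairs_def poly_restriction
    by (intro closed_Collect_conj closed_Collect_le closed_Collect_eq continuous_intros c d
        c[of "excl Var", unfolded peval_excl])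
qed

lemma bounded_bad_pairs: "bounded (bad_pairs a)"
proof -
  have "\<exists>M. \<forall>t\<in>cball 0 1. norm (coeff (restriction (pencil a t)) i) \<le> M" for i
  proof -
    have "compact ((\<lambda>t. coeff (restriction (pencil a t)) i) ` cball 0 1)"
      by (intro compact_continuous_image continuous_intros compact_cball)
    then show ?thesis by (auto dest!: compact_imp_bounded simp: bounded_iff)
  qed
  then obtain M where M: "\<And>i t. norm t \<le> 1 \<Longrightarrow> norm (coeff (restriction (pencil a t)) i) \<le> M i"
    by (metis mem_cball_0)
  have M': "norm (coeff (restriction (pencil a t)) i) \<le> Max (M ` {..<18})" if "norm t \<le> 1" "i < 18" for t i
    using M[OF that(1), of i] that(2) by (meson Max_ge finite_imageI finite_lessThan imageI lessThan_iff order_trans)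
  have "bad_pairs a \<subseteq> cball 0 1 \<times> cball 0 (max 1 (18 * Max (M ` {..<18})))"
    using restriction_root_bound[OF M'] by (auto simp: bad_pairs_def)
  then show ?thesis using bounded_Times[OF bounded_cball bounded_cball] bounded_subset by blast
qed

lemma no_bad_root_at_0: "(0, y) \<notin> bad_pairs a"
proof
  assume bad: "(0, y) \<in> bad_pairs a"
  have p: "pencil a 0 = bpt" by (rule ext) (simp add: pencil_def)
  let ?f = "[:2125764, 0, 0, 2834352, 0, 0, -5113935, 0, 0, -288900, 0, 0, 2687850, 0, 0, 427500, 0, 0, 15625:] :: complex poly"
  have "poly (restriction bpt) z = poly ?f z" for z
    unfolding poly_restriction quad_poly_base_line by simp algebra
  then have f: "restriction bpt = ?f" by (simp add: poly_eq_poly_eq_iff[symmetric] fun_eq_iff)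
  define Y where "Y = y^3"
  have F: "2125764 + 2834352 * Y - 5113935 * Y^2 - 288900 * Y^3 + 2687850 * Y^4 + 427500 * Y^5 + 15625 * Y^6 = 0"
    using bad unfolding bad_pairs_def p fst_conv snd_conv mem_Collect_eq poly_restriction quad_poly_base_line Y_def by blast
  note good = base_line_good[OF F]
  have y: "y \<noteq> 0" using good(1) by (auto simp: Y_def)
  have "poly (pderiv (restriction bpt)) y =
      3 * y^2 * (2834352 - 10227870 * Y - 866700 * Y^2 + 10751400 * Y^3 + 2137500 * Y^4 + 93750 * Y^5)"
    unfolding f Y_def by (simp add: pderiv_pCons) algebra
  then have "poly (pderiv (restriction bpt)) y \<noteq> 0" using good(5) y by simp
  moreover have "excl (\<lambda>x. bpt x + y * dir x) \<noteq> 0"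
    unfolding excl_base_line using good(2,3,4) y unfolding Y_def by simp
  ultimately show False using bad by (simp add: bad_pairs_def p)
qed

text \<open>The projection of the compact set \<open>bad_pairs a\<close> to the parameter is compact
  and misses 0, hence misses a neighbourhood of 0.\<close>

lemma good_roots_near_0:
  obtains \<delta> where "\<delta> > 0" "\<And>t y. norm t < \<delta> \<Longrightarrow> (t, y) \<notin> bad_pairs a"
proof -
  have "compact (fst ` bad_pairs a)"
    by (intro compact_continuous_image continuous_intros) (simp add: compact_eq_bounded_closed closed_bad_pairs bounded_bad_pairs)
  then have "open (- (fst ` bad_pairs a))" by (simp add: compact_imp_closed open_Compl)
  moreover have "0 \<in> - (fst ` bad_pairs a)" using no_bad_root_at_0 by force
  ultimately obtain e where e: "e > 0" "ball 0 e \<subseteq> - (fst ` bad_pairs a)" by (meson open_contains_ball)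
  show thesis
  proof (rule that[OF e(1)])
    fix t y :: complex assume "norm t < e"
    then have "t \<notin> fst ` bad_pairs a" using e(2) by auto
    then show "(t, y) \<notin> bad_pairs a" by force
  qed
qed

lemma restriction_18_roots:
  assumes "norm t \<le> 1" "\<And>y. (t, y) \<notin> bad_pairs a"
  shows "card {y. poly (restriction (pencil a t)) y = 0} = 18"
proof -
  let ?f = "restriction (pencil a t)"
  have "rsquarefree ?f"
    unfolding rsquarefree_roots using assms by (auto simp: bad_pairs_def)
  from complex_poly_decompose_rsquarefree[OF this]
  have "?f = smult 15625 (\<Prod>z|poly ?f z = 0. [:-z, 1:])"
    by (simp add: degree_restriction coeff_restriction)
  then have "degree ?f = degree (\<Prod>z|poly ?f z = 0. [:-z, 1:])"
    by (metis degree_smult_eq zero_neq_numeral)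
  also have "\<dots> = card {y. poly ?f y = 0}"
    by (subst degree_prod_eq_sum_degree) auto
  finally show ?thesis by (simp add: degree_restriction)
qed

text \<open>Divide by \<open>quad_poly\<close> along the direction \<open>dir\<close>: for parameters near the base line, the remainder has
  eighteen roots and degree less than eighteen.\<close>
lemma quad_poly_dvd:
  assumes p: "homogeneous d p" "\<And>v. v \<in> moment_vectors \<Longrightarrow> peval v p = 0"
  shows "quad_poly dvd p"
proof -
  have "bounded_coeffs 18 (Const 15625) (along quad_poly)"
    using bounded_coeffs_along[OF homogeneous_quad_poly] by (simp add: peval_dir_quad_poly)
  moreover have "Const (1 / 15625) * Const 15625 = (1 :: moment_poly)"
    by (simp add: semiring_hom.hom_mult[OF semiring_hom_Const, symmetric] semiring_hom.hom_one[OF semiring_hom_Const] del: Const_numeral)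
  ultimately obtain q r where qr: "along p = q * along quad_poly + r" "degree r < 18"
    using division_by_unit_lead[of 18 _ "along quad_poly"] by (metis zero_less_numeral)
  have r: "poly (specialize a r) y = peval (\<lambda>x. a x + y * dir x) p - poly (specialize a q) y * poly (restriction a) y" for a y
    using arg_cong[OF qr(1), of "\<lambda>f. peval a (poly f (Const y))"]
    by (simp add: peval_along poly_specialize poly_restriction)
  have "peval a (coeff r i) = 0" for a i
  proof -
    obtain \<delta> where \<delta>: "\<delta> > 0" "\<And>t y. norm t < \<delta> \<Longrightarrow> (t, y) \<notin> bad_pairs a"
      using good_roots_near_0 by blast
    define T where "T = ball (0::complex) (min \<delta> 1)"
    have T: "infinite T" unfolding T_def using \<delta>(1) by (simp add: uncountable_infinite uncountable_ball)
    have "peval (pencil a t) (coeff r i) = 0" if "t \<in> T" for t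
    proof -
      let ?g = "specialize (pencil a t) r"
      have t: "norm t \<le> 1" "\<And>y. (t, y) \<notin> bad_pairs a" using that \<delta>(2) by (auto simp: T_def)
      have "poly ?g y = 0" if y: "poly (restriction (pencil a t)) y = 0" for y
      proof -
        have "excl (\<lambda>x. pencil a t x + y * dir x) \<noteq> 0" using t y by (auto simp: bad_pairs_def)
        from vanishes_at_good_point[OF p _ this] y show ?thesis by (simp add: r poly_restriction)
      qed
      then have sub: "{y. poly (restriction (pencil a t)) y = 0} \<subseteq> {y. poly ?g y = 0}" by blast
      have "?g = 0"
      proof (rule ccontr)
        assume g: "?g \<noteq> 0"
        have "18 \<le> card {y. poly ?g y = 0}"
          using card_mono[OF poly_roots_finite[OF g] sub] restriction_18_roots[OF t] by simp
        also have "\<dots> \<le> degree ?g" by (rule card_poly_roots_bound[OF g])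
        also have "\<dots> \<le> degree r" by (auto simp: coeff_specialize coeff_eq_0 intro: degree_le)
        finally show False using qr(2) by simp
      qed
      then show ?thesis by (metis coeff_specialize coeff_0)
    qed
    \<comment> \<open>The coefficient vanishes for small \<open>t\<close> on the line from
      \<open>bpt\<close> to \<open>a\<close>, hence for all \<open>t\<close>; at
      \<open>t = 1\<close> this is the arbitrary point \<open>a\<close>.\<close>
    from peval_line_vanishes[OF T, of bpt "\<lambda>x. a x - bpt x" "coeff r i" 1] this
    show ?thesis by (simp add: pencil_def[abs_def])
  qed
  then have "r = 0" by (intro poly_eqI) (simp add: peval_eq_0_imp_zero)
  \<comment> \<open>At parameter 0, \<open>along\<close> returns the original polynomial.\<close>
  then have "p = quad_poly * poly q 0"
  proof (intro peval_inject)
    have zero: "peval a (poly (along f) 0) = peval a f" for a f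
      using peval_along[of a f 0] by simp
    fix a show "peval a p = peval a (quad_poly * poly q 0)"
      using arg_cong[OF qr(1), of "\<lambda>f. peval a (poly f 0)"] \<open>r = 0\<close> by (simp add: zero)
  qed
  then show ?thesis by simp
qed

subsection \<open>The moment variety\<close>

lemma quad_poly_nonzero: "quad_poly \<noteq> 0"
  using card_keys_quad_poly by auto

lemma moment_variety_eq: "moment_variety = proj_zeros {quad_poly}"
proof
  show "moment_variety \<subseteq> proj_zeros {quad_poly}"
    unfolding moment_variety_def proj_closure_def proj_zeros_def
    using homogeneous_quad_poly quad_poly_vanishes_on_image by blast
  show "proj_zeros {quad_poly} \<subseteq> moment_variety"
  proof
    fix v assume v: "v \<in> proj_zeros {quad_poly}"
    have "peval v p = 0" if "homogeneous d p" "\<forall>w\<in>moment_image. peval w p = 0" for d p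
    proof -
      have "quad_poly dvd p"
        using that moment_vectors_subset_image by (intro quad_poly_dvd) auto
      then show ?thesis using v by (auto simp: proj_zeros_def elim!: dvdE)
    qed
    then show "v \<in> moment_variety"
      using v by (auto simp: moment_variety_def proj_closure_def proj_zeros_def)
  qed
qed

text \<open>A polynomial of the ideal may be inhomogeneous. Since the zero set is a cone, the
  homogeneous components vanish on the moment vectors as well, and divisibility is applied to each
  of them.\<close>

lemma vanishing_ideal_moment_variety: "vanishing_ideal moment_variety = {p. quad_poly dvd p}"
proof (intro equalityI subsetI CollectI)
  fix p assume "p \<in> {p. quad_poly dvd p}"
  then show "p \<in> vanishing_ideal moment_variety"
    by (auto simp: vanishing_ideal_def moment_variety_eq proj_zeros_def elim!: dvdE)
next
  fix p assume p: "p \<in> vanishing_ideal moment_variety"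
  have comp: "quad_poly dvd wcomponent (\<lambda>_. 1) d p" for d
  proof (rule quad_poly_dvd)
    show "homogeneous d (wcomponent (\<lambda>_. 1) d p)"
      by (simp add: homogeneous_iff_whomogeneous whomogeneous_wcomponent)
    fix v assume v: "v \<in> moment_vectors"
    then have v0: "v M00 = 1" by (auto simp: moment_vectors_def qmoment_def coord_monom_M00)
    show "peval v (wcomponent (\<lambda>_. 1) d p) = 0"
    proof (rule wcomponent_vanishes)
      show "infinite (- {0 :: complex})" by (simp add: Compl_eq_Diff_UNIV infinite_UNIV_char_0)
      fix t :: complex assume t: "t \<in> - {0}"
      have "peval (\<lambda>x. t ^ 1 * v x) quad_poly = 0"
        using peval_weighted[OF whomogeneous_quad_poly(1), of t v] v moment_vectors_subset_image
        by (auto simp: quad_poly_vanishes_on_image)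
      moreover have "(\<lambda>x. t ^ 1 * v x) \<noteq> (\<lambda>_. 0)"
        using t v0 by (auto simp: fun_eq_iff intro!: exI[of _ M00])
      ultimately show "peval (\<lambda>x. t ^ 1 * v x) p = 0"
        using p unfolding vanishing_ideal_def moment_variety_eq proj_zeros_def by blast
    qed
  qed
  have "quad_poly dvd (\<Sum>d\<in>wdeg (\<lambda>_. 1) ` Poly_Mapping.keys p. wcomponent (\<lambda>_. 1) d p)"
    by (intro dvd_sum comp)
  then show "quad_poly dvd p" by (simp add: sum_wcomponent)
qed

theorem theorem6p3:
  shows "(\<exists>s t h g. affine_s s \<and> affine_t t \<and> affine_h h \<and> affine_g g) \<and>
    (\<forall>s t h g. affine_s s \<and> affine_t t \<and> affine_h h \<and> affine_g g \<longrightarrow>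
      (let F = quad_equation s t h g in
        hypersurface_with_equation moment_variety F \<and>
        card (Poly_Mapping.keys F) = 5100 \<and>
        (\<forall>m\<in>Poly_Mapping.keys F. z3_degree m = (18, 12, 12))))"
proof -
  have "hypersurface_with_equation moment_variety quad_poly"
    unfolding hypersurface_with_equation_def
    using quad_poly_nonzero homogeneous_quad_poly moment_variety_eq vanishing_ideal_moment_variety
    by (metis zero_less_numeral)
  then show ?thesis
    unfolding affine_s_iff affine_t_iff affine_h_iff affine_g_iff Let_def
    using card_keys_quad_poly z3_degree_quad_poly by (auto simp flip: quad_poly_def)
qed

end
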